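(* Let $m,n\ge1$, let $\lambda\in\mathbb Z$, and let $\tilde\Lambda(\lambda)$ be the $\widehat{gl}_{m|n}$-highest weight (with respect to the standard Borel subalgebra) $$\tilde\Lambda(\lambda)=\begin{cases}\tilde\epsilon_1+\cdots+\tilde\epsilon_\lambda+\tilde\Lambda_0,&0\le\lambda\le m,\\ \tilde\epsilon_1+\cdots+\tilde\epsilon_m+(\lambda-m)\tilde\delta_1+\tilde\Lambda_0,&\lambda>m,\\ \lambda\tilde\delta_n+\tilde\Lambda_0,&\lambda<0.\end{cases}$$ Then $$\mathrm{ch}\,L(\widehat{gl}_{m|n},\tilde\Lambda(\lambda))=q^{-\frac{|\lambda|}{2}}\sum_{\mu-\nu=\lambda}HS_\mu(\mathbf{zq};\mathbf{yq})\,HS_\nu(\mathbf z^{-1}\mathbf q;\mathbf y^{-1}\mathbf q),$$ where the sum is over $\mu,\nu\in\mathbb Z_+$ with $\mu-\nu=\lambda$ (each regarded as a one-row partition), $y_i=e^{\tilde\epsilon_i}$, $z_j=e^{\tilde\delta_j}$, $q=e^{-\tilde\delta}$, $\mathbf z^{\pm1}\mathbf q=\{z_j^{\pm1}q^s\mid j=1,\dots,n;\ s\in\frac12+\mathbb Z_+\}$ and $\mathbf y^{\pm1}\mathbf q=\{y_i^{\pm1}q^s\mid i=1,\dots,m;\ s\in\frac12+\mathbb Z_+\}$.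
   Context: $\mathbb Z_+=\{0,1,2,\dots\}$. $gl_{m|n}$ is the general linear Lie superalgebra of $\mathbb C^{m|n}$, with even basis $e_1,\dots,e_m$ and odd basis $f_1,\dots,f_n$; its elements are block matrices $\begin{pmatrix}E&a\\ b&e\end{pmatrix}$, with elementary matrices $E_{ij},a_{ij},b_{ij},e_{ij}$ in the respective blocks, and $\mathrm{Str}=\mathrm{Tr}(E)-\mathrm{Tr}(e)$. Its Cartan subalgebra is $\mathfrak h=\sum_i\mathbb CE_{ii}+\sum_j\mathbb Ce_{jj}$. The standard Borel subalgebra of $gl_{m|n}$ is the one of matrices that are upper triangular with respect to the ordered basis $e_1<\dots<e_m<f_1<\dots<f_n$. $\widehat{gl}_{m|n}=gl_{m|n}\otimes\mathbb C[t,t^{-1}]+\mathbb CC+\mathbb Cd$ with $A(k)=A\otimes t^k$, $[A(k),B(l)]=[A,B](k+l)+\delta_{k+l,0}\,k\,\mathrm{Str}(AB)C$, $[d,A(k)]=kA(k)$, $C$ central. Its Cartan subalgebra is $\hat{\mathfrak h}=\mathfrak h+\mathbb CC+\mathbb Cd$. Define elements of $\hat{\mathfrak h}^*$: $\tilde\epsilon_i$ is dual to $E_{ii}$ and $\tilde\delta_j$ is dual to $e_{jj}$ (each zero on all other $E_{kk},e_{kk}$ and on $C,d$); $\tilde\Lambda_0(C)=1$, $\tilde\Lambda_0(\mathfrak h)=\tilde\Lambda_0(d)=0$; $\tilde\delta(d)=1$, $\tilde\delta(\mathfrak h)=\tilde\delta(C)=0$. The standard Borel subalgebra of $\widehat{gl}_{m|n}$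 is $B+\mathbb CC+\mathbb Cd+gl_{m|n}\otimes t\mathbb C[t]$ with $B$ the standard Borel subalgebra of $gl_{m|n}$. $L(\widehat{gl}_{m|n},\Lambda)$ denotes the irreducible highest weight module of highest weight $\Lambda\in\hat{\mathfrak h}^*$. Its character is the formal sum of $\dim(L_\eta)e^\eta$ over the weights $\eta$ with respect to $\mathfrak h+\mathbb Cd$ (the action of $C$ is not recorded, i.e. the factor $e^{\tilde\Lambda_0}$ is omitted). For a partition $\lambda$ the hook Schur function is $HS_\lambda(\mathbf x;\mathbf y)=\sum_{\mu\subset\lambda}s_\mu(\mathbf x)s_{\lambda'/\mu'}(\mathbf y)$, where $s$ denotes (skew) Schur functions in the countable variable sets $\mathbf x,\mathbf y$, and $'$ denotes the conjugate partition; for $k\in\mathbb Z_+$, $HS_k$ means $HS_{(k)}$. *)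

theory Defs
  imports Complex_Main "HOL-Library.Function_Algebras" "HOL-Library.Product_Plus"
    "HOL-Library.Z2" "HOL-Library.FuncSet" "HOL-Library.Groups_Big_Fun"
begin

section \<open>The Lie superalgebra of block matrices\<close>

text \<open>
  The indices \<open>Ev 1, \<dots>, Ev m\<close> stand for the even basis vectors \<open>e\<^sub>1, \<dots>, e\<^sub>m\<close> and
  \<open>Od 1, \<dots>, Od n\<close> for the odd basis vectors \<open>f\<^sub>1, \<dots>, f\<^sub>n\<close>.  The blocks \<open>E, a, b, e\<close> of a
  matrix are its entries at \<open>(Ev, Ev)\<close>, \<open>(Ev, Od)\<close>, \<open>(Od, Ev)\<close>, \<open>(Od, Od)\<close>.
  Addition of matrices is pointwise; the pointwise product is never used.
\<close>

datatype idx = Ev nat | Od nat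

type_synonym smat = "idx \<Rightarrow> idx \<Rightarrow> complex"

definition idxs :: "nat \<Rightarrow> nat \<Rightarrow> idx set" where
  "idxs m n = Ev ` {1..m} \<union> Od ` {1..n}"

fun parity :: "idx \<Rightarrow> bit" where
  "parity (Ev i) = 0"
| "parity (Od j) = 1"

fun idx_less :: "idx \<Rightarrow> idx \<Rightarrow> bool" where
  "idx_less (Ev i) (Ev j) \<longleftrightarrow> i < j"
| "idx_less (Ev i) (Od j) \<longleftrightarrow> True"
| "idx_less (Od i) (Ev j) \<longleftrightarrow> False"
| "idx_less (Od i) (Od j) \<longleftrightarrow> i < j"

definition gl :: "nat \<Rightarrow> nat \<Rightarrow> smat set" where
  "gl m n = {A. \<forall>a b. A a b \<noteq> 0 \<longrightarrow> a \<in> idxs m n \<and> b \<in> idxs m n}"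

definition smat_mult :: "nat \<Rightarrow> nat \<Rightarrow> smat \<Rightarrow> smat \<Rightarrow> smat" where
  "smat_mult m n A B = (\<lambda>a b. \<Sum>c\<in>idxs m n. A a c * B c b)"

definition Str :: "nat \<Rightarrow> nat \<Rightarrow> smat \<Rightarrow> complex" where
  "Str m n A = (\<Sum>i=1..m. A (Ev i) (Ev i)) - (\<Sum>j=1..n. A (Od j) (Od j))"

definition smat_part :: "bit \<Rightarrow> smat \<Rightarrow> smat" where
  "smat_part p A = (\<lambda>a b. if parity a + parity b = p then A a b else 0)"

text \<open>The sign \<open>(-1)\<^sup>p\<^sup>q\<close>.\<close>

definition super_sign :: "bit \<Rightarrow> bit \<Rightarrow> complex" where
  "super_sign p q = (if p = 1 \<and> q = 1 then -1 else 1)"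

definition gl_bracket :: "nat \<Rightarrow> nat \<Rightarrow> smat \<Rightarrow> smat \<Rightarrow> smat" where
  "gl_bracket m n A B = (\<lambda>a b. \<Sum>p\<in>{0, 1}. \<Sum>q\<in>{0, 1}.
      smat_mult m n (smat_part p A) (smat_part q B) a b
      - super_sign p q * smat_mult m n (smat_part q B) (smat_part p A) a b)"


section \<open>The affine Lie superalgebra\<close>

text \<open>The triple \<open>(X, c, d)\<close> stands for \<open>(\<Sum>k. X k \<otimes> t\<^sup>k) + c C + d d\<close>.\<close>

type_synonym glhat = "(int \<Rightarrow> smat) \<times> complex \<times> complex"

definition glhat :: "nat \<Rightarrow> nat \<Rightarrow> glhat set" where
  "glhat m n = {(X, c, d). (\<forall>k. X k \<in> gl m n) \<and> finite {k. X k \<noteq> 0}}"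

definition glhat_scale :: "complex \<Rightarrow> glhat \<Rightarrow> glhat" where
  "glhat_scale s = (\<lambda>(X, c, d). (\<lambda>k a b. s * X k a b, s * c, s * d))"

definition glhat_bracket :: "nat \<Rightarrow> nat \<Rightarrow> glhat \<Rightarrow> glhat \<Rightarrow> glhat" where
  "glhat_bracket m n = (\<lambda>(X, c, d) (Y, c', d').
     (\<lambda>r a b. (\<Sum>k\<in>{k. X k \<noteq> 0}. gl_bracket m n (X k) (Y (r - k)) a b)
              + d * of_int r * Y r a b - d' * of_int r * X r a b,
      \<Sum>k\<in>{k. X k \<noteq> 0}. of_int k * Str m n (smat_mult m n (X k) (Y (- k))),
      0))"

definition glhat_part :: "nat \<Rightarrow> nat \<Rightarrow> bit \<Rightarrow> glhat set" where
  "glhat_part m n p = {(X, c, d) \<in> glhat m n.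
     (\<forall>k. smat_part p (X k) = X k) \<and> (p = 1 \<longrightarrow> c = 0 \<and> d = 0)}"

definition loop :: "smat \<Rightarrow> int \<Rightarrow> glhat" where
  "loop A k = (\<lambda>r. if r = k then A else 0, 0, 0)"

definition C_elt :: glhat where "C_elt = (0, 1, 0)"

definition d_elt :: glhat where "d_elt = (0, 0, 1)"

text \<open>The closed formula for the bracket agrees with the relations on generators.\<close>

lemma smat_mult_0 [simp]: "smat_mult m n 0 B = 0" "smat_mult m n A 0 = 0"
  by (auto simp: smat_mult_def fun_eq_iff)

lemma smat_part_0 [simp]: "smat_part p 0 = 0"
  by (auto simp: smat_part_def fun_eq_iff)

lemma Str_0 [simp]: "Str m n 0 = 0"
  by (simp add: Str_def)

lemma gl_bracket_0 [simp]: "gl_bracket m n 0 B = 0" "gl_bracket m n A 0 = 0"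
  by (auto simp: gl_bracket_def fun_eq_iff)

lemma gl_bracket_homogeneous:
  assumes "smat_part p A = A" "smat_part q B = B"
  shows "gl_bracket m n A B =
    (\<lambda>a b. smat_mult m n A B a b - super_sign p q * smat_mult m n B A a b)"
proof -
  have A: "smat_part p' A = (if p' = p then A else 0)" for p'
  proof (cases "p' = p")
    case False
    have "smat_part p' (smat_part p A) = 0"
      using False by (auto simp: smat_part_def fun_eq_iff)
    with False assms(1) show ?thesis by simp
  qed (simp add: assms)
  have B: "smat_part q' B = (if q' = q then B else 0)" for q'
  proof (cases "q' = q")
    case False
    have "smat_part q' (smat_part q B) = 0"
      using False by (auto simp: smat_part_def fun_eq_iff)
    with False assms(2) show ?thesis by simp
  qed (simp add: assms)
  show ?thesis
    by (cases p; cases q) (simp_all add: gl_bracket_def A B fun_eq_iff)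
qed

lemma loop_bracket_loop:
  "glhat_bracket m n (loop A k) (loop B l) =
     loop (gl_bracket m n A B) (k + l)
     + glhat_scale (if k + l = 0 then of_int k * Str m n (smat_mult m n A B) else 0) C_elt"
proof (cases "A = 0")
  case True
  show ?thesis unfolding True
    by (auto simp: glhat_bracket_def loop_def glhat_scale_def C_elt_def fun_eq_iff)
next
  case False
  then have "{r. (if r = k then A else 0) \<noteq> 0} = {k}" by auto
  then show ?thesis
    by (auto simp: glhat_bracket_def loop_def glhat_scale_def C_elt_def fun_eq_iff)
qed

lemma d_bracket_loop:
  "glhat_bracket m n d_elt (loop A k) = glhat_scale (of_int k) (loop A k)"
  by (auto simp: glhat_bracket_def loop_def glhat_scale_def d_elt_def fun_eq_iff)

lemma C_bracket: "glhat_bracket m n C_elt x = 0"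
  by (cases x) (auto simp: glhat_bracket_def C_elt_def fun_eq_iff zero_prod_def)


section \<open>Cartan and Borel subalgebras, weights\<close>

definition cartan :: "nat \<Rightarrow> nat \<Rightarrow> glhat set" where
  "cartan m n = {(X, c, d) \<in> glhat m n.
     (\<forall>k. k \<noteq> 0 \<longrightarrow> X k = 0) \<and> (\<forall>a b. a \<noteq> b \<longrightarrow> X 0 a b = 0)}"

text \<open>The subalgebra \<open>\<hh> + \<complex>d\<close>, with respect to which weight spaces are taken.\<close>

definition cartan_hd :: "nat \<Rightarrow> nat \<Rightarrow> glhat set" where
  "cartan_hd m n = {(X, c, d) \<in> cartan m n. c = 0}"

definition borel :: "nat \<Rightarrow> nat \<Rightarrow> glhat set" where
  "borel m n = {(X, c, d) \<in> glhat m n.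
     (\<forall>k<0. X k = 0) \<and> (\<forall>a b. idx_less b a \<longrightarrow> X 0 a b = 0)}"

text \<open>
  A functional on the Cartan subalgebra is identified with its extension to triples that
  ignores all coordinates outside the Cartan subalgebra: \<open>\<epsilon>\<^sub>i\<close> reads off the coefficient of
  \<open>E\<^sub>i\<^sub>i(0)\<close> and so on.  This makes equality of weights equality of functions, and on the
  standard Borel subalgebra it is the extension by zero on the nilradical.
\<close>

type_synonym weight = "glhat \<Rightarrow> complex"

definition wt_eps :: "nat \<Rightarrow> weight" where
  "wt_eps i = (\<lambda>(X, c, d). X 0 (Ev i) (Ev i))"

definition wt_del :: "nat \<Rightarrow> weight" where
  "wt_del j = (\<lambda>(X, c, d). X 0 (Od j) (Od j))"

definition wt_Lambda0 :: weight where
  "wt_Lambda0 = (\<lambda>(X, c, d). c)"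

definition wt_delta :: weight where
  "wt_delta = (\<lambda>(X, c, d). d)"

definition wt_scale :: "complex \<Rightarrow> weight \<Rightarrow> weight" where
  "wt_scale s w = (\<lambda>x. s * w x)"

text \<open>The dual space of \<open>\<hh> + \<complex>d\<close>.\<close>

definition dual_hd :: "nat \<Rightarrow> nat \<Rightarrow> weight set" where
  "dual_hd m n = {\<eta>. \<exists>a b c. \<eta> =
     (\<Sum>i=1..m. wt_scale (a i) (wt_eps i)) + (\<Sum>j=1..n. wt_scale (b j) (wt_del j))
     + wt_scale c wt_delta}"

definition Lambda_tilde :: "nat \<Rightarrow> nat \<Rightarrow> int \<Rightarrow> weight" where
  "Lambda_tilde m n l =
     (if 0 \<le> l \<and> l \<le> int m then (\<Sum>i=1..nat l. wt_eps i) + wt_Lambda0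
      else if l > int m then
        (\<Sum>i=1..m. wt_eps i) + wt_scale (of_int (l - int m)) (wt_del 1) + wt_Lambda0
      else wt_scale (of_int l) (wt_del n) + wt_Lambda0)"


section \<open>Modules\<close>

text \<open>A \<open>\<int>/2\<close>-graded module: \<open>V 0\<close> and \<open>V 1\<close> are the even and the odd part.\<close>

locale glhat_module = vector_space scale
  for scale :: "complex \<Rightarrow> 'v::ab_group_add \<Rightarrow> 'v" +
  fixes m n :: nat
    and V :: "bit \<Rightarrow> 'v set"
    and act :: "glhat \<Rightarrow> 'v \<Rightarrow> 'v"
  assumes grading_subspace: "subspace (V p)"
    and grading_disjoint: "V 0 \<inter> V 1 = {0}"
    and grading_sum: "\<exists>v0\<in>V 0. \<exists>v1\<in>V 1. v = v0 + v1"
    and act_linear: "x \<in> glhat m n \<Longrightarrow> Vector_Spaces.linear scale scale (act x)"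
    and act_add: "x \<in> glhat m n \<Longrightarrow> y \<in> glhat m n \<Longrightarrow> act (x + y) v = act x v + act y v"
    and act_scale: "x \<in> glhat m n \<Longrightarrow> act (glhat_scale s x) v = scale s (act x v)"
    and act_parity: "x \<in> glhat_part m n p \<Longrightarrow> v \<in> V q \<Longrightarrow> act x v \<in> V (p + q)"
    and act_bracket: "x \<in> glhat_part m n p \<Longrightarrow> y \<in> glhat_part m n q \<Longrightarrow>
      act (glhat_bracket m n x y) v =
        act x (act y v) - scale (super_sign p q) (act y (act x v))"

definition graded_submodule ::
  "(complex \<Rightarrow> 'v::ab_group_add \<Rightarrow> 'v) \<Rightarrow> nat \<Rightarrow> nat \<Rightarrow> (bit \<Rightarrow> 'v set) \<Rightarrow> (glhat \<Rightarrow> 'v \<Rightarrow> 'v)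
    \<Rightarrow> 'v set \<Rightarrow> bool" where
  "graded_submodule scale m n V act W \<longleftrightarrow>
     module.subspace scale W
     \<and> (\<forall>x\<in>glhat m n. \<forall>w\<in>W. act x w \<in> W)
     \<and> (\<forall>w\<in>W. \<exists>w0\<in>W \<inter> V 0. \<exists>w1\<in>W \<inter> V 1. w = w0 + w1)"

definition irreducible_module ::
  "(complex \<Rightarrow> 'v::ab_group_add \<Rightarrow> 'v) \<Rightarrow> nat \<Rightarrow> nat \<Rightarrow> (bit \<Rightarrow> 'v set) \<Rightarrow> (glhat \<Rightarrow> 'v \<Rightarrow> 'v)
    \<Rightarrow> bool" where
  "irreducible_module scale m n V act \<longleftrightarrow>
     glhat_module scale m n V act
     \<and> (UNIV :: 'v set) \<noteq> {0}
     \<and> (\<forall>W. graded_submodule scale m n V act W \<longrightarrow> W = {0} \<or> W = UNIV)"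

definition highest_weight_vector ::
  "(complex \<Rightarrow> 'v::ab_group_add \<Rightarrow> 'v) \<Rightarrow> nat \<Rightarrow> nat \<Rightarrow> (bit \<Rightarrow> 'v set) \<Rightarrow> (glhat \<Rightarrow> 'v \<Rightarrow> 'v)
    \<Rightarrow> weight \<Rightarrow> 'v \<Rightarrow> bool" where
  "highest_weight_vector scale m n V act \<Lambda> v \<longleftrightarrow>
     v \<noteq> 0 \<and> v \<in> V 0 \<union> V 1 \<and> (\<forall>x\<in>borel m n. act x v = scale (\<Lambda> x) v)"

text \<open>
  The irreducible highest weight module \<open>L(\<Lambda>)\<close>, characterised up to isomorphism and parity
  change.  It is generated by its highest weight vector because it is irreducible.
\<close>

definition is_L ::
  "(complex \<Rightarrow> 'v::ab_group_add \<Rightarrow> 'v) \<Rightarrow> nat \<Rightarrow> nat \<Rightarrow> (bit \<Rightarrow> 'v set) \<Rightarrow> (glhat \<Rightarrow> 'v \<Rightarrow> 'v)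
    \<Rightarrow> weight \<Rightarrow> bool" where
  "is_L scale m n V act \<Lambda> \<longleftrightarrow>
     irreducible_module scale m n V act \<and> (\<exists>v. highest_weight_vector scale m n V act \<Lambda> v)"

definition weight_space ::
  "(complex \<Rightarrow> 'v::ab_group_add \<Rightarrow> 'v) \<Rightarrow> nat \<Rightarrow> nat \<Rightarrow> (glhat \<Rightarrow> 'v \<Rightarrow> 'v) \<Rightarrow> weight \<Rightarrow> 'v set"
  where
  "weight_space scale m n act \<eta> = {v. \<forall>h\<in>cartan_hd m n. act h v = scale (\<eta> h) v}"

definition finite_multiplicities ::
  "(complex \<Rightarrow> 'v::ab_group_add \<Rightarrow> 'v) \<Rightarrow> nat \<Rightarrow> nat \<Rightarrow> (glhat \<Rightarrow> 'v \<Rightarrow> 'v) \<Rightarrow> bool" where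
  "finite_multiplicities scale m n act \<longleftrightarrow>
     (\<forall>\<eta>\<in>dual_hd m n. \<exists>B. finite B \<and> weight_space scale m n act \<eta> \<subseteq> module.span scale B)"


section \<open>Formal sums of exponentials\<close>

text \<open>
  A formal sum \<open>\<Sum>\<eta>. F \<eta> \<cdot> e\<^sup>\<eta>\<close> is the function \<open>F\<close>.  \<open>Sum_any\<close> and \<open>card\<close> below give \<open>0\<close> in the
  infinite case; that case does not occur for the variable families \<open>qvars\<close>, since each
  variable carries a power of \<open>q\<close> that is at least \<open>1/2\<close> and only finitely many variables
  carry any given power.
\<close>

type_synonym fsum = "weight \<Rightarrow> nat"

definition character ::
  "(complex \<Rightarrow> 'v::ab_group_add \<Rightarrow> 'v) \<Rightarrow> nat \<Rightarrow> nat \<Rightarrow> (glhat \<Rightarrow> 'v \<Rightarrow> 'v) \<Rightarrow> fsum" where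
  "character scale m n act =
     (\<lambda>\<eta>. if \<eta> \<in> dual_hd m n
           then vector_space.dim scale (weight_space scale m n act \<eta>) else 0)"

definition fexp :: "weight \<Rightarrow> fsum" where
  "fexp w = (\<lambda>\<eta>. if \<eta> = w then 1 else 0)"

definition fmult :: "fsum \<Rightarrow> fsum \<Rightarrow> fsum" where
  "fmult F G = (\<lambda>\<eta>. Sum_any (\<lambda>\<alpha>. F \<alpha> * G (\<eta> - \<alpha>)))"

text \<open>\<open>q\<^sup>s\<close> with \<open>q = e\<^sup>-\<^sup>\<delta>\<close>, as a weight.\<close>

definition q_wt :: "real \<Rightarrow> weight" where
  "q_wt s = wt_scale (- of_real s) wt_delta"

text \<open>
  The family \<open>qvars u r\<close> lists each of the variables \<open>e\<^bsup>u j\<^esup> q\<^sup>s\<close> with \<open>j = 1, \<dots>, r\<close> and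
  \<open>s \<in> 1/2 + \<nat>\<close> exactly once (for \<open>r \<ge> 1\<close>).
\<close>

definition qvars :: "(nat \<Rightarrow> weight) \<Rightarrow> nat \<Rightarrow> nat \<Rightarrow> weight" where
  "qvars u r i = u (i mod r + 1) + q_wt (real (i div r) + 1/2)"


section \<open>Schur functions and hook Schur functions\<close>

text \<open>Rows, columns and variables are numbered from \<open>0\<close>.\<close>

definition is_partition :: "(nat \<Rightarrow> nat) \<Rightarrow> bool" where
  "is_partition \<kappa> \<longleftrightarrow> antimono \<kappa> \<and> finite {i. \<kappa> i \<noteq> 0}"

definition conj_partition :: "(nat \<Rightarrow> nat) \<Rightarrow> nat \<Rightarrow> nat" where
  "conj_partition \<kappa> = (\<lambda>j. card {i. j < \<kappa> i})"

definition one_row :: "nat \<Rightarrow> nat \<Rightarrow> nat" where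
  "one_row k = (\<lambda>i. if i = 0 then k else 0)"

definition skew_diagram :: "(nat \<Rightarrow> nat) \<Rightarrow> (nat \<Rightarrow> nat) \<Rightarrow> (nat \<times> nat) set" where
  "skew_diagram \<kappa> \<mu> = {(i, j). \<mu> i \<le> j \<and> j < \<kappa> i}"

definition ssyt :: "(nat \<Rightarrow> nat) \<Rightarrow> (nat \<Rightarrow> nat) \<Rightarrow> (nat \<times> nat \<Rightarrow> nat) set" where
  "ssyt \<kappa> \<mu> = {T \<in> skew_diagram \<kappa> \<mu> \<rightarrow>\<^sub>E UNIV.
     (\<forall>i j j'. (i, j) \<in> skew_diagram \<kappa> \<mu> \<and> (i, j') \<in> skew_diagram \<kappa> \<mu> \<and> j < j'
        \<longrightarrow> T (i, j) \<le> T (i, j'))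
     \<and> (\<forall>i i' j. (i, j) \<in> skew_diagram \<kappa> \<mu> \<and> (i', j) \<in> skew_diagram \<kappa> \<mu> \<and> i < i'
        \<longrightarrow> T (i, j) < T (i', j))}"

text \<open>
  The skew Schur function \<open>s\<^bsub>\<kappa>/\<mu>\<^esub>\<close> as the generating function of semistandard tableaux, in the
  variables \<open>x\<^sub>i = e\<^bsup>w i\<^esup>\<close>: the tableau \<open>T\<close> contributes the monomial \<open>e\<^bsup>\<Sum>b. w (T b)\<^esup>\<close>.
\<close>

definition skew_schur :: "(nat \<Rightarrow> nat) \<Rightarrow> (nat \<Rightarrow> nat) \<Rightarrow> (nat \<Rightarrow> weight) \<Rightarrow> fsum" where
  "skew_schur \<kappa> \<mu> w =
     (\<lambda>\<eta>. card {T \<in> ssyt \<kappa> \<mu>. (\<Sum>b\<in>skew_diagram \<kappa> \<mu>. w (T b)) = \<eta>})"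

definition schur :: "(nat \<Rightarrow> nat) \<Rightarrow> (nat \<Rightarrow> weight) \<Rightarrow> fsum" where
  "schur \<kappa> = skew_schur \<kappa> (\<lambda>_. 0)"

definition hook_schur ::
  "(nat \<Rightarrow> nat) \<Rightarrow> (nat \<Rightarrow> weight) \<Rightarrow> (nat \<Rightarrow> weight) \<Rightarrow> fsum" where
  "hook_schur \<kappa> x y =
     (\<lambda>\<eta>. \<Sum>\<mu> | is_partition \<mu> \<and> (\<forall>i. \<mu> i \<le> \<kappa> i).
        fmult (schur \<mu> x) (skew_schur (conj_partition \<kappa>) (conj_partition \<mu>) y) \<eta>)"

end

theory Submission
  imports Defs "HOL-Library.Countable" "HOL-Library.Multiset"
begin

text \<open>
  The module is realised in the Fock space of free fermions, indexed by the even basis vectors,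
  and free bosons, indexed by the odd ones.  The matrix unit with indices \<open>a, b\<close> acts in loop
  degree \<open>k\<close> by the normally ordered sum \<open>\<Sum>i. :\<psi>\<^sup>+(a, i + k) \<psi>\<^sup>-(b, i):\<close>, which has level
  one, and the occupation numbers of the modes give a basis of weight vectors, so the character of
  the subspace of charge \<open>l\<close> is a count of configurations.  The point is that this subspace is
  irreducible.  For a fermion, \<open>\<Sum>j\<ge>1. a(-j) a(j)\<close> (with \<open>a(j)\<close> its current) is a diagonal
  operator up to a polynomial in \<open>a(0)\<close>, since the quartic terms cancel by antisymmetry; its
  eigenvalues separate the terms of the mode sum for an odd root vector, so a submodule is stable
  under all products of one fermionic and one bosonic mode operator.  These separate the
  configurations and connect any two of the same charge.  An irreducible module with the same
  highest weight is isomorphic to this subspace: in the direct sum of the two, the highest weight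
  vectors together generate the graph of an isomorphism.
\<close>

section \<open>Oscillator operators on configurations\<close>

text \<open>The algebra contains only whole mode sums, and \<open>d\<close> measures the energy of
  all indices at once; what has to be found inside it is an operator that sees a single index. The
  antisymmetry behind the quartic cancellation has no counterpart for bosons, so this construction
  works for a fermion. That is enough: an odd root vector pairs the fermion with a boson, and each
  term of its mode sum changes the fermion's level by an amount affine in the mode number. Here
  \<open>m\<close> and \<open>n\<close> both being positive enters. The common submodule of the
  direct sum is generated by lowering operators alone, which makes it triangular for the principal
  gradation; that the raising operators preserve it follows from the bracket relations.
  Irreducibility of the given module concerns graded submodules only, so parities are carried along
  on that side. A particle in the mode \<open>i\<close> has energy |i + 1/2|. The highest weight
  configuration has |l| particles, all of energy 1/2, while \<open>d\<close> kills the highest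
  weight vector; this produces the factor q^(-|l|/2).\<close>

type_synonym mode = "idx \<times> int"
type_synonym cfg = "mode \<Rightarrow> nat"
type_synonym fock = "cfg \<Rightarrow> complex"

abbreviation fermi :: "mode \<Rightarrow> bool" where
  "fermi p \<equiv> parity (fst p) = 0"

text \<open>An arbitrary enumeration of the fermionic modes: the Jordan-Wigner sign needs finite
  initial segments, which the order of the integers lacks. Bosonic modes never enter a sign, so they
  may share the value 0.\<close>

fun mode_num :: "mode \<Rightarrow> nat" where
  "mode_num (Ev j, i) = to_nat (j, i)"
| "mode_num (Od j, i) = 0"

definition jw_below :: "mode \<Rightarrow> mode set" where
  "jw_below p = {q. fermi p \<and> fermi q \<and> mode_num q < mode_num p}"

definition jw :: "mode \<Rightarrow> cfg \<Rightarrow> complex" where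
  "jw p c = (-1) ^ (\<Sum>q\<in>jw_below p. c q)"

text \<open>Indices of even parity belong to fermions, hence the sign -1 for two even
  indices.\<close>

definition exchange_sign :: "idx \<Rightarrow> idx \<Rightarrow> complex" where
  "exchange_sign a b = (if parity a = 0 \<and> parity b = 0 then -1 else 1)"

definition creates :: "bool \<Rightarrow> mode \<Rightarrow> bool" where
  "creates s p \<longleftrightarrow> (s \<longleftrightarrow> snd p < 0)"

text \<open>
  The mode \<open>(a, i)\<close> stands for the basis vector \<open>a \<otimes> t\<^sup>i\<close>.  For \<open>i < 0\<close> it is filled by
  \<open>\<psi>\<^sup>+\<close> and emptied by \<open>\<psi>\<^sup>-\<close>, for \<open>i \<ge> 0\<close> the other way round; the vacuum has all occupation numbers
  zero.  Fermionic operators look at the parity of the occupation number, so that the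
  (anti)commutation relations hold on all functions, not only on admissible configurations.
\<close>

definition occ_shift :: "bool \<Rightarrow> mode \<Rightarrow> nat \<Rightarrow> nat" where
  "occ_shift s p x = (if creates s p then x - 1 else x + 1)"

text \<open>The operators act on functions, so the coefficient is taken at the target configuration:
  a bosonic creator has coefficient 1, an annihilator \<open>x + 1\<close> up to sign. The minus
  sign for an annihilating \<open>psi True\<close> keeps the commutator of \<open>psi False\<close>
  with \<open>psi True\<close> equal to 1 on the modes with \<open>snd p \<ge> 0\<close>, where the
  roles are exchanged.\<close>

definition occ_coeff :: "bool \<Rightarrow> mode \<Rightarrow> nat \<Rightarrow> complex" where
  "occ_coeff s p x =
    (if creates s p then (if fermi p then (if odd x then 1 else 0) else if x = 0 then 0 else 1)
     else (if fermi p then (if even x then 1 else 0) else (if s then -1 else 1) * of_nat (x + 1)))"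

definition psi :: "bool \<Rightarrow> mode \<Rightarrow> fock \<Rightarrow> fock" where
  "psi s p f = (\<lambda>c. occ_coeff s p (c p) * jw p c * f (c(p := occ_shift s p (c p))))"

definition fscale :: "complex \<Rightarrow> fock \<Rightarrow> fock" where
  "fscale z f = (\<lambda>c. z * f c)"

section \<open>Jordan-Wigner signs and the canonical (anti)commutation relations\<close>

lemma fermi_iff: "fermi p \<longleftrightarrow> (\<exists>j i. p = (Ev j, i))"
  by (cases p; cases "fst p") auto

lemma inj_mode_num: "inj_on mode_num {p. fermi p}"
  by (auto simp: inj_on_def fermi_iff)

lemma finite_jw_below [simp]: "finite (jw_below p)"
proof -
  have "finite (mode_num ` jw_below p)"
    by (rule finite_subset[of _ "{..<mode_num p}"]) (auto simp: jw_below_def)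
  moreover have "inj_on mode_num (jw_below p)"
    by (rule inj_on_subset[OF inj_mode_num]) (auto simp: jw_below_def)
  ultimately show ?thesis by (rule finite_imageD)
qed

lemma jw_sq [simp]: "jw p c * jw p c = 1" "jw p c * (jw p c * z) = z"
  by (simp_all add: jw_def mult.assoc[symmetric] power_add[symmetric] mult_2[symmetric])

lemma jw_nonzero [simp]: "jw p c \<noteq> 0"
  by (simp add: jw_def)

lemma jw_upd_self [simp]: "jw p (c(p := x)) = jw p c"
proof -
  have "(\<Sum>q\<in>jw_below p. (c(p := x)) q) = (\<Sum>q\<in>jw_below p. c q)"
    by (rule sum.cong) (auto simp: jw_below_def)
  then show ?thesis by (simp add: jw_def)
qed

lemma jw_upd_flip:
  assumes "odd (c p + x)"
  shows "jw q (c(p := x)) = (if p \<in> jw_below q then - jw q c else jw q c)"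
proof (cases "p \<in> jw_below q")
  case True
  have "(\<Sum>r\<in>jw_below q. (c(p := x)) r) = x + (\<Sum>r\<in>jw_below q - {p}. c r)"
    using True by (subst sum.remove[of _ p]) auto
  moreover have "(\<Sum>r\<in>jw_below q. c r) = c p + (\<Sum>r\<in>jw_below q - {p}. c r)"
    using True by (subst sum.remove[of _ p]) auto
  moreover have "(- (1::complex)) ^ x = - ((- 1) ^ c p)"
    using assms by (cases "even x") auto
  ultimately show ?thesis using True by (simp add: jw_def power_add)
next
  case False
  then have "(\<Sum>r\<in>jw_below q. (c(p := x)) r) = (\<Sum>r\<in>jw_below q. c r)"
    by (intro sum.cong) auto
  then show ?thesis using False by (simp add: jw_def)
qed

lemma occ_coeff_flip: "fermi p \<Longrightarrow> occ_coeff s p x \<noteq> 0 \<Longrightarrow> odd (x + occ_shift s p x)"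
  by (auto simp: occ_coeff_def occ_shift_def split: if_splits elim: oddE)

lemma jw_below_nonfermi: "\<not> fermi p \<Longrightarrow> p \<notin> jw_below q" "\<not> fermi q \<Longrightarrow> p \<notin> jw_below q"
  by (auto simp: jw_below_def)

lemma jw_upd_nonfermi: "\<not> fermi p \<Longrightarrow> jw q (c(p := x)) = jw q c"
proof -
  assume "\<not> fermi p"
  then have "(\<Sum>r\<in>jw_below q. (c(p := x)) r) = (\<Sum>r\<in>jw_below q. c r)"
    by (intro sum.cong) (auto simp: jw_below_def)
  then show ?thesis by (simp add: jw_def)
qed

text \<open>The factor \<open>occ_coeff\<close> stays on both sides because the sign is controlled
  only when a fermionic occupation number changes parity, which a nonzero coefficient
  guarantees.\<close>

lemma jw_occ_shift:
  "occ_coeff s p (c p) * jw q (c(p := occ_shift s p (c p))) =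
   occ_coeff s p (c p) * (if p \<in> jw_below q then - jw q c else jw q c)"
proof (cases "fermi p \<and> occ_coeff s p (c p) \<noteq> 0")
  case True
  then show ?thesis using occ_coeff_flip[of p s "c p"] jw_upd_flip[of c p "occ_shift s p (c p)" q] by simp
next
  case False
  then show ?thesis by (auto simp: jw_upd_nonfermi jw_below_nonfermi)
qed

lemma jw_below_total:
  "p \<noteq> q \<Longrightarrow> fermi p \<Longrightarrow> fermi q \<Longrightarrow> p \<in> jw_below q \<longleftrightarrow> q \<notin> jw_below p"
  using inj_onD[OF inj_mode_num, of p q] by (auto simp: jw_below_def less_le)

text \<open>Two distinct fermionic modes are comparable in the Jordan-Wigner order, so exactly one
  of the two products picks up a sign.\<close>

lemma psi_psi_other:
  assumes "p \<noteq> q"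
  shows "psi s p (psi t q f) c = exchange_sign (fst p) (fst q) * psi t q (psi s p f) c"
proof -
  let ?c = "c(p := occ_shift s p (c p), q := occ_shift t q (c q))"
  have tw: "c(q := occ_shift t q (c q), p := occ_shift s p (c p)) = ?c"
    using assms by (simp add: fun_upd_twist)
  have "psi s p (psi t q f) c =
      (occ_coeff s p (c p) * jw q (c(p := occ_shift s p (c p)))) * occ_coeff t q (c q) * jw p c * f ?c"
    using assms by (simp add: psi_def mult_ac)
  also have "\<dots> = occ_coeff s p (c p) * (if p \<in> jw_below q then - jw q c else jw q c)
      * occ_coeff t q (c q) * jw p c * f ?c"
    by (simp only: jw_occ_shift)
  finally have 1: "psi s p (psi t q f) c = occ_coeff s p (c p) * (if p \<in> jw_below q then - jw q c else jw q c)
      * occ_coeff t q (c q) * jw p c * f ?c" .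
  have "psi t q (psi s p f) c =
      (occ_coeff t q (c q) * jw p (c(q := occ_shift t q (c q)))) * occ_coeff s p (c p) * jw q c * f ?c"
    using assms by (simp add: psi_def mult_ac tw)
  also have "\<dots> = occ_coeff t q (c q) * (if q \<in> jw_below p then - jw p c else jw p c)
      * occ_coeff s p (c p) * jw q c * f ?c"
    by (simp only: jw_occ_shift)
  finally have 2: "psi t q (psi s p f) c = occ_coeff t q (c q) * (if q \<in> jw_below p then - jw p c else jw p c)
      * occ_coeff s p (c p) * jw q c * f ?c" .
  show ?thesis
  proof (cases "fermi p \<and> fermi q")
    case True
    then show ?thesis using jw_below_total[OF assms] unfolding 1 2 by (auto simp: exchange_sign_def)
  next
    case False
    then show ?thesis unfolding 1 2 by (auto simp: exchange_sign_def jw_below_nonfermi)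
  qed
qed

lemma psi_psi_same: "fermi p \<Longrightarrow> psi s p (psi s p f) = 0"
  by (auto simp: psi_def occ_coeff_def occ_shift_def fun_eq_iff)

lemma psi_psi:
  assumes "p \<noteq> q \<or> s = t"
  shows "psi s p (psi t q f) = fscale (exchange_sign (fst p) (fst q)) (psi t q (psi s p f))"
proof (cases "p = q")
  case True
  then have "t = s" "q = p" using assms by auto
  then show ?thesis using psi_psi_same[of p s f]
    by (cases "fermi p") (simp_all add: fscale_def exchange_sign_def fun_eq_iff)
next
  case False
  then show ?thesis unfolding fscale_def by (intro ext psi_psi_other)
qed

lemma psi_minus_plus:
  "psi False p (psi True p f) = fscale (exchange_sign (fst p) (fst p)) (psi True p (psi False p f)) + f"
proof
  fix c
  have idem: "c(p := Suc x) = c" if "c p = Suc x" for x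
    using that by (metis fun_upd_triv)
  show "psi False p (psi True p f) c =
    (fscale (exchange_sign (fst p) (fst p)) (psi True p (psi False p f)) + f) c"
    by (cases "c p"; cases "snd p < 0"; cases "fermi p"; cases "even (c p)")
      (simp_all add: psi_def occ_coeff_def occ_shift_def creates_def exchange_sign_def fscale_def idem algebra_simps)
qed

lemma psi_car:
  "psi False p (psi True q f) =
     fscale (exchange_sign (fst p) (fst q)) (psi True q (psi False p f)) + (if p = q then f else 0)"
  using psi_psi[of p q False True f] psi_minus_plus[of p f] by auto

lemma psi_car':
  "psi True q (psi False p f) =
     fscale (exchange_sign (fst p) (fst q)) (psi False p (psi True q f) - (if p = q then f else 0))"
  unfolding psi_car by (auto simp: fscale_def exchange_sign_def fun_eq_iff)

lemma psi_add: "psi s p (f + g) = psi s p f + psi s p g"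
  by (auto simp: psi_def fun_eq_iff algebra_simps)

lemma psi_diff: "psi s p (f - g) = psi s p f - psi s p g"
  by (auto simp: psi_def fun_eq_iff algebra_simps)

lemma psi_fscale: "psi s p (fscale z f) = fscale z (psi s p f)"
  by (auto simp: psi_def fscale_def fun_eq_iff algebra_simps)

lemma psi_0 [simp]: "psi s p 0 = 0"
  by (auto simp: psi_def fun_eq_iff)

lemma psi_sum: "psi s p (sum g I) = (\<Sum>i\<in>I. psi s p (g i))"
  using sum_comp_morphism[of "psi s p" g I] psi_add by (simp add: o_def)

lemma fscale_simps [simp]:
  "fscale z 0 = 0" "fscale 0 f = 0" "fscale 1 f = f" "fscale z (fscale y f) = fscale (z * y) f"
  by (auto simp: fscale_def fun_eq_iff)

lemma fscale_add: "fscale z (f + g) = fscale z f + fscale z g"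
  by (auto simp: fscale_def fun_eq_iff algebra_simps)

lemma fscale_diff: "fscale z (f - g) = fscale z f - fscale z g"
  by (auto simp: fscale_def fun_eq_iff algebra_simps)

lemma fscale_left: "fscale (z + y) f = fscale z f + fscale y f"
  by (auto simp: fscale_def fun_eq_iff algebra_simps)

lemma fscale_minus: "fscale (- z) f = - fscale z f"
  by (auto simp: fscale_def fun_eq_iff algebra_simps)

lemma fscale_sum: "fscale z (sum g I) = (\<Sum>i\<in>I. fscale z (g i))"
  using sum_comp_morphism[of "fscale z" g I] fscale_add by (simp add: o_def)

interpretation fock: vector_space fscale
  by unfold_locales (auto simp: fscale_add fscale_left)

lemma exchange_sign_sq [simp]: "exchange_sign a b * exchange_sign a b = 1" "exchange_sign a b * (exchange_sign a b * z) = z"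
  by (auto simp: exchange_sign_def)

lemma exchange_sign_sym: "exchange_sign a b = exchange_sign b a"
  by (auto simp: exchange_sign_def)

section \<open>Normally ordered currents\<close>

text \<open>One bound for the occupied modes of the whole support; this uniformity is what truncates
  the infinite mode sums.\<close>

definition bnd :: "int \<Rightarrow> fock \<Rightarrow> bool" where
  "bnd N f \<longleftrightarrow> 0 \<le> N \<and> (\<forall>c p. f c \<noteq> 0 \<longrightarrow> c p \<noteq> 0 \<longrightarrow> \<bar>snd p\<bar> < N)"

definition tame_vec :: "fock \<Rightarrow> bool" where
  "tame_vec f \<longleftrightarrow> (\<exists>N. bnd N f)"

lemma bnd_mono: "bnd N f \<Longrightarrow> N \<le> M \<Longrightarrow> bnd M f"
  unfolding bnd_def by (meson order_less_le_trans order_trans)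

lemma tame_vecE2:
  assumes "tame_vec f" "tame_vec g"
  obtains N where "bnd N f" "bnd N g"
proof -
  obtain N M where "bnd N f" "bnd M g" using assms by (auto simp: tame_vec_def)
  then have "bnd (max N M) f" "bnd (max N M) g" by (auto intro: bnd_mono)
  then show ?thesis by (rule that)
qed

lemma bnd_add: "bnd N f \<Longrightarrow> bnd N g \<Longrightarrow> bnd N (f + g)"
  unfolding bnd_def by (metis add.right_neutral plus_fun_apply)

lemma bnd_fscale: "bnd N f \<Longrightarrow> bnd N (fscale z f)"
  by (auto simp: bnd_def fscale_def)

lemma bnd_0 [simp]: "0 \<le> N \<Longrightarrow> bnd N 0"
  by (auto simp: bnd_def)

lemma tame_add: "tame_vec f \<Longrightarrow> tame_vec g \<Longrightarrow> tame_vec (f + g)"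
  by (meson tame_vecE2 bnd_add tame_vec_def)

lemma tame_fscale: "tame_vec f \<Longrightarrow> tame_vec (fscale z f)"
  by (meson bnd_fscale tame_vec_def)

lemma tame_0 [simp]: "tame_vec 0"
  using bnd_0[of 0] by (auto simp: tame_vec_def simp del: bnd_0)

lemma tame_sum: "(\<And>i. i \<in> I \<Longrightarrow> tame_vec (g i)) \<Longrightarrow> tame_vec (sum g I)"
  by (induction I rule: infinite_finite_induct) (simp_all add: tame_add)

lemma psi_nonzero:
  "psi s p f c \<noteq> 0 \<Longrightarrow> occ_coeff s p (c p) \<noteq> 0 \<and> f (c(p := occ_shift s p (c p))) \<noteq> 0"
  by (auto simp: psi_def)

lemma bnd_psi:
  assumes "bnd N f" shows "bnd (max N (\<bar>snd p\<bar> + 1)) (psi s p f)"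
  unfolding bnd_def
proof (intro conjI allI impI)
  fix c q assume "psi s p f c \<noteq> 0" "c q \<noteq> 0"
  then have "f (c(p := occ_shift s p (c p))) \<noteq> 0" using psi_nonzero by blast
  then show "\<bar>snd q\<bar> < max N (\<bar>snd p\<bar> + 1)"
    using assms \<open>c q \<noteq> 0\<close> unfolding bnd_def
    by (metis fun_upd_other less_max_iff_disj zless_add1_eq)
qed (use assms in \<open>auto simp: bnd_def\<close>)

lemma tame_psi: "tame_vec f \<Longrightarrow> tame_vec (psi s p f)"
  using bnd_psi unfolding tame_vec_def by blast

lemma psi_annihilates:
  assumes "bnd N f" "\<not> creates s p" "N \<le> \<bar>snd p\<bar>"
  shows "psi s p f = 0"
proof (rule ccontr)
  assume "psi s p f \<noteq> 0"
  then obtain c where "psi s p f c \<noteq> 0" by (auto simp: fun_eq_iff)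
  then have "f (c(p := c p + 1)) \<noteq> 0" using psi_nonzero[of s p f c] assms(2) by (simp add: occ_shift_def)
  then show False using assms(1,3) unfolding bnd_def
    by (metis add_eq_0_iff_both_eq_0 fun_upd_same linorder_not_less one_neq_zero)
qed

text \<open>
  The two cases differ by the vacuum expectation value: \<open>\<psi>\<^sup>-(b, i)\<close> creates for \<open>i \<ge> 0\<close>.
\<close>

definition current_term :: "idx \<Rightarrow> idx \<Rightarrow> int \<Rightarrow> int \<Rightarrow> fock \<Rightarrow> fock" where
  "current_term a b k i f = (if 0 \<le> i then fscale (exchange_sign a b) (psi False (b, i) (psi True (a, i + k) f))
     else psi True (a, i + k) (psi False (b, i) f))"

definition current :: "idx \<Rightarrow> idx \<Rightarrow> int \<Rightarrow> fock \<Rightarrow> fock" where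
  "current a b k f = Sum_any (\<lambda>i. current_term a b k i f)"

text \<open>Reordering costs a scalar only when both factors belong to the same mode. These scalars
  are the source of the central term in \<open>current_current\<close>.\<close>

lemma current_term_alt:
  "current_term a b k i f = psi True (a, i + k) (psi False (b, i) f)
     + (if 0 \<le> i \<and> a = b \<and> k = 0 then fscale (exchange_sign a a) f else 0)"
  using psi_car'[of "(a, i + k)" "(b, i)" f]
  by (auto simp: current_term_def exchange_sign_sym[of b a] fscale_diff)

lemma current_term_add: "current_term a b k i (f + g) = current_term a b k i f + current_term a b k i g"
  by (simp add: current_term_def psi_add fscale_add)

lemma current_term_fscale: "current_term a b k i (fscale z f) = fscale z (current_term a b k i f)"
  by (simp add: current_term_def psi_fscale mult.commute)

lemma tame_current_term: "tame_vec f \<Longrightarrow> tame_vec (current_term a b k i f)"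
  by (simp add: current_term_def tame_fscale tame_psi)

text \<open>In either order the rightmost factor annihilates a mode that is empty throughout the
  support.\<close>

lemma current_term_eq_0:
  assumes "bnd N f" "i \<notin> {-N..N + \<bar>k\<bar>}"
  shows "current_term a b k i f = 0"
proof (cases "0 \<le> i")
  case True
  then have "N \<le> i + k" using assms by (auto simp: bnd_def)
  then have "psi True (a, i + k) f = 0"
    using assms(1) by (intro psi_annihilates[of N]) (auto simp: creates_def bnd_def)
  then show ?thesis using True by (simp add: current_term_def)
next
  case False
  then have "psi False (b, i) f = 0"
    using assms by (intro psi_annihilates[of N]) (auto simp: creates_def bnd_def)
  then show ?thesis using False by (simp add: current_term_def)
qed

text \<open>The window \<open>I\<close> is left free so that several currents can be expanded over a
  common one.\<close>

lemma current_eq: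
  assumes "bnd N f" "finite I" "{-N..N + \<bar>k\<bar>} \<subseteq> I"
  shows "current a b k f = (\<Sum>i\<in>I. current_term a b k i f)"
proof -
  have "{i. current_term a b k i f \<noteq> 0} \<subseteq> I" using current_term_eq_0[OF assms(1)] assms(3) by blast
  then show ?thesis unfolding current_def by (rule Sum_any.expand_superset[OF assms(2)])
qed

lemma tame_current: assumes "tame_vec f" shows "tame_vec (current a b k f)"
proof -
  obtain N where "bnd N f" using assms by (auto simp: tame_vec_def)
  from current_eq[OF this _ order.refl] show ?thesis by (simp add: tame_sum tame_current_term assms)
qed

lemma current_add: assumes "tame_vec f" "tame_vec g" shows "current a b k (f + g) = current a b k f + current a b k g"
proof -
  obtain N where N: "bnd N f" "bnd N g" using tame_vecE2 assms by blast
  show ?thesis using current_eq[OF N(1) _ order.refl] current_eq[OF N(2) _ order.refl] current_eq[OF bnd_add[OF N] _ order.refl]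
    by (simp add: current_term_add sum.distrib)
qed

lemma current_fscale: assumes "tame_vec f" shows "current a b k (fscale z f) = fscale z (current a b k f)"
proof -
  obtain N where N: "bnd N f" using assms by (auto simp: tame_vec_def)
  show ?thesis using current_eq[OF N _ order.refl] current_eq[OF bnd_fscale[OF N] _ order.refl]
    by (simp add: current_term_fscale fscale_sum)
qed

lemma current_0 [simp]: "current a b k 0 = 0"
  using current_fscale[of 0 a b k 0] by simp

lemma current_sum:
  assumes "\<And>i. i \<in> I \<Longrightarrow> tame_vec (g i)"
  shows "current a b k (sum g I) = (\<Sum>i\<in>I. current a b k (g i))"
  using assms by (induction I rule: infinite_finite_induct) (simp_all add: current_add tame_sum)

section \<open>Commutators of currents with mode operators and with each other\<close>

lemma current_term_psi_plus:
  "current_term a b k i (psi True (c, j) f) =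
     fscale (exchange_sign a c * exchange_sign b c) (psi True (c, j) (current_term a b k i f))
     + (if b = c \<and> i = j then psi True (a, i + k) f else 0)"
  unfolding current_term_alt psi_add psi_car[of "(b, i)"] psi_fscale fscale_add
  using psi_psi[of "(a, i + k)" "(c, j)" True True "psi False (b, i) f"]
  by (auto simp: psi_fscale psi_add psi_car mult_ac)

lemma current_term_psi_minus:
  "current_term a b k i (psi False (c, j) f) =
     fscale (exchange_sign a c * exchange_sign b c) (psi False (c, j) (current_term a b k i f)
       - (if a = c \<and> i + k = j then psi False (b, i) f else 0))"
proof -
  have "psi True (a, i + k) (psi False (b, i) (psi False (c, j) f)) =
      fscale (exchange_sign b c) (psi True (a, i + k) (psi False (c, j) (psi False (b, i) f)))"
    using psi_psi[of "(b, i)" "(c, j)" False False f] by (simp add: psi_fscale)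
  also have "\<dots> = fscale (exchange_sign b c * exchange_sign c a) (psi False (c, j) (psi True (a, i + k) (psi False (b, i) f))
      - (if a = c \<and> i + k = j then psi False (b, i) f else 0))"
    using psi_car'[of "(a, i + k)" "(c, j)" "psi False (b, i) f"] by auto
  finally show ?thesis
    unfolding current_term_alt psi_add
    by (auto simp: exchange_sign_sym[of c a] mult_ac fscale_add fscale_diff psi_fscale)
qed

text \<open>Up to sign, commuting with the current is the action of the matrix unit
  \<open>a, b\<close> in loop degree \<open>k\<close> on the basis vector \<open>c\<close> in degree
  \<open>j\<close>; \<open>current_psi_minus\<close> is the dual action.\<close>

lemma current_psi_plus:
  assumes "tame_vec f"
  shows "current a b k (psi True (c, j) f) = fscale (exchange_sign a c * exchange_sign b c) (psi True (c, j) (current a b k f))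
     + (if b = c then psi True (a, j + k) f else 0)"
proof -
  obtain N where N: "bnd N f" "bnd N (psi True (c, j) f)"
    using tame_vecE2 assms tame_psi by blast
  let ?I = "insert j {-N..N + \<bar>k\<bar>}"
  have "current a b k (psi True (c, j) f) = (\<Sum>i\<in>?I. fscale (exchange_sign a c * exchange_sign b c) (psi True (c, j) (current_term a b k i f)))
     + (\<Sum>i\<in>?I. if b = c \<and> i = j then psi True (a, i + k) f else 0)"
    using current_eq[OF N(2) _ subset_insertI, of j k a b] unfolding current_term_psi_plus sum.distrib by simp
  also have "(\<Sum>i\<in>?I. if b = c \<and> i = j then psi True (a, i + k) f else 0) =
      (if b = c then psi True (a, j + k) f else 0)"
    by (cases "b = c") (simp_all add: sum.delta)
  also have "(\<Sum>i\<in>?I. fscale (exchange_sign a c * exchange_sign b c) (psi True (c, j) (current_term a b k i f))) =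
      fscale (exchange_sign a c * exchange_sign b c) (psi True (c, j) (current a b k f))"
    using current_eq[OF N(1) _ subset_insertI, of j k a b] by (simp add: fscale_sum psi_sum del: sum.insert_if)
  finally show ?thesis .
qed

lemma current_psi_minus:
  assumes "tame_vec f"
  shows "current a b k (psi False (c, j) f) = fscale (exchange_sign a c * exchange_sign b c) (psi False (c, j) (current a b k f)
     - (if a = c then psi False (b, j - k) f else 0))"
proof -
  obtain N where N: "bnd N f" "bnd N (psi False (c, j) f)"
    using tame_vecE2 assms tame_psi by blast
  let ?I = "insert (j - k) {-N..N + \<bar>k\<bar>}"
  have iff: "a = c \<and> i + k = j \<longleftrightarrow> a = c \<and> i = j - k" for i by auto
  have "current a b k (psi False (c, j) f) = (\<Sum>i\<in>?I. fscale (exchange_sign a c * exchange_sign b c) (psi False (c, j) (current_term a b k i f)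
       - (if a = c \<and> i = j - k then psi False (b, i) f else 0)))"
    using current_eq[OF N(2) _ subset_insertI, of "j - k" k a b] unfolding current_term_psi_minus iff by simp
  also have "\<dots> = fscale (exchange_sign a c * exchange_sign b c) (psi False (c, j) (\<Sum>i\<in>?I. current_term a b k i f)
      - (\<Sum>i\<in>?I. if a = c \<and> i = j - k then psi False (b, i) f else 0))"
    by (simp only: fscale_sum[symmetric] psi_sum sum_subtractf)
  also have "(\<Sum>i\<in>?I. if a = c \<and> i = j - k then psi False (b, i) f else 0) =
      (if a = c then psi False (b, j - k) f else 0)"
    by (cases "a = c") (simp_all add: sum.delta)
  also have "(\<Sum>i\<in>?I. current_term a b k i f) = current a b k f"
    using current_eq[OF N(1) _ subset_insertI, of "j - k" k a b] by (simp del: sum.insert_if)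
  finally show ?thesis .
qed

text \<open>The supertrace of the matrix unit at \<open>a, a\<close>.\<close>

definition esgn :: "idx \<Rightarrow> complex" where
  "esgn a = (if parity a = 0 then 1 else -1)"

lemma sum_fscale_same: "(\<Sum>j\<in>J. fscale z f) = fscale (of_nat (card J) * z) f"
  by (induction J rule: infinite_finite_induct) (simp_all add: fscale_left distrib_right del: sum_constant)

lemma sum_fscale_const:
  fixes J :: "int set"
  assumes "finite J"
  shows "(\<Sum>j\<in>J. if 0 \<le> j \<and> P then fscale z f else 0) =
    (if P then fscale (of_nat (card {j\<in>J. 0 \<le> j}) * z) f else 0)"
proof (cases P)
  case True
  have "(\<Sum>j\<in>J. if 0 \<le> j \<and> P then fscale z f else 0) = (\<Sum>j\<in>{j\<in>J. 0 \<le> j}. fscale z f)"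
    using True assms by (simp add: sum.If_cases Int_def)
  also have "\<dots> = fscale (of_nat (card {j\<in>J. 0 \<le> j}) * z) f"
    by (rule sum_fscale_same)
  finally show ?thesis using True by simp
qed simp

lemma current_current_term:
  fixes a b c d :: idx
  assumes "tame_vec f"
  defines "\<sigma> \<equiv> exchange_sign a c * exchange_sign b c * exchange_sign a d * exchange_sign b d"
  shows "current a b k (current_term c d l j f) = fscale \<sigma> (current_term c d l j (current a b k f))
     + (if b = c then psi True (a, j + (k + l)) (psi False (d, j) f) else 0)
     - (if a = d then fscale \<sigma> (psi True (c, j + l) (psi False (b, j - k) f)) else 0)"
proof -
  let ?h = "if 0 \<le> j \<and> c = d \<and> l = 0 then fscale (exchange_sign c c) f else 0"
  have h: "current a b k ?h = fscale \<sigma> (if 0 \<le> j \<and> c = d \<and> l = 0 then fscale (exchange_sign c c) (current a b k f) else 0)"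
    using current_fscale[OF assms(1)] by (auto simp: \<sigma>_def mult_ac)
  have "current a b k (current_term c d l j f) = current a b k (psi True (c, j + l) (psi False (d, j) f)) + current a b k ?h"
    unfolding current_term_alt by (rule current_add) (auto intro!: tame_psi tame_fscale assms(1))
  also have "current a b k (psi True (c, j + l) (psi False (d, j) f)) =
      fscale (exchange_sign a c * exchange_sign b c) (psi True (c, j + l) (current a b k (psi False (d, j) f)))
      + (if b = c then psi True (a, j + l + k) (psi False (d, j) f) else 0)"
    by (rule current_psi_plus) (intro tame_psi assms(1))
  also have "fscale (exchange_sign a c * exchange_sign b c) (psi True (c, j + l) (current a b k (psi False (d, j) f))) =
      fscale \<sigma> (psi True (c, j + l) (psi False (d, j) (current a b k f)))
       - (if a = d then fscale \<sigma> (psi True (c, j + l) (psi False (b, j - k) f)) else 0)"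
    unfolding current_psi_minus[OF assms(1)]
    by (simp add: \<sigma>_def psi_fscale psi_diff fscale_diff mult_ac)
  finally show ?thesis
    unfolding h current_term_alt[of c d l j "current a b k f"] fscale_add by (simp add: fun_eq_iff algebra_simps)
qed

text \<open>The two commutator sums are again mode sums, but over windows shifted by
  \<open>k\<close> against each other. Such windows contain numbers of nonnegative indices that
  differ by \<open>k\<close>, and the vacuum scalars sit exactly at those indices: this difference
  is the central term, with level one.\<close>

lemma current_current:
  fixes a b c d :: idx
  assumes "tame_vec f"
  defines "\<sigma> \<equiv> exchange_sign a c * exchange_sign b c * exchange_sign a d * exchange_sign b d"
  shows "current a b k (current c d l f) = fscale \<sigma> (current c d l (current a b k f))
     + (if b = c then current a d (k + l) f else 0) - (if a = d then fscale \<sigma> (current c b (k + l) f) else 0)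
     + (if b = c \<and> a = d \<and> k + l = 0 then fscale (of_int k * esgn a) f else 0)"
proof -
  obtain N where N: "bnd N f" "bnd N (current a b k f)"
    using tame_vecE2[OF assms(1) tame_current[OF assms(1)]] by blast
  have N0: "0 \<le> N" using N by (simp add: bnd_def)
  \<comment> \<open>Large enough for every current involved, also after the window is shifted by
    \<open>k\<close>.\<close>
  define M where "M = N + \<bar>k\<bar> + \<bar>l\<bar> + \<bar>k + l\<bar>"
  let ?J = "{-M..M}" and ?J' = "{-M - k..M - k}"
  have sub: "{-N..N + \<bar>l\<bar>} \<subseteq> ?J" "{-N..N + \<bar>k + l\<bar>} \<subseteq> ?J" "{-N..N + \<bar>k + l\<bar>} \<subseteq> ?J'"
    unfolding M_def by auto
  have card: "of_nat (card {j\<in>?J. 0 \<le> j}) = (of_int (M + 1) :: complex)"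
    "of_nat (card {j\<in>?J'. 0 \<le> j}) = (of_int (M - k + 1) :: complex)"
  proof -
    have "{j\<in>?J. 0 \<le> j} = {0..M}" "{j\<in>?J'. 0 \<le> j} = {0..M - k}"
      using N0 unfolding M_def by auto
    then show "of_nat (card {j\<in>?J. 0 \<le> j}) = (of_int (M + 1) :: complex)"
      "of_nat (card {j\<in>?J'. 0 \<le> j}) = (of_int (M - k + 1) :: complex)"
      using N0 by (simp_all add: M_def)
  qed
  have S1: "(\<Sum>j\<in>?J. psi True (a, j + (k + l)) (psi False (d, j) f)) =
      current a d (k + l) f - (if a = d \<and> k + l = 0 then fscale (of_int (M + 1) * exchange_sign a a) f else 0)"
    using current_eq[OF N(1) _ sub(2), of a d]
      sum_fscale_const[of ?J "a = d \<and> k + l = 0" "exchange_sign a a" f] card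
    by (simp add: current_term_alt sum.distrib)
  have "(\<Sum>j\<in>?J. psi True (c, j + l) (psi False (b, j - k) f)) =
      (\<Sum>i\<in>?J'. psi True (c, i + (k + l)) (psi False (b, i) f))"
    by (rule sum.reindex_bij_witness[of _ "\<lambda>i. i + k" "\<lambda>j. j - k"]) (auto simp: algebra_simps)
  also have "\<dots> = current c b (k + l) f
      - (if c = b \<and> k + l = 0 then fscale (of_int (M - k + 1) * exchange_sign c c) f else 0)"
    using current_eq[OF N(1) _ sub(3), of c b]
      sum_fscale_const[of ?J' "c = b \<and> k + l = 0" "exchange_sign c c" f] card
    by (simp add: current_term_alt sum.distrib)
  finally have S2: "(\<Sum>j\<in>?J. psi True (c, j + l) (psi False (b, j - k) f)) = current c b (k + l) f
      - (if c = b \<and> k + l = 0 then fscale (of_int (M - k + 1) * exchange_sign c c) f else 0)" .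
  have "current a b k (current c d l f) = (\<Sum>j\<in>?J. current a b k (current_term c d l j f))"
    using current_eq[OF N(1) _ sub(1), of c d] by (simp add: current_sum tame_current_term assms(1))
  also have "\<dots> = fscale \<sigma> (\<Sum>j\<in>?J. current_term c d l j (current a b k f))
      + (if b = c then \<Sum>j\<in>?J. psi True (a, j + (k + l)) (psi False (d, j) f) else 0)
      - (if a = d then fscale \<sigma> (\<Sum>j\<in>?J. psi True (c, j + l) (psi False (b, j - k) f)) else 0)"
    unfolding current_current_term[OF assms(1)] \<sigma>_def[symmetric]
    by (simp add: sum.distrib sum_subtractf fscale_sum)
  also have "(\<Sum>j\<in>?J. current_term c d l j (current a b k f)) = current c d l (current a b k f)"
    using current_eq[OF N(2) _ sub(1), of c d] by simp
  finally have *: "current a b k (current c d l f) = fscale \<sigma> (current c d l (current a b k f))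
      + (if b = c then current a d (k + l) f - (if a = d \<and> k + l = 0 then fscale (of_int (M + 1) * exchange_sign a a) f else 0) else 0)
      - (if a = d then fscale \<sigma> (current c b (k + l) f
      - (if c = b \<and> k + l = 0 then fscale (of_int (M - k + 1) * exchange_sign c c) f else 0)) else 0)"
    unfolding S1 S2 .
  show ?thesis
  proof (cases "b = c \<and> a = d \<and> k + l = 0")
    case True
    \<comment> \<open>Here \<open>\<sigma>\<close> reduces to the product of the signs at
      \<open>a, a\<close> and at \<open>c, c\<close>, so the counts M - k + 1 and M + 1 leave -k
      times the sign at \<open>a, a\<close>.\<close>
    then have "fscale \<sigma> (fscale (of_int (M - k + 1) * exchange_sign c c) f) - fscale (of_int (M + 1) * exchange_sign a a) f
        = fscale (of_int k * esgn a) f"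
      by (auto simp: fscale_def fun_eq_iff \<sigma>_def exchange_sign_def esgn_def algebra_simps)
    then show ?thesis using True unfolding * fscale_diff
      by (simp add: fun_eq_iff)
  next
    case False
    then show ?thesis unfolding * by auto
  qed
qed

section \<open>Gradings and finitely supported vectors\<close>

text \<open>The charge of a particle: modes \<open>i \<ge> 0\<close> are filled by
  \<open>psi False\<close>, so their particles count negatively.\<close>

definition mode_sign :: "mode \<Rightarrow> 'a::comm_ring_1" where
  "mode_sign p = (if snd p < 0 then 1 else -1)"

definition op_sign :: "bool \<Rightarrow> 'a::comm_ring_1" where
  "op_sign s = (if s then 1 else -1)"

text \<open>Polymorphic because it serves over the integers for charge and principal gradation, over
  the complex numbers for energies and weights, and over \<open>bit\<close> for the parity.\<close>

definition lsum :: "(mode \<Rightarrow> 'a::comm_ring_1) \<Rightarrow> cfg \<Rightarrow> 'a" where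
  "lsum g c = (\<Sum>p | c p \<noteq> 0. of_nat (c p) * g p)"

definition cfgs :: "nat \<Rightarrow> nat \<Rightarrow> cfg set" where
  "cfgs m n = {c. finite {p. c p \<noteq> 0} \<and> (\<forall>p. c p \<noteq> 0 \<longrightarrow> fst p \<in> idxs m n \<and> (fermi p \<longrightarrow> c p \<le> 1))}"

definition cfgs_ch :: "nat \<Rightarrow> nat \<Rightarrow> int \<Rightarrow> cfg set" where
  "cfgs_ch m n l = {c \<in> cfgs m n. lsum mode_sign c = l}"

definition fin_on :: "cfg set \<Rightarrow> fock set" where
  "fin_on C = {f. finite {c. f c \<noteq> 0} \<and> {c. f c \<noteq> 0} \<subseteq> C}"

definition fdelta :: "cfg \<Rightarrow> fock" where
  "fdelta c = (\<lambda>c'. if c' = c then 1 else 0)"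

definition fdiag :: "(cfg \<Rightarrow> complex) \<Rightarrow> fock \<Rightarrow> fock" where
  "fdiag h f = (\<lambda>c. h c * f c)"

lemma mode_sign_sq [simp]: "mode_sign p * mode_sign p = 1" "mode_sign p * (mode_sign p * x) = x"
  by (auto simp: mode_sign_def)

lemma lsum_superset:
  assumes "finite S" "{p. c p \<noteq> 0} \<subseteq> S"
  shows "lsum g c = (\<Sum>p\<in>S. of_nat (c p) * g p)"
  unfolding lsum_def by (rule sum.mono_neutral_left) (use assms in auto)

lemma lsum_upd:
  assumes "finite {p. c p \<noteq> 0}"
  shows "lsum g (c(p := x)) = lsum g c + (of_nat x - of_nat (c p)) * g p"
proof -
  let ?S = "insert p {p. c p \<noteq> 0}"
  have "lsum g (c(p := x)) = (\<Sum>q\<in>?S. of_nat ((c(p := x)) q) * g q)"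
    using assms by (intro lsum_superset) auto
  also have "\<dots> = of_nat x * g p + (\<Sum>q\<in>?S - {p}. of_nat (c q) * g q)"
    using assms by (subst sum.remove[of _ p]) auto
  moreover have "lsum g c = (\<Sum>q\<in>?S. of_nat (c q) * g q)"
    using assms by (intro lsum_superset) auto
  moreover have "\<dots> = of_nat (c p) * g p + (\<Sum>q\<in>?S - {p}. of_nat (c q) * g q)"
    using assms by (subst sum.remove[of _ p]) auto
  ultimately show ?thesis by (simp add: algebra_simps)
qed

lemma finite_upd: "finite {q. (c(p := x)) q \<noteq> (0::nat)} \<longleftrightarrow> finite {q. c q \<noteq> 0}"
proof -
  have "{q. (c(p := x)) q \<noteq> 0} - {p} = {q. c q \<noteq> 0} - {p}" by auto
  then show ?thesis by (metis finite.emptyI finite.insertI finite_Diff2)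
qed

lemma op_sign_mode_sign: "op_sign s * mode_sign p = (if creates s p then 1 else - 1 :: 'a::comm_ring_1)"
  by (simp add: op_sign_def mode_sign_def creates_def)

lemma occ_coeff_creates: "occ_coeff s p x \<noteq> 0 \<Longrightarrow> creates s p \<Longrightarrow> x \<noteq> 0"
  by (auto simp: occ_coeff_def split: if_splits dest: odd_pos)

lemma occ_shift_inv:
  assumes "occ_coeff s p x \<noteq> 0"
  shows "of_nat x = of_nat (occ_shift s p x) + op_sign s * (mode_sign p :: 'a::comm_ring_1)"
proof (cases "creates s p")
  case True
  with occ_coeff_creates[OF assms] obtain y where "x = Suc y" using not0_implies_Suc by blast
  then show ?thesis using True unfolding op_sign_mode_sign by (simp add: occ_shift_def)
next
  case False
  then show ?thesis unfolding op_sign_mode_sign by (simp add: occ_shift_def)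
qed

lemma cfgs_fermi: "c \<in> cfgs m n \<Longrightarrow> fermi p \<Longrightarrow> c p \<le> 1"
  by (cases p; cases "c p = 0") (simp_all add: cfgs_def)

lemma lsum_pre:
  assumes "finite {q. c q \<noteq> 0}" "occ_coeff s p (c p) \<noteq> 0"
  shows "lsum g c = lsum g (c(p := occ_shift s p (c p))) + op_sign s * mode_sign p * g p"
  unfolding lsum_upd[OF assms(1)] occ_shift_inv[OF assms(2)] by (simp add: algebra_simps)

lemma cfgs_pre:
  assumes "c(p := occ_shift s p (c p)) \<in> cfgs m n" "occ_coeff s p (c p) \<noteq> 0" "fst p \<in> idxs m n"
  shows "c \<in> cfgs m n"
proof -
  let ?c = "c(p := occ_shift s p (c p))"
  have "finite {q. ?c q \<noteq> 0}" using assms(1) unfolding cfgs_def by blast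
  then have fin: "finite {q. c q \<noteq> 0}" unfolding finite_upd .
  have "fst q \<in> idxs m n \<and> (fermi q \<longrightarrow> c q \<le> 1)" if "c q \<noteq> 0" for q
  proof (cases "q = p")
    case True
    have "c p \<le> 1" if "fermi p"
    proof -
      have "?c p \<le> 1" using assms(1) that by (rule cfgs_fermi)
      then have "occ_shift s p (c p) \<le> 1" by simp
      \<comment> \<open>Occupation 2 could only be reached by a creator, whose fermionic coefficient
        vanishes at even values.\<close>
      then show ?thesis using assms(2) that
        by (cases "c p = 2") (auto simp: occ_shift_def occ_coeff_def split: if_splits)
    qed
    then show ?thesis using True assms(3) by auto
  next
    case False
    then have "?c q \<noteq> 0" using that by simp
    then have "fst q \<in> idxs m n \<and> (fermi q \<longrightarrow> ?c q \<le> 1)" using assms(1) unfolding cfgs_def by blast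
    then show ?thesis using False by simp
  qed
  then show ?thesis using fin by (auto simp: cfgs_def)
qed

lemma fin_on_0 [simp]: "0 \<in> fin_on C"
  by (auto simp: fin_on_def)

lemma fin_on_add: "f \<in> fin_on C \<Longrightarrow> g \<in> fin_on C \<Longrightarrow> f + g \<in> fin_on C"
proof -
  assume f: "f \<in> fin_on C" and g: "g \<in> fin_on C"
  have "{c. (f + g) c \<noteq> 0} \<subseteq> {c. f c \<noteq> 0} \<union> {c. g c \<noteq> 0}" by auto
  with f g show ?thesis unfolding fin_on_def
    by (auto intro: finite_subset simp del: plus_fun_apply)
qed

lemma fin_on_fscale: "f \<in> fin_on C \<Longrightarrow> fscale z f \<in> fin_on C"
  unfolding fin_on_def fscale_def by (auto elim: rev_finite_subset)

lemma subspace_fin_on: "fock.subspace (fin_on C)"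
  by (rule fock.subspaceI) (rule fin_on_0 fin_on_add fin_on_fscale; assumption)+

lemma fin_on_sum:
  assumes "\<And>i. i \<in> I \<Longrightarrow> g i \<in> fin_on C"
  shows "sum g I \<in> fin_on C"
  by (rule fock.subspace_sum[OF subspace_fin_on]) (rule assms)

lemma fin_on_mono: "C \<subseteq> D \<Longrightarrow> fin_on C \<subseteq> fin_on D"
  by (auto simp: fin_on_def)

lemma fin_on_fdiag: "f \<in> fin_on C \<Longrightarrow> fdiag h f \<in> fin_on C"
  unfolding fin_on_def fdiag_def by (auto elim: rev_finite_subset)

lemma fdelta_fin_on [simp]: "c \<in> C \<Longrightarrow> fdelta c \<in> fin_on C"
  by (auto simp: fin_on_def fdelta_def)

lemma fdelta_nonzero [simp]: "fdelta c \<noteq> 0"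
  by (auto simp: fdelta_def fun_eq_iff)

lemma fin_on_expand:
  assumes "f \<in> fin_on C"
  shows "f = (\<Sum>c | f c \<noteq> 0. fscale (f c) (fdelta c))"
proof
  fix c
  have fin: "finite {c. f c \<noteq> 0}" using assms by (simp add: fin_on_def)
  have app: "sum F I c = (\<Sum>i\<in>I. F i c)" for F :: "cfg \<Rightarrow> fock" and I
    by (induction I rule: infinite_finite_induct) auto
  have "(\<Sum>c' | f c' \<noteq> 0. fscale (f c') (fdelta c')) c = (\<Sum>c' | f c' \<noteq> 0. if c = c' then f c else 0)"
    unfolding app by (rule sum.cong) (auto simp: fscale_def fdelta_def)
  also have "\<dots> = f c" using fin by (simp add: sum.delta)
  finally show "f c = (\<Sum>c | f c \<noteq> 0. fscale (f c) (fdelta c)) c" by simp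
qed

lemma fin_on_cfgs_tame:
  assumes "f \<in> fin_on (cfgs m n)" shows "tame_vec f"
proof -
  have td: "tame_vec (fdelta c)" if "c \<in> cfgs m n" for c
  proof -
    have fin: "finite {p. c p \<noteq> 0}" using that by (simp add: cfgs_def)
    let ?N = "Max (insert 0 ((\<lambda>p. \<bar>snd p\<bar> + 1) ` {p. c p \<noteq> 0}))"
    have "bnd ?N (fdelta c)"
      unfolding bnd_def
    proof (intro conjI allI impI)
      fix c' p assume "fdelta c c' \<noteq> 0" "c' p \<noteq> 0"
      then have "c p \<noteq> 0" by (auto simp: fdelta_def split: if_splits)
      then have "\<bar>snd p\<bar> + 1 \<le> ?N" using fin by (intro Max_ge) auto
      then show "\<bar>snd p\<bar> < ?N" by simp
    qed (use fin in \<open>auto intro: Max_ge\<close>)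
    then show ?thesis by (auto simp: tame_vec_def)
  qed
  have "{c. f c \<noteq> 0} \<subseteq> cfgs m n" using assms by (simp add: fin_on_def)
  then show ?thesis
    by (subst fin_on_expand[OF assms]) (auto intro!: tame_sum tame_fscale td)
qed

lemma psi_fin_on:
  assumes "f \<in> fin_on (cfgs m n)" "fst p \<in> idxs m n"
  shows "psi s p f \<in> fin_on (cfgs m n)"
proof -
  have "c \<in> (\<lambda>c. c(p := c p + 1)) ` {c. f c \<noteq> 0} \<union> (\<lambda>c. c(p := c p - 1)) ` {c. f c \<noteq> 0}"
    if "psi s p f c \<noteq> 0" for c
  proof -
    have k: "occ_coeff s p (c p) \<noteq> 0" and f: "f (c(p := occ_shift s p (c p))) \<noteq> 0"
      using psi_nonzero[OF that] by auto
    show ?thesis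
    proof (cases "creates s p")
      case True
      then have "c p \<noteq> 0" using k by (auto simp: occ_coeff_def split: if_splits dest: odd_pos)
      then have "c = (\<lambda>c. c(p := c p + 1)) (c(p := occ_shift s p (c p)))" using True by (simp add: occ_shift_def)
      then show ?thesis using f by blast
    next
      case False
      then have "c = (\<lambda>c. c(p := c p - 1)) (c(p := occ_shift s p (c p)))" by (simp add: occ_shift_def)
      then show ?thesis using f by blast
    qed
  qed
  then have "{c. psi s p f c \<noteq> 0} \<subseteq> (\<lambda>c. c(p := c p + 1)) ` {c. f c \<noteq> 0} \<union> (\<lambda>c. c(p := c p - 1)) ` {c. f c \<noteq> 0}"
    by blast
  then have "finite {c. psi s p f c \<noteq> 0}"
    by (rule finite_subset) (use assms(1) in \<open>simp add: fin_on_def\<close>)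
  moreover have "c \<in> cfgs m n" if "psi s p f c \<noteq> 0" for c
    using psi_nonzero[OF that] assms cfgs_pre[of c p s m n] by (auto simp: fin_on_def)
  ultimately show ?thesis by (auto simp: fin_on_def)
qed

lemma current_term_fin_on:
  assumes "f \<in> fin_on (cfgs m n)" "a \<in> idxs m n" "b \<in> idxs m n"
  shows "current_term a b k i f \<in> fin_on (cfgs m n)"
proof (cases "0 \<le> i")
  case True
  have "fscale (exchange_sign a b) (psi False (b, i) (psi True (a, i + k) f)) \<in> fin_on (cfgs m n)"
    by (intro fin_on_fscale psi_fin_on) (simp_all add: assms)
  then show ?thesis unfolding current_term_def if_P[OF True] by this
next
  case False
  have "psi True (a, i + k) (psi False (b, i) f) \<in> fin_on (cfgs m n)"
    by (intro psi_fin_on) (simp_all add: assms)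
  then show ?thesis unfolding current_term_def if_not_P[OF False] by this
qed

lemma current_fin_on:
  assumes "f \<in> fin_on (cfgs m n)" "a \<in> idxs m n" "b \<in> idxs m n"
  shows "current a b k f \<in> fin_on (cfgs m n)"
proof -
  obtain N where "bnd N f" using fin_on_cfgs_tame[OF assms(1)] by (auto simp: tame_vec_def)
  from current_eq[OF this _ order.refl] show ?thesis by (simp add: fin_on_sum current_term_fin_on assms)
qed

lemma fdiag_add: "fdiag h (f + g) = fdiag h f + fdiag h g"
  by (auto simp: fdiag_def fun_eq_iff algebra_simps)

lemma fdiag_fscale: "fdiag h (fscale z f) = fscale z (fdiag h f)"
  by (auto simp: fdiag_def fscale_def fun_eq_iff algebra_simps)

lemma fdiag_0 [simp]: "fdiag h 0 = 0"
  by (auto simp: fdiag_def fun_eq_iff)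

lemma fdiag_sum: "fdiag h (sum g I) = (\<Sum>i\<in>I. fdiag h (g i))"
  using sum_comp_morphism[of "fdiag h" g I] fdiag_add by (simp add: o_def)

lemma fdiag_psi:
  assumes "f \<in> fin_on (cfgs m n)"
  shows "fdiag (lsum g) (psi s p f) = psi s p (fdiag (lsum g) f) + fscale (op_sign s * mode_sign p * g p) (psi s p f)"
proof
  fix c
  show "fdiag (lsum g) (psi s p f) c = (psi s p (fdiag (lsum g) f) + fscale (op_sign s * mode_sign p * g p) (psi s p f)) c"
  proof (cases "psi s p f c = 0")
    case True
    then show ?thesis by (auto simp: fdiag_def fscale_def psi_def)
  next
    case False
    note nz = psi_nonzero[OF False]
    then have "c(p := occ_shift s p (c p)) \<in> cfgs m n" using assms by (auto simp: fin_on_def)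
    then have "finite {q. (c(p := occ_shift s p (c p))) q \<noteq> 0}" unfolding cfgs_def by blast
    then have "finite {q. c q \<noteq> 0}" unfolding finite_upd .
    from lsum_pre[OF this conjunct1[OF nz], of g] show ?thesis
      by (simp add: fdiag_def fscale_def psi_def algebra_simps)
  qed
qed

lemma fdiag_current_term:
  assumes "f \<in> fin_on (cfgs m n)" "a \<in> idxs m n" "b \<in> idxs m n"
  shows "fdiag (lsum g) (current_term a b k i f) = current_term a b k i (fdiag (lsum g) f)
    + fscale (mode_sign (a, i + k) * g (a, i + k) - mode_sign (b, i) * g (b, i)) (current_term a b k i f)"
proof (cases "0 \<le> i")
  case True
  then show ?thesis using assms
    by (simp add: current_term_def fdiag_fscale fdiag_psi[of _ m n] psi_fin_on psi_add psi_diff fscale_minus psi_fscale op_sign_def)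
       (simp add: fscale_def fun_eq_iff algebra_simps)
next
  case False
  then show ?thesis using assms
    by (simp add: current_term_def fdiag_fscale fdiag_psi[of _ m n] psi_fin_on psi_add psi_diff fscale_minus psi_fscale op_sign_def)
       (simp add: fscale_def fun_eq_iff algebra_simps)
qed

lemma fdiag_current:
  assumes "f \<in> fin_on (cfgs m n)" "a \<in> idxs m n" "b \<in> idxs m n"
    and "\<And>i. mode_sign (a, i + k) * g (a, i + k) - mode_sign (b, i) * g (b, i) = z"
  shows "fdiag (lsum g) (current a b k f) = current a b k (fdiag (lsum g) f) + fscale z (current a b k f)"
proof -
  obtain N where N: "bnd N f" "bnd N (fdiag (lsum g) f)"
    by (rule tame_vecE2[OF fin_on_cfgs_tame[OF assms(1)] fin_on_cfgs_tame[OF fin_on_fdiag[OF assms(1)]]])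
  note eq = current_eq[OF N(1) finite_atLeastAtMost_int order.refl, of a b]
    current_eq[OF N(2) finite_atLeastAtMost_int order.refl, of a b]
  show ?thesis
    by (simp only: eq fdiag_sum fdiag_current_term[OF assms(1-3)] assms(4) sum.distrib fscale_sum)
qed

text \<open>Each term measures one occupation number; normal ordering removes the infinite vacuum
  contribution of the modes \<open>i \<ge> 0\<close>.\<close>

lemma current_diag:
  assumes "f \<in> fin_on (cfgs m n)"
  shows "current a a 0 f = fdiag (lsum (\<lambda>p. if fst p = a then mode_sign p else 0)) f"
proof
  fix c
  obtain N where N: "bnd N f" using fin_on_cfgs_tame[OF assms] by (auto simp: tame_vec_def)
  have app: "sum F I c = (\<Sum>i\<in>I. F i c)" for F :: "int \<Rightarrow> fock" and I
    by (induction I rule: infinite_finite_induct) auto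
  show "current a a 0 f c = fdiag (lsum (\<lambda>p. if fst p = a then mode_sign p else 0)) f c"
  proof (cases "f c = 0")
    case True
    have "current_term a a 0 i f c = 0" for i
      unfolding current_term_def psi_def fscale_def using True
      by (cases "c (a, i)") (auto simp: occ_shift_def occ_coeff_def fun_upd_idem creates_def)
    then show ?thesis using True current_eq[OF N _ order.refl, of 0 a a] by (simp add: app fdiag_def)
  next
    case False
    then have c: "c \<in> cfgs m n" using assms by (auto simp: fin_on_def)
    then have le1: "fermi p \<Longrightarrow> c p \<le> 1" for p using cfgs_fermi by blast
    have b: "current_term a a 0 i f c = of_nat (c (a, i)) * mode_sign (a, i) * f c" for i
      unfolding current_term_def psi_def fscale_def using le1[of "(a, i)"]
      by (cases "c (a, i)") (auto simp: occ_shift_def occ_coeff_def fun_upd_idem creates_def exchange_sign_def mode_sign_def)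
    have fin: "finite {p. c p \<noteq> 0}" using c by (simp add: cfgs_def)
    let ?S = "{p. c p \<noteq> 0} \<union> (\<lambda>i. (a, i)) ` {-N..N}"
    have "(lsum (\<lambda>p. if fst p = a then mode_sign p else 0) c :: complex)
        = (\<Sum>p\<in>?S. of_nat (c p) * (if fst p = a then mode_sign p else 0))"
      using fin by (intro lsum_superset) auto
    also have "\<dots> = (\<Sum>p\<in>(\<lambda>i. (a, i)) ` {-N..N}. of_nat (c p) * (if fst p = a then mode_sign p else 0))"
    proof (intro sum.mono_neutral_right ballI)
      fix p assume p: "p \<in> ?S - (\<lambda>i. (a, i)) ` {-N..N}"
      then have "\<bar>snd p\<bar> < N" using N False unfolding bnd_def by blast
      then have "fst p \<noteq> a" using p by (cases p) (auto simp: image_iff)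
      then show "of_nat (c p) * (if fst p = a then mode_sign p else 0) = 0" by simp
    qed (use fin in auto)
    also have "\<dots> = (\<Sum>i\<in>{-N..N}. of_nat (c (a, i)) * mode_sign (a, i))"
      by (subst sum.reindex) (auto simp: inj_on_def)
    finally show ?thesis using current_eq[OF N _ order.refl, of 0 a a]
      by (simp add: app fdiag_def b sum_distrib_right)
  qed
qed

section \<open>The energy of a fermion as a polynomial in currents\<close>

definition pair_op :: "idx \<Rightarrow> int \<Rightarrow> int \<Rightarrow> fock \<Rightarrow> fock" where
  "pair_op a u s f = psi True (a, u) (psi False (a, s) f)"

text \<open>The quadruple lists source and target of two successive moves, \<open>s\<close> to
  \<open>u\<close> and \<open>s'\<close> to \<open>u'\<close>.\<close>

definition quartic_op :: "idx \<Rightarrow> fock \<Rightarrow> int \<times> int \<times> int \<times> int \<Rightarrow> fock" where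
  "quartic_op a f = (\<lambda>(s, u, s', u'). psi True (a, u') (psi True (a, u) (psi False (a, s') (psi False (a, s) f))))"

lemma pair_op_pair_op:
  assumes "parity a = 0"
  shows "pair_op a u' s' (pair_op a u s f) = (if s' = u then pair_op a u' s f else 0) - quartic_op a f (s, u, s', u')"
  using psi_car[of "(a, s')" "(a, u)" "psi False (a, s) f"] assms
  by (auto simp: pair_op_def quartic_op_def psi_add psi_fscale exchange_sign_def fscale_minus psi_diff)

lemma pair_op_sum: "pair_op a u s (sum g I) = (\<Sum>i\<in>I. pair_op a u s (g i))"
  by (simp add: pair_op_def psi_sum)

lemma quartic_op_swap: "parity a = 0 \<Longrightarrow> quartic_op a f (s, u', s', u) = - quartic_op a f (s, u, s', u')"
  using psi_psi[of "(a, u)" "(a, u')" True True "psi False (a, s') (psi False (a, s) f)"]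
  by (simp add: quartic_op_def exchange_sign_def fscale_minus)

lemma quartic_op_swap2: "parity a = 0 \<Longrightarrow> quartic_op a f (s', u', s, u) = quartic_op a f (s, u, s', u')"
  using quartic_op_swap[of a f s u s' u'] psi_psi[of "(a, s)" "(a, s')" False False f]
  by (simp add: quartic_op_def exchange_sign_def fscale_minus psi_fscale)
     (metis (no_types, lifting) fscale_minus fscale_simps(3) psi_fscale psi_psi minus_minus)

text \<open>The condition on the sums says that the two moves have opposite loop degrees
  \<open>u - s\<close> and \<open>u' - s'\<close>.\<close>

definition quads :: "int set \<Rightarrow> (int \<times> int \<times> int \<times> int) set" where
  "quads w = {(s, u, s', u'). s \<in> w \<and> u \<in> w \<and> s' \<in> w \<and> u' \<in> w \<and> s + s' = u + u'}"

lemma finite_quads: "finite w \<Longrightarrow> finite (quads w)"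
  by (rule finite_subset[of _ "w \<times> w \<times> w \<times> w"]) (auto simp: quads_def)

lemma fock_double_zero: "(f :: fock) = - f \<Longrightarrow> f = 0"
  by (simp add: fun_eq_iff)

text \<open>
  The quartic terms cancel because they are antisymmetric under the exchange of the two
  creation operators, which leaves an operator that is diagonal on configurations.
\<close>

lemma sum_quartic_op_upper:
  assumes "finite w" and a: "parity a = 0"
  defines "A \<equiv> \<lambda>f. \<Sum>s\<in>w. pair_op a s s f"
  shows "(\<Sum>q\<in>{(s, u, s', u') \<in> quads w. s < u}. quartic_op a f q) = fscale (1/2) (A (A f) - A f)"
proof -
  let ?R = "quartic_op a f" and ?Q = "quads w"
  let ?P = "{(s, u, s', u') \<in> ?Q. s < u}" and ?M = "{(s, u, s', u') \<in> ?Q. u < s}"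
    and ?Z = "{(s, u, s', u') \<in> ?Q. s = u}"
  have fin: "finite ?P" "finite ?M" "finite ?Z"
    by (rule finite_subset[OF _ finite_quads[OF assms(1)]]; auto)+
  have swap: "- quartic_op a f (s, u', s', u) = quartic_op a f (s, u, s', u')" for s u s' u'
    using quartic_op_swap[OF a, of f s u s' u'] by simp
  have "sum ?R ?Q = (\<Sum>q\<in>?Q. - ?R q)"
    by (rule sum.reindex_bij_witness[of _ "\<lambda>(s, u, s', u'). (s, u', s', u)" "\<lambda>(s, u, s', u'). (s, u', s', u)"])
      (auto simp: quads_def intro: swap)
  then have all: "sum ?R ?Q = 0"
    by (intro fock_double_zero) (simp add: sum_negf)
  \<comment> \<open>Exchanging the two moves keeps the operator and, because
    \<open>s + s' = u + u'\<close>, turns \<open>s < u\<close> into \<open>u < s\<close>.\<close>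
  have "sum ?R ?P = sum ?R ?M"
    by (rule sum.reindex_bij_witness[of _ "\<lambda>(s, u, s', u'). (s', u', s, u)" "\<lambda>(s, u, s', u'). (s', u', s, u)"])
      (auto simp: quads_def intro: quartic_op_swap2[OF a])
  moreover have "sum ?R ?Q = sum ?R ?P + (sum ?R ?M + sum ?R ?Z)"
  proof -
    have "?Q = ?P \<union> (?M \<union> ?Z)" by auto
    then have "sum ?R ?Q = sum ?R (?P \<union> (?M \<union> ?Z))" by simp
    also have "\<dots> = sum ?R ?P + sum ?R (?M \<union> ?Z)"
      by (rule sum.union_disjoint) (use fin in auto)
    also have "sum ?R (?M \<union> ?Z) = sum ?R ?M + sum ?R ?Z"
      by (rule sum.union_disjoint) (use fin in auto)
    finally show ?thesis .
  qed
  \<comment> \<open>All quartic terms add up to zero, so twice the sum over \<open>?P\<close> is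
    minus the diagonal part \<open>?Z\<close>, which is expressed by \<open>A\<close> below.\<close>
  ultimately have eq: "sum ?R ?P + (sum ?R ?P + sum ?R ?Z) = 0" using all by simp
  have "sum ?R ?Z = (\<Sum>(s', s)\<in>w \<times> w. ?R (s, s, s', s'))"
    by (rule sum.reindex_bij_witness[of _ "\<lambda>(s', s). (s, s, s', s')" "\<lambda>(s, u, s', u'). (s', s)"])
      (auto simp: quads_def)
  also have "\<dots> = (\<Sum>(s', s)\<in>w \<times> w. (if s' = s then pair_op a s' s f else 0) - pair_op a s' s' (pair_op a s s f))"
    by (rule sum.cong) (auto simp: pair_op_pair_op[OF a])
  also have "\<dots> = (\<Sum>s'\<in>w. \<Sum>s\<in>w. (if s' = s then pair_op a s' s f else 0) - pair_op a s' s' (pair_op a s s f))"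
    by (simp add: sum.cartesian_product)
  also have "\<dots> = A f - A (A f)"
    unfolding sum_subtractf A_def pair_op_sum using assms(1) by (simp add: sum.delta)
  finally have Z: "sum ?R ?Z = A f - A (A f)" .
  show ?thesis
  proof
    fix c
    have "(sum ?R ?P + (sum ?R ?P + sum ?R ?Z)) c = 0" unfolding eq by simp
    then have "2 * sum ?R ?P c = A (A f) c - A f c" unfolding Z by (simp add: algebra_simps)
    then show "sum ?R ?P c = fscale (1/2) (A (A f) - A f) c" by (simp add: fscale_def mult.commute)
  qed
qed

text \<open>The contraction \<open>s' = u\<close> forces \<open>u' = s\<close>, so beside the
  quartic terms only diagonal operators remain, each \<open>s\<close> counted once for every
  \<open>u\<close> above it in the window.\<close>

lemma sum_PP_pair_op:
  assumes "finite w" and a: "parity a = 0"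
  defines "A \<equiv> \<lambda>f. \<Sum>s\<in>w. pair_op a s s f"
  shows "(\<Sum>(s, u, s', u')\<in>{(s, u, s', u') \<in> quads w. s < u}. pair_op a u' s' (pair_op a u s f)) =
    (\<Sum>s\<in>w. fscale (of_nat (card {u\<in>w. s < u})) (pair_op a s s f)) + fscale (1/2) (A f - A (A f))"
proof -
  let ?P = "{(s, u, s', u') \<in> quads w. s < u}"
  have finP: "finite ?P"
    by (rule finite_subset[OF _ finite_quads[OF assms(1)]]) auto
  have "(\<Sum>(s, u, s', u')\<in>?P. pair_op a u' s' (pair_op a u s f)) =
      (\<Sum>q\<in>?P. (case q of (s, u, s', u') \<Rightarrow> if s' = u then pair_op a u' s f else 0) - quartic_op a f q)"
    by (rule sum.cong) (auto simp: pair_op_pair_op[OF a])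
  also have "\<dots> = (\<Sum>(s, u, s', u')\<in>?P. if s' = u then pair_op a u' s f else 0) - sum (quartic_op a f) ?P"
    by (rule sum_subtractf)
  also have "(\<Sum>(s, u, s', u')\<in>?P. if s' = u then pair_op a u' s f else 0) =
      (\<Sum>(s, u, s', u')\<in>{(s, u, s', u') \<in> ?P. s' = u}. pair_op a u' s f)"
    by (rule sum.mono_neutral_cong_right[OF finP]) auto
  also have "\<dots> = (\<Sum>(s, u)\<in>Sigma w (\<lambda>s. {u\<in>w. s < u}). pair_op a s s f)"
    by (rule sum.reindex_bij_witness[of _ "\<lambda>(s, u). (s, u, u, s)" "\<lambda>(s, u, s', u'). (s, u)"])
      (auto simp: quads_def)
  also have "\<dots> = (\<Sum>s\<in>w. \<Sum>u\<in>{u\<in>w. s < u}. pair_op a s s f)"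
    using assms(1) by (subst sum.Sigma) auto
  also have "\<dots> = (\<Sum>s\<in>w. fscale (of_nat (card {u\<in>w. s < u})) (pair_op a s s f))"
    by (rule sum.cong[OF refl]) (simp only: sum_fscale_same[of 1, unfolded fscale_simps mult_1_right])
  finally have eq: "(\<Sum>(s, u, s', u')\<in>?P. pair_op a u' s' (pair_op a u s f)) =
    (\<Sum>s\<in>w. fscale (of_nat (card {u\<in>w. s < u})) (pair_op a s s f)) - sum (quartic_op a f) ?P" .
  show ?thesis
    unfolding eq sum_quartic_op_upper[OF assms(1) a] A_def fscale_diff by (rule ext) simp
qed

section \<open>Truncating the products of currents to a finite window\<close>

lemma bnd_psi_lt: "bnd N f \<Longrightarrow> \<bar>snd p\<bar> < N \<Longrightarrow> bnd N (psi s p f)"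
  using bnd_psi[of N f p s] by (simp add: max_absorb1)

lemma bnd_sum: "0 \<le> N \<Longrightarrow> (\<And>i. i \<in> I \<Longrightarrow> bnd N (g i)) \<Longrightarrow> bnd N (sum g I)"
  by (induction I rule: infinite_finite_induct) (simp_all only: sum.infinite sum.empty sum.insert bnd_0 bnd_add insert_iff simp_thms)

lemma current_term_pair_op: "k \<noteq> 0 \<Longrightarrow> current_term a a k s f = pair_op a (s + k) s f"
  by (simp add: current_term_alt pair_op_def)

text \<open>For \<open>u \<noteq> s\<close> the factors can be exchanged up to sign, so it is enough
  that one of them annihilates.\<close>

lemma pair_op_eq_0:
  assumes "bnd N f" "u \<noteq> s" "s < - N \<or> N \<le> u"
  shows "pair_op a u s f = 0"
proof (cases "s < - N")
  case True
  then have "psi False (a, s) f = 0"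
    using assms(1) by (intro psi_annihilates) (auto simp: creates_def bnd_def)
  then show ?thesis by (simp add: pair_op_def)
next
  case False
  then have "psi True (a, u) f = 0"
    using assms(1,3) by (intro psi_annihilates) (auto simp: creates_def bnd_def)
  then show ?thesis using psi_car'[of "(a, u)" "(a, s)" f] assms(2) by (simp add: pair_op_def)
qed

lemma current_window:
  assumes "bnd N f" "k \<noteq> 0" "finite w" "{-N..<N + \<bar>k\<bar>} \<subseteq> w" "{-N - \<bar>k\<bar>..<N} \<subseteq> w"
  shows "current a a k f = (\<Sum>s\<in>{s\<in>w. s + k \<in> w}. pair_op a (s + k) s f)"
proof -
  have "current a a k f = (\<Sum>s\<in>w \<union> {-N..N + \<bar>k\<bar>}. pair_op a (s + k) s f)"
    using current_eq[OF assms(1), of "w \<union> {-N..N + \<bar>k\<bar>}" k a a] assms(2,3) by (simp add: current_term_pair_op)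
  also have "\<dots> = (\<Sum>s\<in>{s\<in>w. s + k \<in> w}. pair_op a (s + k) s f)"
  proof (rule sum.mono_neutral_right)
    show "\<forall>i\<in>w \<union> {- N..N + \<bar>k\<bar>} - {s \<in> w. s + k \<in> w}. pair_op a (i + k) i f = 0"
    proof
      fix i assume "i \<in> w \<union> {- N..N + \<bar>k\<bar>} - {s \<in> w. s + k \<in> w}"
      then have "i \<notin> w \<or> i + k \<notin> w" by auto
      then have "i \<notin> {-N..<N + \<bar>k\<bar>} \<or> i + k \<notin> {-N - \<bar>k\<bar>..<N}" using assms(4,5) by blast
      then have "i < - N \<or> N \<le> i + k" by auto
      then show "pair_op a (i + k) i f = 0" using assms(1,2) by (intro pair_op_eq_0) auto
    qed
  qed (use assms(3) in auto)
  finally show ?thesis .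
qed

text \<open>A term survives only for \<open>- N \<le> s\<close> and \<open>s + k < N\<close>; with
  \<open>k > 0\<close> both modes then have absolute value at most \<open>N\<close>, so the bound
  grows by 1 and not by \<open>k\<close>.\<close>

lemma current_raise_bnd:
  assumes "bnd N f" "0 < k"
  shows "bnd (N + 1) (current a a k f)"
proof -
  have N0: "0 \<le> N" using assms by (simp add: bnd_def)
  have "bnd (N + 1) (pair_op a (s + k) s f)" for s
  proof (cases "s < - N \<or> N \<le> s + k")
    case True
    then have "pair_op a (s + k) s f = 0" using assms by (intro pair_op_eq_0) auto
    then show ?thesis using N0 by simp
  next
    case False
    then show ?thesis unfolding pair_op_def using assms N0
      by (intro bnd_psi_lt) (auto intro: bnd_mono)
  qed
  moreover have "current a a k f = (\<Sum>s\<in>{-N..N + \<bar>k\<bar>}. pair_op a (s + k) s f)"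
    using current_eq[OF assms(1) _ order.refl, of k a a] assms(2) by (simp add: current_term_pair_op)
  ultimately show ?thesis using N0 by (simp add: bnd_sum)
qed

lemma current_raise_eq_0:
  assumes "bnd N f" "0 < k" "2 * N \<le> k"
  shows "current a a k f = 0"
proof -
  have "pair_op a (s + k) s f = 0" for s
    using assms by (intro pair_op_eq_0[of N]) auto
  then show ?thesis
    using current_eq[OF assms(1) _ order.refl, of k a a] assms(2) by (simp add: current_term_pair_op)
qed

lemma pair_op_diag:
  assumes "f \<in> fin_on (cfgs m n)" "parity a = 0"
  shows "pair_op a s s f = fdiag (\<lambda>c. if s < 0 then of_nat (c (a, s)) else 1 - of_nat (c (a, s))) f"
proof
  fix c
  show "pair_op a s s f c = fdiag (\<lambda>c. if s < 0 then of_nat (c (a, s)) else 1 - of_nat (c (a, s))) f c"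
  proof (cases "f c = 0")
    case True
    then show ?thesis unfolding pair_op_def psi_def fdiag_def
      by (cases "c (a, s)") (auto simp: occ_shift_def occ_coeff_def fun_upd_idem creates_def)
  next
    case False
    then have "c \<in> cfgs m n" using assms by (auto simp: fin_on_def)
    then have "c (a, s) \<le> 1" by (rule cfgs_fermi) (simp add: assms(2))
    then show ?thesis unfolding pair_op_def psi_def fdiag_def using assms(2)
      by (cases "c (a, s)") (auto simp: occ_shift_def occ_coeff_def fun_upd_idem creates_def)
  qed
qed

text \<open>Multiplied by \<open>mode_sign\<close> this is \<open>-i\<close> for every mode number
  \<open>i\<close>, negative or not; that linearity later separates the modes.\<close>

definition level :: "idx \<Rightarrow> mode \<Rightarrow> complex" where
  "level a p = (if fst p = a then of_int \<bar>snd p\<bar> else 0)"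

lemma lsum_window:
  assumes "c \<in> cfgs m n" "\<And>p. c p \<noteq> 0 \<Longrightarrow> \<bar>snd p\<bar> \<le> W"
    and "\<And>p. fst p \<noteq> a \<Longrightarrow> g p = 0"
  shows "lsum g c = (\<Sum>s\<in>{-W..W}. of_nat (c (a, s)) * g (a, s))"
proof -
  have fin: "finite {p. c p \<noteq> 0}" using assms by (simp add: cfgs_def)
  let ?S = "{p. c p \<noteq> 0} \<union> (\<lambda>i. (a, i)) ` {-W..W}"
  have "lsum g c = (\<Sum>p\<in>?S. of_nat (c p) * g p)"
    using fin by (intro lsum_superset) auto
  also have "\<dots> = (\<Sum>p\<in>(\<lambda>i. (a, i)) ` {-W..W}. of_nat (c p) * g p)"
  proof (intro sum.mono_neutral_right ballI)
    fix p assume p: "p \<in> ?S - (\<lambda>i. (a, i)) ` {-W..W}"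
    then have "\<bar>snd p\<bar> \<le> W" using assms(2) by blast
    then have "fst p \<noteq> a" using p by (cases p) (auto simp: image_iff)
    then show "of_nat (c p) * g p = 0" using assms(3) by simp
  qed (use fin in auto)
  also have "\<dots> = (\<Sum>i\<in>{-W..W}. of_nat (c (a, i)) * g (a, i))"
    by (subst sum.reindex) (auto simp: inj_on_def)
  finally show ?thesis .
qed

lemma sum_app: "sum F I c = (\<Sum>i\<in>I. F i c)" for F :: "'b \<Rightarrow> 'c \<Rightarrow> 'd::comm_monoid_add"
  by (induction I rule: infinite_finite_induct) auto

text \<open>For \<open>j \<ge> 2 * N\<close> both sides vanish. Otherwise the two currents act on
  vectors bounded by \<open>N\<close> and \<open>N + 1\<close> in degree below \<open>2 * N\<close>,
  so they reach no mode beyond \<open>3 * N + 1\<close>, which the bound on \<open>W\<close>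
  covers.\<close>

lemma current_E_window:
  assumes "bnd N f" "0 < j" "3 * N + 5 \<le> W"
  defines "w \<equiv> {-W..W}"
  shows "current a a (- j) (current a a j f) =
    (\<Sum>(s', s)\<in>{s'\<in>w. s' - j \<in> w} \<times> {s\<in>w. s + j \<in> w}. pair_op a (s' - j) s' (pair_op a (s + j) s f))"
proof (cases "2 * N \<le> j")
  case True
  have "pair_op a (s + j) s f = 0" for s
    using assms(1,2) True by (intro pair_op_eq_0[of N]) auto
  then show ?thesis
    using current_raise_eq_0[OF assms(1,2) True, of a] by (simp add: pair_op_def split_def)
next
  case False
  have N0: "0 \<le> N" using assms(1) by (simp add: bnd_def)
  have 1: "current a a j f = (\<Sum>s\<in>{s\<in>w. s + j \<in> w}. pair_op a (s + j) s f)"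
    by (rule current_window[OF assms(1)]) (use assms False N0 in auto)
  have "current a a (- j) (current a a j f) = (\<Sum>s\<in>{s\<in>w. s + - j \<in> w}. pair_op a (s + - j) s (current a a j f))"
    by (rule current_window[OF current_raise_bnd[OF assms(1,2)]]) (use assms False N0 in auto)
  also have "\<dots> = (\<Sum>s'\<in>{s'\<in>w. s' - j \<in> w}. \<Sum>s\<in>{s\<in>w. s + j \<in> w}. pair_op a (s' - j) s' (pair_op a (s + j) s f))"
    unfolding 1 pair_op_sum by simp
  finally show ?thesis by (simp add: sum.cartesian_product)
qed

text \<open>The substitution j = u - s: the degrees from 1 to \<open>2 * W\<close> exhaust the
  positive differences inside the window.\<close>

lemma current_E_sum:
  assumes "bnd N f" "3 * N + 5 \<le> W"
  shows "(\<Sum>j\<in>{1..2 * W}. current a a (- j) (current a a j f)) =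
    (\<Sum>(s, u, s', u')\<in>{(s, u, s', u') \<in> quads {-W..W}. s < u}. pair_op a u' s' (pair_op a u s f))"
proof -
  let ?w = "{-W..W}"
  let ?S = "\<lambda>j. {s'\<in>?w. s' - j \<in> ?w} \<times> {s\<in>?w. s + j \<in> ?w}"
  have "(\<Sum>j\<in>{1..2 * W}. current a a (- j) (current a a j f)) =
      (\<Sum>j\<in>{1..2 * W}. \<Sum>(s', s)\<in>?S j. pair_op a (s' - j) s' (pair_op a (s + j) s f))"
    by (rule sum.cong[OF refl], rule current_E_window[OF assms(1) _ assms(2)]) simp
  also have "\<dots> = (\<Sum>(j, s', s)\<in>Sigma {1..2 * W} ?S. pair_op a (s' - j) s' (pair_op a (s + j) s f))"
    by (rule sum.Sigma)
      (auto intro!: finite_cartesian_product intro: finite_subset[OF _ finite_atLeastAtMost_int[of "-W" W]])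
  also have "\<dots> = (\<Sum>(s, u, s', u')\<in>{(s, u, s', u') \<in> quads ?w. s < u}. pair_op a u' s' (pair_op a u s f))"
    by (rule sum.reindex_bij_witness[of _ "\<lambda>(s, u, s', u'). (u - s, s', s)" "\<lambda>(j, s', s). (s, s + j, s', s' - j)"])
      (auto simp: quads_def)
  finally show ?thesis .
qed

definition acount :: "idx \<Rightarrow> mode \<Rightarrow> complex" where
  "acount a p = (if fst p = a then mode_sign p else 0)"

text \<open>Let n(s) be the eigenvalue of \<open>pair_op a s s\<close> and A their sum over the
  window. The products of currents give the sum of (W - s) n(s) plus (A - A^2)/2. Substituting A = Q
  + w1, with Q the eigenvalue of \<open>current a a 0\<close>, the terms in Q times w1 cancel and
  Q/2 + Q^2/2 is left to be added back. The scalar equals 0, because \<open>K\<close> is W (W +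
  1)/2.\<close>

lemma energy_identity:
  assumes f: "f \<in> fin_on (cfgs m n)" and "bnd N f" "3 * N + 5 \<le> W" and a: "parity a = 0"
  defines "K \<equiv> \<Sum>s\<in>{0..W}. complex_of_int s" and "w1 \<equiv> complex_of_int (W + 1)"
  shows "fdiag (lsum (level a)) f = (\<Sum>j\<in>{1..2 * W}. current a a (- j) (current a a j f))
    + fscale (K - (w1 - 1/2) * w1 + w1 * w1 / 2) f + fscale (1/2) (current a a 0 f)
    + fscale (1/2) (current a a 0 (current a a 0 f))"
proof
  fix c
  let ?w = "{-W..W}"
  let ?n = "\<lambda>s c. if s < 0 then of_nat (c (a, s)) else 1 - of_nat (c (a, s)) :: complex"
  define A where "A = (\<lambda>f. \<Sum>s\<in>?w. pair_op a s s f)"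
  have N0: "0 \<le> N" using assms(2) by (simp add: bnd_def)
  have Af: "A g c = (\<Sum>s\<in>?w. ?n s c) * g c" if "g \<in> fin_on (cfgs m n)" for g
    unfolding A_def sum_app by (simp add: pair_op_diag[OF that a] fdiag_def sum_distrib_right)
  have A_fin: "A f \<in> fin_on (cfgs m n)"
  proof -
    have "A f = (\<Sum>s\<in>?w. fdiag (?n s) f)"
      unfolding A_def by (rule sum.cong[OF refl]) (rule pair_op_diag[OF f a])
    then show ?thesis by (simp only:) (rule fin_on_sum, rule fin_on_fdiag, rule f)
  qed
  have E0: "current a a 0 g = fdiag (lsum (acount a)) g" if "g \<in> fin_on (cfgs m n)" for g
    using current_diag[OF that, of a] unfolding acount_def[abs_def] .
  have E00: "current a a 0 (current a a 0 f) c = lsum (acount a) c * (lsum (acount a) c * f c)"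
    unfolding E0[OF f] E0[OF fin_on_fdiag[OF f]] by (simp add: fdiag_def)
  have card: "of_nat (card {u\<in>?w. s < u}) = complex_of_int (W - s)" if "s \<in> ?w" for s
  proof -
    have "{u\<in>?w. s < u} = {s<..W}" using that by auto
    then show ?thesis using that by simp
  qed
  have T: "(\<Sum>j\<in>{1..2 * W}. current a a (- j) (current a a j f)) c =
      (\<Sum>s\<in>?w. of_int (W - s) * ?n s c) * f c
      + ((\<Sum>s\<in>?w. ?n s c) * f c - (\<Sum>s\<in>?w. ?n s c) * ((\<Sum>s\<in>?w. ?n s c) * f c)) / 2"
  proof -
    have "(\<Sum>j\<in>{1..2 * W}. current a a (- j) (current a a j f)) c =
      (\<Sum>s\<in>?w. of_nat (card {u\<in>?w. s < u}) * pair_op a s s f c) + (A f c - A (A f) c) / 2"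
      unfolding current_E_sum[OF assms(2,3)] sum_PP_pair_op[OF finite_atLeastAtMost_int a]
      by (simp add: sum_app fscale_def A_def)
    also have "(\<Sum>s\<in>?w. of_nat (card {u\<in>?w. s < u}) * pair_op a s s f c) =
        (\<Sum>s\<in>?w. of_int (W - s) * ?n s c * f c)"
      by (rule sum.cong[OF refl]) (simp only: card pair_op_diag[OF f a] fdiag_def mult.assoc)
    finally show ?thesis unfolding Af[OF A_fin] Af[OF f] by (simp add: sum_distrib_right)
  qed
  show "fdiag (lsum (level a)) f c = ((\<Sum>j\<in>{1..2 * W}. current a a (- j) (current a a j f))
    + fscale (K - (w1 - 1/2) * w1 + w1 * w1 / 2) f + fscale (1/2) (current a a 0 f)
    + fscale (1/2) (current a a 0 (current a a 0 f))) c"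
  proof (cases "f c = 0")
    case True
    then show ?thesis using T E00 by (simp add: fdiag_def fscale_def E0[OF f])
  next
    case False
    then have c: "c \<in> cfgs m n" using f by (auto simp: fin_on_def)
    have cW: "\<bar>snd p\<bar> \<le> W" if "c p \<noteq> 0" for p
    proof -
      have "\<bar>snd p\<bar> < N" using that assms(2) False unfolding bnd_def by blast
      then show ?thesis using assms(3) N0 by simp
    qed
    have lev: "lsum (level a) c = (\<Sum>s\<in>?w. of_nat (c (a, s)) * of_int \<bar>s\<bar>)"
      using lsum_window[OF c cW, where g = "level a" and a = a] by (simp add: level_def)
    have cnt: "lsum (acount a) c = (\<Sum>s\<in>?w. of_nat (c (a, s)) * mode_sign (a, s))"
      using lsum_window[OF c cW, where g = "acount a" and a = a] by (simp add: acount_def)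
    have pos: "(\<Sum>s\<in>?w. if 0 \<le> s then g s else 0) = (\<Sum>s\<in>{0..W}. g s)" for g :: "int \<Rightarrow> complex"
      by (rule sum.mono_neutral_cong_right) (use N0 assms(3) in auto)
    \<comment> \<open>\<open>pair_op\<close> is not normally ordered: each of the
      \<open>W + 1\<close> modes with \<open>0 \<le> s\<close> contributes 1 when it is
      empty.\<close>
    have nsum: "(\<Sum>s\<in>?w. ?n s c) = lsum (acount a) c + w1"
    proof -
      have "(\<Sum>s\<in>?w. ?n s c) = (\<Sum>s\<in>?w. of_nat (c (a, s)) * mode_sign (a, s) + (if 0 \<le> s then 1 else 0))"
        by (rule sum.cong) (auto simp: mode_sign_def)
      also have "\<dots> = lsum (acount a) c + (\<Sum>s\<in>{0..W}. 1)"
        unfolding sum.distrib cnt pos by simp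
      finally show ?thesis using N0 assms(3) by (simp add: w1_def)
    qed
    have "(\<Sum>s\<in>?w. of_int (W - s) * ?n s c) =
        (\<Sum>s\<in>?w. of_int W * ?n s c - ((if 0 \<le> s then of_int s else 0) - of_nat (c (a, s)) * of_int \<bar>s\<bar>))"
      by (rule sum.cong) (auto simp: algebra_simps)
    also have "\<dots> = of_int W * (\<Sum>s\<in>?w. ?n s c) - (K - lsum (level a) c)"
      unfolding sum_subtractf pos lev K_def by (simp add: sum_distrib_left)
    finally have wsum: "(\<Sum>s\<in>?w. of_int (W - s) * ?n s c) =
        (w1 - 1) * (lsum (acount a) c + w1) - (K - lsum (level a) c)"
      unfolding nsum by (simp add: w1_def)
    show ?thesis
      unfolding plus_fun_apply T wsum nsum fscale_def E00
      unfolding E0[OF f] fdiag_def by (simp add: field_simps)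
  qed
qed

section \<open>Irreducibility of the charge subspaces\<close>

definition fres :: "cfg set \<Rightarrow> fock \<Rightarrow> fock" where
  "fres C f = (\<lambda>c. if c \<in> C then f c else 0)"

lemma fdiag_prod_mem:
  assumes "\<And>f. f \<in> U \<Longrightarrow> fdiag h f \<in> U" "fock.subspace U" "finite Y" "f \<in> U"
  shows "fdiag (\<lambda>c. \<Prod>y\<in>Y. h c - y) f \<in> U"
  using assms(3)
proof (induction Y)
  case empty
  have "fdiag (\<lambda>c. \<Prod>y\<in>{}. h c - y) f = f" by (simp add: fdiag_def)
  then show ?case using assms(4) by (simp only:)
next
  case (insert x Y)
  let ?g = "fdiag (\<lambda>c. \<Prod>y\<in>Y. h c - y) f"
  have "fdiag (\<lambda>c. \<Prod>y\<in>insert x Y. h c - y) f = fdiag h ?g + fscale (- x) ?g"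
    using insert(1,2) by (simp add: fdiag_def fscale_def fun_eq_iff algebra_simps)
  also have "\<dots> \<in> U"
    by (intro fock.subspace_add[OF assms(2)] fock.subspace_scale[OF assms(2)] assms(1) insert.IH)
  finally show ?case .
qed

text \<open>Lagrange interpolation in the eigenvalues of the diagonal operator.\<close>

lemma fres_mem:
  assumes "\<And>f. f \<in> U \<Longrightarrow> fdiag h f \<in> U" "fock.subspace U" "f \<in> U" "finite {c. f c \<noteq> 0}"
  shows "fres {c. h c = x} f \<in> U"
proof -
  define Y where "Y = h ` {c. f c \<noteq> 0} - {x}"
  have fin: "finite Y" using assms(4) by (simp add: Y_def)
  have nz: "(\<Prod>y\<in>Y. x - y) \<noteq> 0" using fin by (auto simp: Y_def)
  have "fres {c. h c = x} f = fscale (inverse (\<Prod>y\<in>Y. x - y)) (fdiag (\<lambda>c. \<Prod>y\<in>Y. h c - y) f)"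
  proof
    fix c
    show "fres {c. h c = x} f c = fscale (inverse (\<Prod>y\<in>Y. x - y)) (fdiag (\<lambda>c. \<Prod>y\<in>Y. h c - y) f) c"
    proof (cases "f c = 0 \<or> h c = x")
      case True
      then show ?thesis using nz by (auto simp: fres_def fscale_def fdiag_def)
    next
      case False
      then have "h c \<in> Y" by (auto simp: Y_def)
      then have "(\<Prod>y\<in>Y. h c - y) = 0" using fin by (auto simp: prod_zero_iff)
      then show ?thesis using False by (simp add: fres_def fscale_def fdiag_def)
    qed
  qed
  then show ?thesis
    using fock.subspace_scale[OF assms(2) fdiag_prod_mem[OF assms(1-2) fin assms(3)]] by (simp only:)
qed

lemma fres_decompose:
  assumes "finite {c. f c \<noteq> 0}"
  shows "f = (\<Sum>x\<in>h ` {c. f c \<noteq> 0}. fres {c. h c = x} f)"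
proof
  fix c
  have "(\<Sum>x\<in>h ` {c. f c \<noteq> 0}. fres {c. h c = x} f) c = (\<Sum>x\<in>h ` {c. f c \<noteq> 0}. if x = h c then f c else 0)"
    unfolding sum_app by (rule sum.cong) (auto simp: fres_def)
  also have "\<dots> = f c" using assms by (auto simp: sum.delta)
  finally show "f c = (\<Sum>x\<in>h ` {c. f c \<noteq> 0}. fres {c. h c = x} f) c" by simp
qed

lemma fdiag_eigen: "fdiag h f = fscale x f \<longleftrightarrow> (\<forall>c. f c \<noteq> 0 \<longrightarrow> h c = x)"
  by (auto simp: fdiag_def fscale_def fun_eq_iff)

lemma fres_eigen:
  assumes "fdiag h f = fscale x f"
  shows "fres {c. h c = y} f = (if x = y then f else 0)"
  using assms unfolding fdiag_eigen by (auto simp: fres_def fun_eq_iff)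

lemma fres_sum: "fres C (sum g I) = (\<Sum>i\<in>I. fres C (g i))"
proof
  fix c
  show "fres C (sum g I) c = (\<Sum>i\<in>I. fres C (g i)) c"
    unfolding sum_app by (cases "c \<in> C") (simp_all add: fres_def sum_app)
qed

locale fock_stable =
  fixes m n :: nat and U :: "fock set"
  assumes sub: "fock.subspace U"
    and fin: "U \<subseteq> fin_on (cfgs m n)"
    and current_mem: "f \<in> U \<Longrightarrow> a \<in> idxs m n \<Longrightarrow> b \<in> idxs m n \<Longrightarrow> current a b k f \<in> U"
begin

lemma energy_mem:
  assumes "f \<in> U" "a \<in> idxs m n" "parity a = 0"
  shows "fdiag (lsum (level a)) f \<in> U"
proof -
  have f: "f \<in> fin_on (cfgs m n)" using assms(1) fin by (rule set_rev_mp)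
  obtain N where N: "bnd N f" using fin_on_cfgs_tame[OF f] by (auto simp: tame_vec_def)
  show ?thesis
    unfolding energy_identity[OF f N order.refl assms(3)]
    by (intro fock.subspace_add[OF sub] fock.subspace_scale[OF sub] fock.subspace_sum[OF sub]
        current_mem assms(1,2))
qed

lemma fres_U:
  assumes "\<And>f. f \<in> U \<Longrightarrow> fdiag h f \<in> U" "f \<in> U"
  shows "fres {c. h c = x} f \<in> U"
proof -
  have "f \<in> fin_on (cfgs m n)" using assms(2) fin by (rule set_rev_mp)
  then show ?thesis by (intro fres_mem sub assms) (simp_all add: fin_on_def)
qed

text \<open>
  The terms of the mode sum for \<open>current a b k\<close> change the energy of the fermions with index \<open>a\<close>
  by distinct amounts, so each of them preserves \<open>U\<close> separately.
\<close>

lemma single_mode_mem: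
  assumes f: "f \<in> U" and ab: "a \<in> idxs m n" "b \<in> idxs m n" and mode_par: "parity e = 0"
    and e: "e = a \<and> b \<noteq> e \<or> e = b \<and> a \<noteq> e"
  shows "psi True (a, i) (psi False (b, j) f) \<in> U"
proof -
  let ?h = "lsum (level e)"
  have eI: "e \<in> idxs m n" using e ab by auto
  have hU: "fdiag ?h g \<in> U" if "g \<in> U" for g by (rule energy_mem[OF that eI mode_par])
  have eig: "psi True (a, i) (psi False (b, j) g) \<in> U"
    if g: "g \<in> U" and gx: "fdiag ?h g = fscale x g" for g x
  proof -
    have gf: "g \<in> fin_on (cfgs m n)" using g fin by (rule set_rev_mp)
    obtain N where N: "bnd N g" using fin_on_cfgs_tame[OF gf] by (auto simp: tame_vec_def)
    define k where "k = i - j"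
    let ?I = "insert j {-N..N + \<bar>k\<bar>}"
    let ?G = "\<lambda>t. psi True (a, t + k) (psi False (b, t) g)"
    have neq: "a \<noteq> b" using e by auto
    have Eg: "current a b k g = (\<Sum>t\<in>?I. ?G t)"
      using current_eq[OF N _ subset_insertI, of j k a b] neq unfolding current_term_alt by simp
    \<comment> \<open>Since \<open>mode_sign\<close> times \<open>level\<close> is minus the mode
      number, the shift is affine in \<open>t\<close> with slope 1 or -1, and distinct terms lie in
      distinct eigenspaces.\<close>
    define sh where "sh = (\<lambda>t. if e = a then - of_int (t + k) else (of_int t :: complex))"
    have "fdiag ?h (?G t) = fscale (x + sh t) (?G t)" for t
    proof -
      have "fdiag ?h (?G t) = psi True (a, t + k) (psi False (b, t) (fdiag ?h g))
         + fscale (mode_sign (a, t + k) * level e (a, t + k) - mode_sign (b, t) * level e (b, t)) (?G t)"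
        using fdiag_current_term[OF gf ab, of "level e" k t] neq unfolding current_term_alt by simp
      also have "mode_sign (a, t + k) * level e (a, t + k) - mode_sign (b, t) * level e (b, t) = sh t"
        using e by (auto simp: level_def mode_sign_def sh_def)
      finally show ?thesis unfolding gx psi_fscale fscale_left .
    qed
    then have "fres {c. ?h c = x + sh j} (?G t) = (if t = j then ?G t else 0)" for t
      using fres_eigen[of ?h "?G t" "x + sh t" "x + sh j"] by (auto simp: sh_def)
    then have "fres {c. ?h c = x + sh j} (current a b k g) = ?G j"
      unfolding Eg fres_sum by (simp add: sum.delta del: sum.insert_if sum.insert)
    moreover have "fres {c. ?h c = x + sh j} (current a b k g) \<in> U"
      by (rule fres_U[OF hU current_mem[OF g ab]])
    ultimately show ?thesis by (simp add: k_def)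
  qed
  have finf: "finite {c. f c \<noteq> 0}" using f fin by (auto simp: fin_on_def)
  \<comment> \<open>A general \<open>f\<close> is split into its level components, which belong to
    \<open>U\<close> by interpolation.\<close>
  have "psi True (a, i) (psi False (b, j) f) =
      (\<Sum>x\<in>?h ` {c. f c \<noteq> 0}. psi True (a, i) (psi False (b, j) (fres {c. ?h c = x} f)))"
    by (subst fres_decompose[OF finf, of ?h]) (simp only: psi_sum)
  also have "\<dots> \<in> U"
  proof (rule fock.subspace_sum[OF sub])
    fix x
    show "psi True (a, i) (psi False (b, j) (fres {c. ?h c = x} f)) \<in> U"
      by (rule eig[OF fres_U[OF hU f], of _ x]) (auto simp: fdiag_eigen fres_def)
  qed
  finally show ?thesis .
qed

end

section \<open>Separating and connecting configurations by fermion-boson pairs\<close>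

definition occ :: "bool \<Rightarrow> mode \<Rightarrow> nat \<Rightarrow> complex" where
  "occ s p x = occ_coeff s p x * occ_coeff (\<not> s) p (occ_shift s p x)"

lemma occ_shift_occ_shift: "occ_coeff s p x \<noteq> 0 \<Longrightarrow> occ_shift (\<not> s) p (occ_shift s p x) = x"
  using occ_coeff_creates[of s p x] by (auto simp: occ_shift_def creates_def)

lemma psi_psi_diag: "psi s p (psi (\<not> s) p f) c = occ s p (c p) * f c"
proof (cases "occ_coeff s p (c p) = 0")
  case False
  then show ?thesis by (simp add: psi_def occ_def occ_shift_occ_shift)
qed (simp add: psi_def occ_def)

lemma psi_psi_fermi_bose:
  assumes "fermi p" "\<not> fermi K"
  shows "psi s p (psi t K f) = psi t K (psi s p f)"
proof -
  have "p \<noteq> K" using assms by auto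
  then show ?thesis using psi_psi[of p K s t f] assms by (simp add: exchange_sign_def)
qed

text \<open>
  The commutator of moving a particle from \<open>p\<close> to \<open>K\<close> and back: its value determines the occupation numbers
  of both modes.
\<close>

definition zsep :: "mode \<Rightarrow> mode \<Rightarrow> cfg \<Rightarrow> complex" where
  "zsep p K c = occ True p (c p) * occ False K (c K) - occ False p (c p) * occ True K (c K)"

lemma zsep_psi:
  assumes "fermi p" "\<not> fermi K"
  shows "fdiag (zsep p K) f = psi True p (psi False K (psi True K (psi False p f)))
    - psi True K (psi False p (psi True p (psi False K f)))"
proof
  fix c
  have 1: "psi True p (psi False K (psi True K (psi False p f))) = psi True p (psi False p (psi False K (psi True K f)))"
    by (simp only: psi_psi_fermi_bose[OF assms])
  have 2: "psi True K (psi False p (psi True p (psi False K f))) = psi False p (psi True p (psi True K (psi False K f)))"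
    by (simp only: psi_psi_fermi_bose[OF assms])
  show "fdiag (zsep p K) f c = (psi True p (psi False K (psi True K (psi False p f)))
    - psi True K (psi False p (psi True p (psi False K f)))) c"
    unfolding minus_apply 1 2
    using psi_psi_diag[of True p] psi_psi_diag[of False p] psi_psi_diag[of True K] psi_psi_diag[of False K]
    by (simp add: zsep_def fdiag_def algebra_simps)
qed

text \<open>The value is an integer: whether it is positive reveals the state of \<open>p\<close>,
  and its absolute value then reveals the occupation of \<open>K\<close>.\<close>

lemma zsep_inj:
  assumes "fermi p" "\<not> fermi K" "c p \<le> 1" "c' p \<le> 1" "zsep p K c = zsep p K c'"
  shows "c p = c' p \<and> c K = c' K"
proof -
  define z where "z = (\<lambda>c::cfg. if snd p < 0 \<longleftrightarrow> c p = 1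
    then (if snd K < 0 then int (c K) + 1 else - int (c K))
    else (if snd K < 0 then - int (c K) else int (c K) + 1))"
  have zz: "zsep p K d = of_int (z d)" if "d p \<le> 1" for d
  proof -
    have "d p = 0 \<or> d p = 1" using that by auto
    then show ?thesis using assms(1,2)
      by (cases "d K"; elim disjE)
        (auto simp: zsep_def z_def occ_def occ_coeff_def occ_shift_def creates_def)
  qed
  have "z c = z c'" using assms zz[of c] zz[of c'] by (metis of_int_eq_iff)
  moreover have "c p = 0 \<or> c p = 1" "c' p = 0 \<or> c' p = 1" using assms by auto
  ultimately show ?thesis by (auto simp: z_def split: if_splits)
qed

lemma occ_coeff_rev:
  assumes "occ_coeff s p x \<noteq> 0"
  shows "occ_coeff (\<not> s) p (occ_shift s p x) \<noteq> 0"
proof (cases "creates s p")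
  case True
  with occ_coeff_creates[OF assms] obtain y where "x = Suc y" using not0_implies_Suc by blast
  then show ?thesis using assms True
    by (auto simp: occ_coeff_def occ_shift_def creates_def simp flip: of_nat_Suc split: if_splits)
next
  case False
  then show ?thesis using assms
    by (auto simp: occ_coeff_def occ_shift_def creates_def split: if_splits)
qed

text \<open>Here \<open>x\<close> is the occupation after the step; since the operators act by
  pullback, \<open>occ_shift\<close> leads from the target back to the source.\<close>

lemma psi_fdelta:
  assumes "occ_shift s p x = c p" "occ_coeff s p x \<noteq> 0"
  obtains z where "z \<noteq> 0" "psi s p (fdelta c) = fscale z (fdelta (c(p := x)))"
proof
  show "occ_coeff s p x * jw p c \<noteq> 0" using assms by simp
  show "psi s p (fdelta c) = fscale (occ_coeff s p x * jw p c) (fdelta (c(p := x)))"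
  proof
    fix c'
    show "psi s p (fdelta c) c' = fscale (occ_coeff s p x * jw p c) (fdelta (c(p := x))) c'"
    proof (cases "c' = c(p := x)")
      case True
      then show ?thesis using assms by (simp add: psi_def fscale_def fdelta_def)
    next
      case False
      have "psi s p (fdelta c) c' = 0"
      proof (rule ccontr)
        assume "psi s p (fdelta c) c' \<noteq> 0"
        then have k: "occ_coeff s p (c' p) \<noteq> 0" and d: "c'(p := occ_shift s p (c' p)) = c"
          using psi_nonzero[of s p "fdelta c" c'] by (auto simp: fdelta_def split: if_splits)
        have "(c'(p := occ_shift s p (c' p))) p = c p" unfolding d ..
        then have "occ_shift s p (c' p) = occ_shift s p x" unfolding fun_upd_same assms(1) .
        then have "c' p = x" by (metis occ_shift_occ_shift[OF k] occ_shift_occ_shift[OF assms(2)])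
        then have "c' = c(p := x)" by (metis d fun_upd_triv fun_upd_upd)
        then show False using False by contradiction
      qed
      then show ?thesis using False by (simp add: fscale_def fdelta_def)
    qed
  qed
qed

lemma cfgs_idx: "c \<in> cfgs m n \<Longrightarrow> c p \<noteq> 0 \<Longrightarrow> fst p \<in> idxs m n"
  unfolding cfgs_def by blast

context fock_stable
begin

text \<open>The fermion is the index whose level is controlled; it may be created or annihilated,
  which are the two alternatives of \<open>single_mode_mem\<close>.\<close>

lemma single_pair_mem:
  assumes "f \<in> U" "fermi p" "\<not> fermi K" "fst p \<in> idxs m n" "fst K \<in> idxs m n"
  shows "psi s p (psi (\<not> s) K f) \<in> U"
proof -
  have neq: "fst p \<noteq> fst K" using assms by auto
  show ?thesis
  proof (cases s)
    case True
    then show ?thesis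
      using single_mode_mem[of f "fst p" "fst K" "fst p" "snd p" "snd K"] assms neq by auto
  next
    case False
    then show ?thesis
      using single_mode_mem[of f "fst K" "fst p" "fst p" "snd K" "snd p"] assms neq
        psi_psi_fermi_bose[OF assms(2,3), of False True f] by auto
  qed
qed

lemma zsep_mem:
  assumes "f \<in> U" "fermi p" "\<not> fermi K" "fst p \<in> idxs m n" "fst K \<in> idxs m n"
  shows "fdiag (zsep p K) f \<in> U"
proof -
  have 1: "psi True K (psi False p g) \<in> U" if "g \<in> U" for g
    using single_pair_mem[OF that assms(2-5), of False] psi_psi_fermi_bose[OF assms(2,3)] by simp
  have 2: "psi True p (psi False K g) \<in> U" if "g \<in> U" for g
    using single_pair_mem[OF that assms(2-5), of True] by simp
  show ?thesis
    unfolding zsep_psi[OF assms(2,3)]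
    by (intro fock.subspace_diff[OF sub] 1 2 assms(1))
qed

lemma move:
  assumes "fdelta c \<in> U" "fermi p" "\<not> fermi K" "fst p \<in> idxs m n" "fst K \<in> idxs m n"
    and "occ_shift s p x = c p" "occ_coeff s p x \<noteq> 0" "occ_shift (\<not> s) K y = c K" "occ_coeff (\<not> s) K y \<noteq> 0"
  shows "fdelta (c(p := x, K := y)) \<in> U"
proof -
  have pK: "p \<noteq> K" using assms by auto
  obtain z where z: "z \<noteq> 0" "psi (\<not> s) K (fdelta c) = fscale z (fdelta (c(K := y)))"
    using psi_fdelta[where c = c, OF assms(8,9)] .
  obtain z' where z': "z' \<noteq> 0" "psi s p (fdelta (c(K := y))) = fscale z' (fdelta (c(K := y, p := x)))"
    using psi_fdelta[of s p x "c(K := y)"] assms(6,7) pK by auto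
  have "psi s p (psi (\<not> s) K (fdelta c)) = fscale (z * z') (fdelta (c(K := y, p := x)))"
    unfolding z(2) psi_fscale z'(2) by simp
  then have "fscale (z * z') (fdelta (c(K := y, p := x))) \<in> U"
    using single_pair_mem[OF assms(1-5), of s] by (simp only:)
  then have "fscale (inverse (z * z')) (fscale (z * z') (fdelta (c(K := y, p := x)))) \<in> U"
    by (rule fock.subspace_scale[OF sub])
  moreover have "c(K := y, p := x) = c(p := x, K := y)" using pK by (rule fun_upd_twist[symmetric])
  moreover have "inverse (z * z') * (z * z') = 1" using z(1) z'(1) by (intro left_inverse) simp
  ultimately show ?thesis by (simp only: fscale_simps)
qed

text \<open>The matrix element of a mode operator is nonzero exactly when the opposite operator has
  a nonzero element back, so a move can be undone.\<close>

lemma move_iff: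
  assumes "fermi p" "\<not> fermi K" "fst p \<in> idxs m n" "fst K \<in> idxs m n"
    and "occ_shift s p x = c p" "occ_coeff s p x \<noteq> 0" "occ_shift (\<not> s) K y = c K" "occ_coeff (\<not> s) K y \<noteq> 0"
  shows "fdelta c \<in> U \<longleftrightarrow> fdelta (c(p := x, K := y)) \<in> U"
proof
  assume "fdelta c \<in> U"
  then show "fdelta (c(p := x, K := y)) \<in> U" by (rule move[OF _ assms])
next
  assume *: "fdelta (c(p := x, K := y)) \<in> U"
  have pK: "p \<noteq> K" using assms by auto
  have "fdelta (c(p := x, K := y, p := c p, K := c K)) \<in> U"
  proof (rule move[OF * assms(1-4), of "\<not> s"])
    show "occ_shift (\<not> s) p (c p) = (c(p := x, K := y)) p" "occ_coeff (\<not> s) p (c p) \<noteq> 0"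
      using occ_shift_occ_shift[OF assms(6)] occ_coeff_rev[OF assms(6)] assms(5) pK by auto
    show "occ_shift (\<not> \<not> s) K (c K) = (c(p := x, K := y)) K" "occ_coeff (\<not> \<not> s) K (c K) \<noteq> 0"
      using occ_shift_occ_shift[OF assms(8)] occ_coeff_rev[OF assms(8)] assms(7) by auto
  qed
  moreover have "c(p := x, K := y, p := c p, K := c K) = c" by auto
  ultimately show "fdelta c \<in> U" by simp
qed

text \<open>Another configuration in the support differs from \<open>c\<close> in some mode
  \<open>q\<close>. Completing \<open>q\<close> by a mode of index 1 of the other kind to a
  fermion-boson pair gives a \<open>zsep\<close> that separates the two; restricting to its level
  set shrinks the support and keeps \<open>c\<close>.\<close>

lemma fdelta_mem:
  assumes "m \<ge> 1" "n \<ge> 1"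
  shows "f \<in> U \<Longrightarrow> f c \<noteq> 0 \<Longrightarrow> fdelta c \<in> U"
proof (induction "card {c. f c \<noteq> 0}" arbitrary: f rule: less_induct)
  case less
  have f: "finite {c. f c \<noteq> 0}" "{c. f c \<noteq> 0} \<subseteq> cfgs m n"
    using less.prems(1) fin by (auto simp: fin_on_def)
  show ?case
  proof (cases "{c. f c \<noteq> 0} = {c}")
    case True
    then have "f c' = 0" if "c' \<noteq> c" for c' using that by blast
    then have "fdelta c = fscale (inverse (f c)) f"
      using less.prems(2) unfolding fdelta_def fscale_def by (intro ext) auto
    then show ?thesis using fock.subspace_scale[OF sub less.prems(1), of "inverse (f c)"] by (simp only:)
  next
    case False
    then obtain c' where c': "f c' \<noteq> 0" "c' \<noteq> c" using less.prems(2) by blast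
    then obtain q where q: "c' q \<noteq> c q" by (auto simp: fun_eq_iff)
    have C: "c \<in> cfgs m n" "c' \<in> cfgs m n" using f(2) less.prems(2) c'(1) by blast+
    then have q_idx: "fst q \<in> idxs m n"
      using q cfgs_idx[OF C(1), of q] cfgs_idx[OF C(2), of q] by (cases "c q = 0") auto
    have "Ev 1 \<in> idxs m n" "Od 1 \<in> idxs m n" using assms by (auto simp: idxs_def)
    then obtain p K where pK: "fermi p" "\<not> fermi K" "fst p \<in> idxs m n" "fst K \<in> idxs m n" "q = p \<or> q = K"
      using q_idx by (cases "fermi q") (metis fst_conv parity.simps(2) zero_neq_one, metis fst_conv parity.simps(1))
    have "zsep p K c' \<noteq> zsep p K c"
      using zsep_inj[where c = c' and c' = c, OF pK(1,2) cfgs_fermi[OF C(2) pK(1)] cfgs_fermi[OF C(1) pK(1)]] q pK(5)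
      by auto
    then have sub': "{d. fres {d. zsep p K d = zsep p K c} f d \<noteq> 0} \<subset> {d. f d \<noteq> 0}"
      using c' by (auto simp: fres_def)
    show ?thesis
    proof (rule less.hyps)
      show "card {d. fres {d. zsep p K d = zsep p K c} f d \<noteq> 0} < card {d. f d \<noteq> 0}"
        by (rule psubset_card_mono[OF f(1) sub'])
      show "fres {d. zsep p K d = zsep p K c} f \<in> U"
        by (rule fres_U[OF zsep_mem[OF _ pK(1-4)] less.prems(1)])
      show "fres {d. zsep p K d = zsep p K c} f c \<noteq> 0"
        using less.prems(2) by (simp add: fres_def)
    qed
  qed
qed

end

text \<open>A purely bosonic reference point of charge \<open>l\<close>, in general different from
  the highest weight configuration \<open>top_cfg\<close>.\<close>

definition ground :: "int \<Rightarrow> cfg" where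
  "ground l = (\<lambda>p. if p = (Od 1, -1) then nat l else if p = (Od 1, 0) then nat (- l) else 0)"

text \<open>Weights chosen so that both reductions strictly decrease the sum: moving a particle into
  one of the two reference modes, and cancelling two opposite particles there.\<close>

definition excess :: "mode \<Rightarrow> int" where
  "excess p = (if p = (Od 1, -1) \<or> p = (Od 1, 0) then 1 else 2)"

lemma cfgs_upd:
  assumes "c \<in> cfgs m n" "fst p \<in> idxs m n" "fermi p \<Longrightarrow> x \<le> 1"
  shows "c(p := x) \<in> cfgs m n"
proof -
  have "finite {q. (c(p := x)) q \<noteq> 0}" using assms(1) unfolding finite_upd cfgs_def by blast
  then show ?thesis using assms by (auto simp: cfgs_def simp del: fun_upd_apply) (auto split: if_splits)
qed

lemma cfgs_finite: "c \<in> cfgs m n \<Longrightarrow> finite {p. c p \<noteq> 0}"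
  by (simp add: cfgs_def)

lemma lsum_upd2:
  assumes "finite {p. c p \<noteq> 0}" "p \<noteq> q"
  shows "lsum g (c(p := x, q := y)) = lsum g c + (of_nat x - of_nat (c p)) * g p + (of_nat y - of_nat (c q)) * g q"
proof -
  have "finite {r. (c(p := x)) r \<noteq> 0}" unfolding finite_upd by (rule assms(1))
  then show ?thesis using assms by (simp add: lsum_upd)
qed

lemma excess_nonneg: "0 \<le> lsum excess c"
  unfolding lsum_def by (rule sum_nonneg) (simp add: excess_def)

context fock_stable
begin

text \<open>Three reductions end at \<open>ground l\<close>: a fermion is turned into a boson of
  equal charge in a reference mode; a boson elsewhere is carried there through an auxiliary fermion
  mode, empty by then; bosons in the two reference modes cancel in pairs, again through a fermion
  mode.\<close>

lemma connected:
  assumes "m \<ge> 1" "n \<ge> 1"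
  shows "c \<in> cfgs_ch m n l \<Longrightarrow> fdelta c \<in> U \<longleftrightarrow> fdelta (ground l) \<in> U"
proof (induction "nat (lsum excess c)" arbitrary: c rule: less_induct)
  case less
  have c: "c \<in> cfgs m n" "lsum mode_sign c = l" using less.prems by (auto simp: cfgs_ch_def)
  note finc = cfgs_finite[OF c(1)]
  have ev: "Ev 1 \<in> idxs m n" and od: "Od 1 \<in> idxs m n" using assms by (auto simp: idxs_def)
  let ?P = "(Od 1, -1) :: mode" and ?M = "(Od 1, 0) :: mode"
  have step: ?case if "c' \<in> cfgs m n" "lsum mode_sign c' = l" "lsum excess c' < lsum excess c"
    "fdelta c \<in> U \<longleftrightarrow> fdelta c' \<in> U" for c'
    using less.hyps[of c'] that excess_nonneg[of c] excess_nonneg[of c'] by (auto simp: cfgs_ch_def)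
  show ?case
  proof (cases "\<exists>p. fermi p \<and> c p \<noteq> 0")
    case True
    then obtain p where p: "fermi p" "c p \<noteq> 0" by blast
    then have p1: "c p = 1" using cfgs_fermi[OF c(1) p(1)] by simp
    define K where "K = (if snd p < 0 then ?P else ?M)"
    have K: "\<not> fermi K" "fst K \<in> idxs m n" "snd K < 0 \<longleftrightarrow> snd p < 0" "K \<noteq> p" "excess K = 1" "excess p = 2"
      using od p by (auto simp: K_def excess_def)
    let ?c = "c(p := 0, K := c K + 1)"
    show ?thesis
    proof (rule step)
      show "?c \<in> cfgs m n"
        using K(1,2) cfgs_idx[OF c(1) p(2)] by (intro cfgs_upd c(1)) auto
      show "lsum mode_sign ?c = l"
        using c(2) K(3,4) p1 by (subst lsum_upd2[OF finc]) (auto simp: mode_sign_def)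
      show "lsum excess ?c < lsum excess c"
        using K p1 by (subst lsum_upd2[OF finc]) auto
      show "fdelta c \<in> U \<longleftrightarrow> fdelta ?c \<in> U"
        \<comment> \<open>This \<open>s\<close> empties \<open>p\<close>; as \<open>K\<close> lies
          on the same side of 0, the opposite operator fills it.\<close>
        by (rule move_iff[OF p(1) K(1) cfgs_idx[OF c(1) p(2)] K(2), of "\<not> snd p < 0"])
          (use p1 K(1,3) p(1) in \<open>auto simp: occ_shift_def occ_coeff_def creates_def simp flip: of_nat_Suc\<close>)
    qed
  next
    case False
    then have nof: "c p = 0" if "fermi p" for p using that by blast
    show ?thesis
    proof (cases "\<exists>K. K \<noteq> ?P \<and> K \<noteq> ?M \<and> c K \<noteq> 0")
      case True
      then obtain K where K: "K \<noteq> ?P" "K \<noteq> ?M" "c K \<noteq> 0" by blast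
      have Kb: "\<not> fermi K"
      proof
        assume "fermi K"
        from nof[OF this] K(3) show False by contradiction
      qed
      have KI: "fst K \<in> idxs m n" by (rule cfgs_idx[OF c(1) K(3)])
      define K' where "K' = (if snd K < 0 then ?P else ?M)"
      have K': "\<not> fermi K'" "fst K' \<in> idxs m n" "snd K' < 0 \<longleftrightarrow> snd K < 0" "K \<noteq> K'" "excess K' = 1" "excess K = 2"
        using od K by (auto simp: K'_def excess_def)
      define p where "p = (Ev 1, if snd K < 0 then -1 else 0 :: int)"
      have p: "fermi p" "fst p \<in> idxs m n" "snd p < 0 \<longleftrightarrow> snd K < 0" "p \<noteq> K" "p \<noteq> K'"
        using ev Kb K'(1) by (auto simp: p_def)
      let ?c1 = "c(p := 1, K := c K - 1)"
      let ?c = "c(K := c K - 1, K' := c K' + 1)"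
      have eq: "?c1(p := 0, K' := ?c1 K' + 1) = ?c"
        using p(4,5) K'(4) nof[OF p(1)] by (auto simp: fun_eq_iff)
      show ?thesis
      proof (rule step)
        show "?c \<in> cfgs m n"
          using K' Kb KI by (intro cfgs_upd c(1)) auto
        show "lsum mode_sign ?c = l"
          using c(2) K'(3,4) K(3) by (subst lsum_upd2[OF finc]) (auto simp: mode_sign_def of_nat_diff)
        show "lsum excess ?c < lsum excess c"
          using K' K(3) by (subst lsum_upd2[OF finc]) (auto simp: of_nat_diff)
        have "fdelta c \<in> U \<longleftrightarrow> fdelta ?c1 \<in> U"
          by (rule move_iff[OF p(1) Kb p(2) KI, of "snd p < 0"])
            (use nof[OF p(1)] K(3) Kb p(1,3) in \<open>auto simp: occ_shift_def occ_coeff_def creates_def simp flip: of_nat_Suc\<close>)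
        also have "\<dots> \<longleftrightarrow> fdelta (?c1(p := 0, K' := ?c1 K' + 1)) \<in> U"
          by (rule move_iff[OF p(1) K'(1) p(2) K'(2), of "\<not> snd p < 0"])
            (use K'(1,3) p(1,3,4) in \<open>auto simp: occ_shift_def occ_coeff_def creates_def simp flip: of_nat_Suc\<close>)
        finally show "fdelta c \<in> U \<longleftrightarrow> fdelta ?c \<in> U" unfolding eq .
      qed
    next
      case False
      then have only: "c q = 0" if "q \<noteq> ?P" "q \<noteq> ?M" for q using that by blast
      have PM: "?P \<noteq> ?M" by simp
      show ?thesis
      proof (cases "c ?P \<noteq> 0 \<and> c ?M \<noteq> 0")
        case True
        define p :: mode where "p = (Ev 1, -1)"
        have p: "fermi p" "fst p \<in> idxs m n" "snd p < 0" "p \<noteq> ?P" "p \<noteq> ?M" "c p = 0"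
          using ev nof by (auto simp: p_def)
        let ?c1 = "c(p := 1, ?P := c ?P - 1)"
        let ?c = "c(?P := c ?P - 1, ?M := c ?M - 1)"
        have eq: "?c1(p := 0, ?M := ?c1 ?M - 1) = ?c"
          using p by (auto simp: fun_eq_iff)
        have b: "\<not> fermi ?P" "\<not> fermi ?M" "fst ?P \<in> idxs m n" "fst ?M \<in> idxs m n" using od by auto
        show ?thesis
        proof (rule step)
          show "?c \<in> cfgs m n"
            using b by (intro cfgs_upd c(1)) auto
          show "lsum mode_sign ?c = l"
            using c(2) True by (subst lsum_upd2[OF finc PM]) (auto simp: mode_sign_def of_nat_diff)
          show "lsum excess ?c < lsum excess c"
            using True by (subst lsum_upd2[OF finc PM]) (auto simp: excess_def of_nat_diff)
          \<comment> \<open>The auxiliary fermion is filled while a particle leaves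
            \<open>?P\<close> and emptied while one leaves \<open>?M\<close>, so the net effect is a
            cancellation.\<close>
          have "fdelta c \<in> U \<longleftrightarrow> fdelta ?c1 \<in> U"
            by (rule move_iff[OF p(1) b(1) p(2) b(3), of True])
              (use p True in \<open>auto simp: occ_shift_def occ_coeff_def creates_def simp flip: of_nat_Suc\<close>)
          also have "\<dots> \<longleftrightarrow> fdelta (?c1(p := 0, ?M := ?c1 ?M - 1)) \<in> U"
            by (rule move_iff[OF p(1) b(2) p(2) b(4), of False])
              (use p True in \<open>auto simp: occ_shift_def occ_coeff_def creates_def simp flip: of_nat_Suc\<close>)
          finally show "fdelta c \<in> U \<longleftrightarrow> fdelta ?c \<in> U" unfolding eq .
        qed
      next
        case False
        have ls: "lsum mode_sign c = (\<Sum>p\<in>{?P, ?M}. of_nat (c p) * mode_sign p :: int)"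
        proof (rule lsum_superset)
          show "{p. c p \<noteq> 0} \<subseteq> {?P, ?M}"
          proof (rule subsetI, rule ccontr)
            fix q assume "q \<in> {p. c p \<noteq> 0}" "q \<notin> {?P, ?M}"
            then show False using only[of q] by simp
          qed
        qed simp
        have l: "l = int (c ?P) - int (c ?M)"
          using ls unfolding c(2) by (simp add: mode_sign_def)
        have "c = ground l"
        proof
          fix q
          show "c q = ground l q" using only[of q] False l by (cases "q = ?P"; cases "q = ?M") (auto simp: ground_def)
        qed
        then show ?thesis by simp
      qed
    qed
  qed
qed

end

text \<open>A nonzero vector yields one basis configuration by separation, and connectedness then
  yields all of them.\<close>

theorem fock_irreducible:
  assumes "m \<ge> 1" "n \<ge> 1" "fock.subspace U" "U \<subseteq> fin_on (cfgs_ch m n l)" "U \<noteq> {0}"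
    and "\<And>f a b k. f \<in> U \<Longrightarrow> a \<in> idxs m n \<Longrightarrow> b \<in> idxs m n \<Longrightarrow> current a b k f \<in> U"
  shows "U = fin_on (cfgs_ch m n l)"
proof -
  have sub: "cfgs_ch m n l \<subseteq> cfgs m n" by (auto simp: cfgs_ch_def)
  interpret fock_stable m n U
    using assms fin_on_mono[OF sub] by unfold_locales auto
  have "0 \<in> U" by (rule fock.subspace_0[OF assms(3)])
  then obtain f where f: "f \<in> U" "f \<noteq> 0" using assms(5) by blast
  then obtain c where c: "f c \<noteq> 0" by (auto simp: fun_eq_iff)
  have "{c. f c \<noteq> 0} \<subseteq> cfgs_ch m n l" using f(1) assms(4) unfolding fin_on_def by blast
  with c have "c \<in> cfgs_ch m n l" by blast
  then have ground: "fdelta (ground l) \<in> U"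
    using connected[OF assms(1,2)] fdelta_mem[OF assms(1,2) f(1) c] by blast
  have "g \<in> U" if g: "g \<in> fin_on (cfgs_ch m n l)" for g
  proof (subst fin_on_expand[OF g], intro fock.subspace_sum[OF assms(3)] fock.subspace_scale[OF assms(3)])
    fix d assume "d \<in> {c. g c \<noteq> 0}"
    then have "d \<in> cfgs_ch m n l" using g unfolding fin_on_def by blast
    then show "fdelta d \<in> U" using connected[OF assms(1,2)] ground by blast
  qed
  with assms(4) show ?thesis by blast
qed

section \<open>The highest weight configuration\<close>

definition homog :: "(mode \<Rightarrow> 'a::comm_ring_1) \<Rightarrow> 'a \<Rightarrow> fock \<Rightarrow> bool" where
  "homog g x f \<longleftrightarrow> (\<forall>c. f c \<noteq> 0 \<longrightarrow> lsum g c = x)"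

lemma homog_add: "homog g x f \<Longrightarrow> homog g x f' \<Longrightarrow> homog g x (f + f')"
  unfolding homog_def by (metis add.right_neutral plus_fun_apply)

lemma homog_fscale: "homog g x f \<Longrightarrow> homog g x (fscale z f)"
  by (simp add: homog_def fscale_def)

lemma homog_0: "homog g x 0"
  by (simp add: homog_def)

lemma homog_sum: "(\<And>i. i \<in> I \<Longrightarrow> homog g x (F i)) \<Longrightarrow> homog g x (sum F I)"
proof (induction I rule: infinite_finite_induct)
  case (insert i I)
  then show ?case unfolding sum.insert[OF insert(1,2)] by (intro homog_add) auto
next
  case (infinite A)
  show ?case unfolding sum.infinite[OF infinite(1)] by (rule homog_0)
next
  case empty
  show ?case unfolding sum.empty by (rule homog_0)
qed

lemma homog_psi:
  assumes "f \<in> fin_on (cfgs m n)" "homog g x f" "y = x + op_sign s * mode_sign p * g p"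
  shows "homog g y (psi s p f)"
  unfolding homog_def
proof (intro allI impI)
  fix c assume "psi s p f c \<noteq> 0"
  then have k: "occ_coeff s p (c p) \<noteq> 0" and f: "f (c(p := occ_shift s p (c p))) \<noteq> 0"
    using psi_nonzero by auto
  then have "c(p := occ_shift s p (c p)) \<in> cfgs m n" using assms(1) unfolding fin_on_def by blast
  then have "finite {q. c q \<noteq> 0}" using cfgs_finite finite_upd by metis
  from lsum_pre[OF this k, of g] f assms(2,3) show "lsum g c = y" by (simp add: homog_def)
qed

lemma homog_current:
  assumes f: "f \<in> fin_on (cfgs m n)" "homog g x f" and ab: "a \<in> idxs m n" "b \<in> idxs m n"
    and z: "\<And>i. mode_sign (a, i + k) * g (a, i + k) - mode_sign (b, i) * g (b, i) = z"
  shows "homog g (x + z) (current a b k f)"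
proof -
  obtain N where N: "bnd N f" using fin_on_cfgs_tame[OF f(1)] by (auto simp: tame_vec_def)
  have "homog g (x + z) (current_term a b k i f)" for i
  proof -
    have T: "homog g (x + mode_sign (a, i + k) * g (a, i + k)) (psi True (a, i + k) f)"
      and F: "homog g (x - mode_sign (b, i) * g (b, i)) (psi False (b, i) f)"
      by (rule homog_psi[OF f]; simp add: op_sign_def)+
    have "homog g (x + z) (psi False (b, i) (psi True (a, i + k) f))"
      by (rule homog_psi[OF psi_fin_on[OF f(1)] T]) (simp_all add: ab op_sign_def flip: z[of i])
    moreover have "homog g (x + z) (psi True (a, i + k) (psi False (b, i) f))"
      by (rule homog_psi[OF psi_fin_on[OF f(1)] F]) (simp_all add: ab op_sign_def flip: z[of i])
    ultimately show ?thesis unfolding current_term_def by (simp add: homog_fscale)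
  qed
  then show ?thesis unfolding current_eq[OF N finite_atLeastAtMost_int order.refl, of a b]
    by (intro homog_sum)
qed

lemma fin_on_cfgs_ch: "f \<in> fin_on (cfgs_ch m n l) \<longleftrightarrow> f \<in> fin_on (cfgs m n) \<and> homog mode_sign l f"
  unfolding fin_on_def cfgs_ch_def homog_def by blast

lemma current_fin_on_ch:
  assumes "f \<in> fin_on (cfgs_ch m n l)" "a \<in> idxs m n" "b \<in> idxs m n"
  shows "current a b k f \<in> fin_on (cfgs_ch m n l)"
  using assms current_fin_on[of f m n a b k] homog_current[of f m n mode_sign l a b k 0]
  unfolding fin_on_cfgs_ch by simp

text \<open>Summed over \<open>bit\<close>, this is the parity of the number of bosons, the grading
  of the Fock space.\<close>

definition mode_par :: "mode \<Rightarrow> bit" where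
  "mode_par p = parity (fst p)"

lemma homog_mode_par_current:
  assumes "f \<in> fin_on (cfgs m n)" "homog mode_par x f" "a \<in> idxs m n" "b \<in> idxs m n"
  shows "homog mode_par (x + (parity a + parity b)) (current a b k f)"
  by (rule homog_current[OF assms]) (simp add: mode_par_def mode_sign_def)

text \<open>This is -|i + 1/2|; times \<open>mode_sign\<close> it becomes i + 1/2, which is affine
  in \<open>i\<close>, so a current of degree \<open>k\<close> shifts it by
  \<open>k\<close>.\<close>

definition mode_energy :: "mode \<Rightarrow> complex" where
  "mode_energy p = (if snd p < 0 then of_int (snd p) + 1/2 else - of_int (snd p) - 1/2)"

text \<open>The constant |l|/2 normalises \<open>d\<close> to 0 on the highest weight
  configuration.\<close>

definition Dop :: "int \<Rightarrow> fock \<Rightarrow> fock" where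
  "Dop l f = fdiag (lsum mode_energy) f + fscale (of_int \<bar>l\<bar> / 2) f"

lemma Dop_current:
  assumes "f \<in> fin_on (cfgs m n)" "a \<in> idxs m n" "b \<in> idxs m n"
  shows "Dop l (current a b k f) = current a b k (Dop l f) + fscale (of_int k) (current a b k f)"
proof -
  have tame: "tame_vec f" "tame_vec (fdiag (lsum mode_energy) f)"
    using fin_on_cfgs_tame[OF assms(1)] fin_on_cfgs_tame[OF fin_on_fdiag[OF assms(1)]] .
  have "fdiag (lsum mode_energy) (current a b k f) = current a b k (fdiag (lsum mode_energy) f) + fscale (of_int k) (current a b k f)"
    by (rule fdiag_current[OF assms]) (simp add: mode_energy_def mode_sign_def)
  then show ?thesis
    unfolding Dop_def current_add[OF tame(2) tame_fscale[OF tame(1)]] current_fscale[OF tame(1)]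
    by (simp add: fun_eq_iff)
qed

lemma Dop_add: "Dop l (f + g) = Dop l f + Dop l g"
  by (simp add: Dop_def fdiag_add fscale_add fun_eq_iff)

lemma Dop_fscale: "Dop l (fscale z f) = fscale z (Dop l f)"
  by (simp add: Dop_def fdiag_fscale fscale_add mult.commute)

lemma fdiag_fdelta: "fdiag h (fdelta c) = fscale (h c) (fdelta c)"
  unfolding fdiag_def fscale_def fdelta_def by (intro ext) auto

text \<open>Positive charge fills the fermions at -1 in the order of their indices and puts the
  remainder into the boson \<open>Od 1\<close>; negative charge goes into the last boson at 0. These
  are the three cases of \<open>Lambda_tilde\<close>.\<close>

fun top_cfg :: "nat \<Rightarrow> nat \<Rightarrow> int \<Rightarrow> cfg" where
  "top_cfg m n l (Ev j, i) = (if i = -1 \<and> 1 \<le> j \<and> j \<le> m \<and> int j \<le> l then 1 else 0)"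
| "top_cfg m n l (Od j, i) = (if i = -1 \<and> j = 1 then nat (l - int m) else if i = 0 \<and> j = n then nat (- l) else 0)"

context
  fixes m n :: nat and l :: int
  assumes mn: "m \<ge> 1" "n \<ge> 1"
begin

lemma top_cfg_support:
  "{p. top_cfg m n l p \<noteq> 0} \<subseteq> (\<lambda>j. (Ev j, -1)) ` {1..m} \<union> {(Od 1, -1), (Od n, 0)}"
proof
  fix p assume "p \<in> {p. top_cfg m n l p \<noteq> 0}"
  then show "p \<in> (\<lambda>j. (Ev j, -1)) ` {1..m} \<union> {(Od 1, -1), (Od n, 0)}"
    by (cases p; cases "fst p") (auto split: if_splits)
qed

lemma top_cfg_cfgs: "top_cfg m n l \<in> cfgs m n"
proof -
  have "fst p \<in> idxs m n \<and> (fermi p \<longrightarrow> top_cfg m n l p \<le> 1)" if "top_cfg m n l p \<noteq> 0" for p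
    using that mn by (cases p; cases "fst p") (auto simp: idxs_def split: if_splits)
  moreover have "finite {p. top_cfg m n l p \<noteq> 0}"
    by (rule finite_subset[OF top_cfg_support]) simp
  ultimately show ?thesis unfolding cfgs_def by blast
qed

lemma lsum_top_cfg: "lsum g (top_cfg m n l) =
  (\<Sum>j\<in>{1..m}. (if int j \<le> l then 1 else 0) * g (Ev j, -1))
   + of_nat (nat (l - int m)) * g (Od 1, -1) + of_nat (nat (- l)) * g (Od n, 0)"
proof -
  let ?A = "(\<lambda>j. (Ev j, -1)) ` {1..m} :: mode set"
  have "lsum g (top_cfg m n l) = (\<Sum>p\<in>?A \<union> {(Od 1, -1), (Od n, 0)}. of_nat (top_cfg m n l p) * g p)"
    by (rule lsum_superset[OF _ top_cfg_support]) simp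
  also have "\<dots> = (\<Sum>p\<in>?A. of_nat (top_cfg m n l p) * g p)
      + (\<Sum>p\<in>{(Od 1, -1), (Od n, 0)}. of_nat (top_cfg m n l p) * g p)"
    by (rule sum.union_disjoint) auto
  also have "(\<Sum>p\<in>?A. of_nat (top_cfg m n l p) * g p) =
      (\<Sum>j\<in>{1..m}. (if int j \<le> l then 1 else 0) * g (Ev j, -1))"
    by (subst sum.reindex) (auto simp: inj_on_def intro!: sum.cong)
  finally show ?thesis by (simp add: add.assoc)
qed

lemma sum_le_count: "(\<Sum>j\<in>{1..m}. if int j \<le> l then 1 else 0 :: 'a::comm_ring_1) = of_nat (min (nat l) m)"
proof -
  have "(\<Sum>j\<in>{1..m}. if int j \<le> l then 1 else 0 :: 'a) = (\<Sum>j\<in>{1..min (nat l) m}. 1)"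
    by (rule sum.mono_neutral_cong_right) auto
  then show ?thesis by simp
qed

lemma top_cfg_ch: "top_cfg m n l \<in> cfgs_ch m n l"
proof -
  have "lsum mode_sign (top_cfg m n l) = int (min (nat l) m) + int (nat (l - int m)) - int (nat (- l))"
    using sum_le_count[where 'a = int] by (simp add: lsum_top_cfg mode_sign_def)
  also have "\<dots> = l" by auto
  finally show ?thesis using top_cfg_cfgs by (simp add: cfgs_ch_def)
qed

text \<open>All |l| particles of \<open>top_cfg\<close> have \<open>mode_energy\<close>
  -1/2.\<close>

lemma Dop_top_cfg: "Dop l (fdelta (top_cfg m n l)) = 0"
proof -
  have "lsum mode_energy (top_cfg m n l) =
      - of_nat (min (nat l) m) / 2 - of_nat (nat (l - int m)) / 2 - of_nat (nat (- l)) / 2"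
  proof -
    have "(\<Sum>j\<in>{1..m}. (if int j \<le> l then 1 else 0) * mode_energy (Ev j, -1)) =
        (\<Sum>j\<in>{1..m}. if int j \<le> l then 1 else 0) * (- 1 / 2)"
      unfolding sum_distrib_right by (simp add: mode_energy_def)
    then show ?thesis unfolding lsum_top_cfg sum_le_count by (simp add: mode_energy_def)
  qed
  also have "\<dots> = - of_int (int (min (nat l) m) + int (nat (l - int m)) + int (nat (- l))) / 2"
    by (simp add: field_simps)
  also have "int (min (nat l) m) + int (nat (l - int m)) + int (nat (- l)) = \<bar>l\<bar>"
    by auto
  finally show ?thesis unfolding Dop_def fdiag_fdelta by (simp add: fscale_minus)
qed

lemma psi_fdelta_0:
  assumes "\<not> creates s p \<and> c p = 0 \<or> creates s p \<and> fermi p \<and> odd (c p)"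
  shows "psi s p (fdelta c) = 0"
proof
  fix c'
  show "psi s p (fdelta c) c' = 0 c'"
  proof (rule ccontr)
    assume "psi s p (fdelta c) c' \<noteq> 0 c'"
    then have k: "occ_coeff s p (c' p) \<noteq> 0" and d: "c'(p := occ_shift s p (c' p)) = c"
      using psi_nonzero[of s p "fdelta c" c'] by (auto simp: fdelta_def split: if_splits)
    have "(c'(p := occ_shift s p (c' p))) p = c p" unfolding d ..
    then have "occ_shift s p (c' p) = c p" by simp
    then show False using assms k by (cases "c' p") (auto simp: occ_shift_def occ_coeff_def split: if_splits)
  qed
qed

text \<open>In every term one factor kills the vector: it annihilates an empty mode or, in degree 0,
  creates in a fermion mode already filled because its index precedes that of the particle
  removed.\<close>

lemma current_top_cfg:
  assumes ab: "a \<in> idxs m n" "b \<in> idxs m n" and k: "k > 0 \<or> k = 0 \<and> idx_less a b"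
  shows "current a b k (fdelta (top_cfg m n l)) = 0"
proof -
  let ?c = "top_cfg m n l"
  have neq: "(a, i + k) \<noteq> (b, i)" for i
    using k by (cases a; cases b) auto
  have comm: "psi True (a, i + k) (psi False (b, i) f) =
      fscale (exchange_sign a b) (psi False (b, i) (psi True (a, i + k) f))" for i f
    using psi_psi[of "(a, i + k)" "(b, i)" True False f] neq by simp
  have "current_term a b k i (fdelta ?c) = 0" for i
  proof (cases "psi True (a, i + k) (fdelta ?c) = 0 \<or> psi False (b, i) (fdelta ?c) = 0")
    case True
    then show ?thesis using comm[of i "fdelta ?c"] by (auto simp: current_term_def)
  next
    case False
    \<comment> \<open>Otherwise \<open>psi True\<close> would have to empty a mode with nonnegative
      number; only \<open>Od n\<close> at 0 can be occupied, and no index lies above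
      \<open>Od n\<close>.\<close>
    have "i < 0"
    proof (rule ccontr)
      assume "\<not> i < 0"
      then have "?c (a, i + k) \<noteq> 0"
        using False psi_fdelta_0[of True "(a, i + k)" ?c] k by (auto simp: creates_def)
      then have "a = Od n" "k = 0" using \<open>\<not> i < 0\<close> k by (cases a; auto split: if_splits)+
      then show False using k ab by (auto simp: idxs_def)
    qed
    then have "?c (b, i) \<noteq> 0"
      using False psi_fdelta_0[of False "(b, i)" ?c] by (auto simp: creates_def)
    then have i: "i = -1" and l: "l > 0"
      and b: "(\<exists>j. b = Ev j \<and> int j \<le> l) \<or> b = Od 1 \<and> l > int m"
      using \<open>i < 0\<close> by (cases b; auto split: if_splits)+
    show ?thesis
    proof (cases "k = 0")
      case True
      with k have less: "idx_less a b" by simp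
      then obtain j where "a = Ev j" "1 \<le> j" "j \<le> m" "int j \<le> l"
        using b ab by (cases a) (auto simp: idxs_def)
      then have "?c (a, i + k) = 1" using i True by simp
      then show ?thesis using False psi_fdelta_0[of True "(a, i + k)" ?c] i True \<open>a = Ev j\<close>
        by (auto simp: creates_def)
    next
      case k': False
      then have "0 \<le> i + k" using k i by auto
      then have "?c (a, i + k) = 0" using l by (cases a) auto
      then show ?thesis using False psi_fdelta_0[of True "(a, i + k)" ?c] \<open>0 \<le> i + k\<close>
        by (auto simp: creates_def)
    qed
  qed
  then show ?thesis by (simp add: current_def)
qed

lemma current_diag_top_cfg: "current a a 0 (fdelta (top_cfg m n l)) =
    fscale (of_nat (top_cfg m n l (a, -1)) - of_nat (top_cfg m n l (a, 0))) (fdelta (top_cfg m n l))"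
proof -
  have snd: "\<bar>snd p\<bar> \<le> 1" if "top_cfg m n l p \<noteq> 0" for p
    using top_cfg_support that by auto
  have "top_cfg m n l (a, 1) = 0" by (cases a) auto
  moreover have "{-1..1} = {-1, 0, 1 :: int}" by auto
  ultimately have "lsum (\<lambda>p. if fst p = a then mode_sign p else 0 :: complex) (top_cfg m n l) =
      of_nat (top_cfg m n l (a, -1)) - of_nat (top_cfg m n l (a, 0))"
    using lsum_window[OF top_cfg_cfgs snd, where a = a and g = "\<lambda>p. if fst p = a then mode_sign p else 0"]
    by (simp add: mode_sign_def)
  then show ?thesis
    unfolding current_diag[OF fdelta_fin_on[OF top_cfg_cfgs]] fdiag_fdelta by simp
qed

end

section \<open>Root vectors of the affine superalgebra\<close>

definition munit :: "idx \<Rightarrow> idx \<Rightarrow> smat" where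
  "munit a b = (\<lambda>x y. if x = a \<and> y = b then 1 else 0)"

definition rootv :: "idx \<Rightarrow> idx \<Rightarrow> int \<Rightarrow> glhat" where
  "rootv a b k = loop (munit a b) k"

lemma finite_idxs [simp]: "finite (idxs m n)"
  by (simp add: idxs_def)

lemma rootv_glhat [simp]: "a \<in> idxs m n \<Longrightarrow> b \<in> idxs m n \<Longrightarrow> rootv a b k \<in> glhat m n"
proof -
  assume "a \<in> idxs m n" "b \<in> idxs m n"
  then have "(if r = k then munit a b else 0) \<in> gl m n" for r
    by (auto simp: gl_def munit_def)
  moreover have "finite {r. (if r = k then munit a b else 0) \<noteq> 0}"
    by (rule finite_subset[of _ "{k}"]) auto
  ultimately show ?thesis by (simp add: rootv_def loop_def glhat_def)
qed

lemma smat_part_munit: "smat_part (parity a + parity b) (munit a b) = munit a b"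
  by (auto simp: smat_part_def munit_def fun_eq_iff)

lemma glhat_part_glhat: "x \<in> glhat_part m n p \<Longrightarrow> x \<in> glhat m n"
  by (cases x) (simp add: glhat_part_def)

lemma rootv_part: "a \<in> idxs m n \<Longrightarrow> b \<in> idxs m n \<Longrightarrow> rootv a b k \<in> glhat_part m n (parity a + parity b)"
  using rootv_glhat[of a m n b k] smat_part_munit[of a b]
  by (auto simp: glhat_part_def rootv_def loop_def)

lemma smat_mult_munit:
  assumes "b \<in> idxs m n"
  shows "smat_mult m n (munit a b) (munit c d) = (if b = c then munit a d else 0)"
proof (intro ext)
  fix x y
  have "smat_mult m n (munit a b) (munit c d) x y =
      (\<Sum>z\<in>idxs m n. if z = b then (if x = a \<and> b = c \<and> y = d then 1 else 0) else 0)"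
    unfolding smat_mult_def by (rule sum.cong) (auto simp: munit_def)
  also have "\<dots> = (if b = c then munit a d else 0) x y"
    using assms by (simp add: munit_def)
  finally show "smat_mult m n (munit a b) (munit c d) x y = (if b = c then munit a d else 0) x y" .
qed

lemma Str_munit:
  assumes "a \<in> idxs m n"
  shows "Str m n (munit a d) = (if a = d then esgn a else 0)"
proof (cases a)
  case (Ev i)
  then have i: "i \<in> {1..m}" using assms by (auto simp: idxs_def)
  have "(\<Sum>j = 1..m. munit a d (Ev j) (Ev j)) = (\<Sum>j = 1..m. if j = i then (if a = d then 1 else 0) else 0)"
    using Ev by (intro sum.cong) (auto simp: munit_def)
  moreover have "(\<Sum>j = 1..n. munit a d (Od j) (Od j)) = 0"
    by (rule sum.neutral) (simp add: munit_def Ev)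
  ultimately show ?thesis using Ev i by (auto simp: Str_def esgn_def)
next
  case (Od i)
  then have i: "i \<in> {1..n}" using assms by (auto simp: idxs_def)
  have "(\<Sum>j = 1..n. munit a d (Od j) (Od j)) = (\<Sum>j = 1..n. if j = i then (if a = d then 1 else 0) else 0)"
    using Od by (intro sum.cong) (auto simp: munit_def)
  moreover have "(\<Sum>j = 1..m. munit a d (Ev j) (Ev j)) = 0"
    by (rule sum.neutral) (simp add: munit_def Od)
  ultimately show ?thesis using Od i by (auto simp: Str_def esgn_def)
qed

lemma glhat_zero: "(0 :: glhat) = (\<lambda>k. 0, 0, 0)"
  by (simp add: zero_prod_def zero_fun_def)

lemma loop_0: "loop 0 k = 0"
  by (simp add: loop_def glhat_zero)

lemma loop_diff: "loop (\<lambda>x y. A x y - s * B x y) k = loop A k + glhat_scale (- s) (loop B k)"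
proof -
  have "(if r = k then \<lambda>x y. A x y - s * B x y else 0) =
      (if r = k then A else 0) + (\<lambda>x y. - s * (if r = k then B else 0) x y)" for r
    by (simp add: fun_eq_iff)
  then show ?thesis by (simp add: loop_def glhat_scale_def plus_fun_def)
qed

lemma bracket_root:
  assumes "a \<in> idxs m n" "b \<in> idxs m n" "c \<in> idxs m n" "d \<in> idxs m n"
  shows "glhat_bracket m n (rootv a b k) (rootv c d k') =
    (if b = c then rootv a d (k + k') else 0)
    + glhat_scale (- super_sign (parity a + parity b) (parity c + parity d)) (if a = d then rootv c b (k + k') else 0)
    + glhat_scale (if b = c \<and> a = d \<and> k + k' = 0 then of_int k * esgn a else 0) C_elt"
proof -
  have br: "gl_bracket m n (munit a b) (munit c d) =
    (\<lambda>x y. (if b = c then munit a d else 0) x y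
      - super_sign (parity a + parity b) (parity c + parity d) * (if a = d then munit c b else 0) x y)"
    using gl_bracket_homogeneous[OF smat_part_munit smat_part_munit, of m n a b c d]
      smat_mult_munit[OF assms(2), of a c d] smat_mult_munit[OF assms(4), of c a b]
    by (simp add: fun_eq_iff)
  have l1: "loop (if b = c then munit a d else 0) (k + k') = (if b = c then rootv a d (k + k') else 0)"
    and l2: "loop (if a = d then munit c b else 0) (k + k') = (if a = d then rootv c b (k + k') else 0)"
    by (simp_all add: rootv_def loop_0)
  have co: "(if k + k' = 0 then of_int k * Str m n (if b = c then munit a d else 0) else 0) =
      (if b = c \<and> a = d \<and> k + k' = 0 then of_int k * esgn a else 0)"
    by (auto simp: Str_munit[OF assms(1)] Str_munit[OF assms(4)])
  show ?thesis
    unfolding rootv_def[of a b] rootv_def[of c d] loop_bracket_loop smat_mult_munit[OF assms(2)]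
      br loop_diff l1 l2 co ..
qed

text \<open>A mode operator of index \<open>a\<close> has statistics 1 + \<open>parity a\<close>,
  and the extra ones cancel in a product of two. So the bilinears obey the sign rule of the
  superalgebra although fermions carry the even indices.\<close>

lemma super_sign_exchange_sign:
  "super_sign (parity a + parity b) (parity c + parity d) = exchange_sign a c * exchange_sign b c * exchange_sign a d * exchange_sign b d"
  by (cases "parity a"; cases "parity b"; cases "parity c"; cases "parity d")
    (simp_all add: super_sign_def exchange_sign_def)

fun rk :: "nat \<Rightarrow> idx \<Rightarrow> int" where
  "rk m (Ev i) = int i"
| "rk m (Od j) = int m + int j"

lemma rk_less: "a \<in> idxs m n \<Longrightarrow> b \<in> idxs m n \<Longrightarrow> idx_less a b \<Longrightarrow> rk m a < rk m b"
  by (auto simp: idxs_def)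

lemma rk_bound: "a \<in> idxs m n \<Longrightarrow> 1 \<le> rk m a \<and> rk m a \<le> int (m + n)"
  by (auto simp: idxs_def)

lemma idx_less_cases: "idx_less a b \<or> a = b \<or> idx_less b a"
  by (cases a; cases b) auto

text \<open>A Cartan element defining the principal gradation.\<close>

definition hgt :: "nat \<Rightarrow> nat \<Rightarrow> glhat" where
  "hgt m n = (\<lambda>k. if k = 0 then (\<lambda>a b. if a = b \<and> a \<in> idxs m n then - of_int (rk m a) else 0) else 0,
     0, of_nat (m + n + 1))"

lemma hgt_part: "hgt m n \<in> glhat_part m n 0"
  by (auto simp: hgt_def glhat_part_def glhat_def gl_def smat_part_def fun_eq_iff)

lemma hgt_glhat: "hgt m n \<in> glhat m n"
  by (rule glhat_part_glhat[OF hgt_part])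

lemma hgt_borel: "hgt m n \<in> borel m n"
proof -
  have "\<not> idx_less b b" for b by (cases b) auto
  then show ?thesis using hgt_glhat by (auto simp: borel_def hgt_def)
qed

definition hdrop :: "nat \<Rightarrow> nat \<Rightarrow> idx \<Rightarrow> idx \<Rightarrow> int \<Rightarrow> int" where
  "hdrop m n a b k = int (m + n + 1) * k - rk m a + rk m b"

text \<open>Ranks lie between 1 and m + n, so their differences stay below the factor m + n + 1 and
  the loop degree decides the sign; in degree 0 the order of the indices does.\<close>

lemma hdrop_neg:
  assumes "a \<in> idxs m n" "b \<in> idxs m n" "k < 0 \<or> k = 0 \<and> idx_less b a"
  shows "hdrop m n a b k < 0"
proof (cases "k < 0")
  case True
  then have "int (m + n + 1) * k \<le> int (m + n + 1) * (-1)" by (intro mult_left_mono) auto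
  then show ?thesis using rk_bound[OF assms(1)] rk_bound[OF assms(2)] by (simp add: hdrop_def)
next
  case False
  then show ?thesis using rk_less[OF assms(2,1)] assms(3) by (simp add: hdrop_def)
qed

lemma bracket_hgt:
  assumes "a \<in> idxs m n" "b \<in> idxs m n"
  shows "glhat_bracket m n (hgt m n) (rootv a b k) = glhat_scale (of_int (hdrop m n a b k)) (rootv a b k)"
proof -
  let ?D = "\<lambda>a b. if a = b \<and> a \<in> idxs m n then - of_int (rk m a) else 0 :: complex"
  have part: "smat_part 0 ?D = ?D" by (auto simp: smat_part_def fun_eq_iff)
  have m1: "smat_mult m n ?D (munit a b) x y = - of_int (rk m a) * munit a b x y" for x y
  proof -
    have "smat_mult m n ?D (munit a b) x y =
       (\<Sum>z\<in>idxs m n. if z = a then - of_int (rk m a) * munit a b x y else 0)"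
      unfolding smat_mult_def by (rule sum.cong) (auto simp: munit_def)
    then show ?thesis using assms by simp
  qed
  have m2: "smat_mult m n (munit a b) ?D x y = - of_int (rk m b) * munit a b x y" for x y
  proof -
    have "smat_mult m n (munit a b) ?D x y =
       (\<Sum>z\<in>idxs m n. if z = b then - of_int (rk m b) * munit a b x y else 0)"
      unfolding smat_mult_def by (rule sum.cong) (auto simp: munit_def)
    then show ?thesis using assms by simp
  qed
  have br: "gl_bracket m n ?D (munit a b) = (\<lambda>x y. (of_int (rk m b) - of_int (rk m a)) * munit a b x y)"
    unfolding gl_bracket_homogeneous[OF part smat_part_munit] m1 m2
    by (simp add: super_sign_def fun_eq_iff algebra_simps)
  have "?D \<noteq> 0"
  proof
    assume "?D = 0"
    from fun_cong[OF fun_cong[OF this], of a a] show False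
      using rk_bound[OF assms(1)] assms(1) by simp
  qed
  then have supp: "{k. (if k = 0 then ?D else 0) \<noteq> 0} = {0 :: int}" by auto
  show ?thesis
    unfolding hgt_def rootv_def loop_def glhat_bracket_def glhat_scale_def split_conv supp
    by (auto simp: br hdrop_def fun_eq_iff algebra_simps)
qed

definition awt :: "idx \<Rightarrow> weight" where
  "awt a = (\<lambda>(X, c, d). X 0 a a)"

lemma awt_eps: "awt (Ev i) = wt_eps i" and awt_del: "awt (Od j) = wt_del j"
  by (simp_all add: awt_def wt_eps_def wt_del_def)

definition mwt :: "mode \<Rightarrow> weight" where
  "mwt p = (\<lambda>h. mode_sign p * awt (fst p) h + mode_energy p * wt_delta h)"

definition cwt :: "int \<Rightarrow> cfg \<Rightarrow> weight" where
  "cwt l c = (\<lambda>h. lsum (\<lambda>p. mwt p h) c + q_wt (- (\<bar>real_of_int l\<bar> / 2)) h)"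

text \<open>Only the modes -1 and 0 are ever occupied in \<open>top_cfg\<close>, so these two
  numbers, taken with their charges, give the coordinates of the highest weight.\<close>

lemma Lambda_root_diag:
  assumes "m \<ge> 1" "n \<ge> 1" "a \<in> idxs m n"
  shows "Lambda_tilde m n l (rootv a a 0) = of_nat (top_cfg m n l (a, -1)) - of_nat (top_cfg m n l (a, 0))"
proof -
  have app: "sum F I h = (\<Sum>i\<in>I. F i h)" for F :: "nat \<Rightarrow> weight" and I h
    by (rule sum_app)
  have eps: "wt_eps i (rootv a a 0) = (if a = Ev i then 1 else 0)" for i
    by (auto simp: wt_eps_def rootv_def loop_def munit_def)
  have del: "wt_del i (rootv a a 0) = (if a = Od i then 1 else 0)" for i
    by (auto simp: wt_del_def rootv_def loop_def munit_def)
  have L0: "wt_Lambda0 (rootv a a 0) = 0" by (simp add: wt_Lambda0_def rootv_def loop_def)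
  have se: "(\<Sum>i = 1..M. wt_eps i) (rootv a a 0) = (case a of Ev j \<Rightarrow> if 1 \<le> j \<and> j \<le> M then 1 else 0 | Od j \<Rightarrow> 0)" for M
    unfolding app eps by (cases a) (simp_all add: sum.delta')
  show ?thesis
  proof (cases a)
    case (Ev j)
    then have "1 \<le> j \<and> j \<le> m" using assms by (auto simp: idxs_def)
    then show ?thesis using Ev se eps del L0 unfolding Lambda_tilde_def
      by (auto simp: wt_scale_def)
  next
    case (Od j)
    then show ?thesis using se eps del L0 assms unfolding Lambda_tilde_def
      by (auto simp: wt_scale_def)
  qed
qed

lemma Lambda_root_off:
  assumes "k \<noteq> 0 \<or> a \<noteq> b"
  shows "Lambda_tilde m n l (rootv a b k) = 0"
proof -
  have app: "sum F I h = (\<Sum>i\<in>I. F i h)" for F :: "nat \<Rightarrow> weight" and I h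
    by (rule sum_app)
  have "wt_eps i (rootv a b k) = 0" "wt_del i (rootv a b k) = 0" "wt_Lambda0 (rootv a b k) = 0" for i
    using assms by (auto simp: wt_eps_def wt_del_def wt_Lambda0_def rootv_def loop_def munit_def)
  then show ?thesis by (auto simp: Lambda_tilde_def app wt_scale_def)
qed

lemma Lambda_C: "Lambda_tilde m n l C_elt = 1"
  and Lambda_d: "Lambda_tilde m n l d_elt = 0"
proof -
  have app: "sum F I h = (\<Sum>i\<in>I. F i h)" for F :: "nat \<Rightarrow> weight" and I h
    by (rule sum_app)
  show "Lambda_tilde m n l C_elt = 1" "Lambda_tilde m n l d_elt = 0"
    by (auto simp: Lambda_tilde_def app wt_scale_def wt_eps_def wt_del_def wt_Lambda0_def C_elt_def d_elt_def)
qed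

lemma C_part: "C_elt \<in> glhat_part m n 0" and d_part: "d_elt \<in> glhat_part m n 0"
  by (auto simp: glhat_part_def glhat_def gl_def C_elt_def d_elt_def fun_eq_iff smat_part_def)

lemma C_glhat: "C_elt \<in> glhat m n" and d_glhat: "d_elt \<in> glhat m n"
  by (rule glhat_part_glhat[OF C_part], rule glhat_part_glhat[OF d_part])

lemma C_borel: "C_elt \<in> borel m n" and d_borel: "d_elt \<in> borel m n"
  by (auto simp: borel_def C_glhat d_glhat) (auto simp: C_elt_def d_elt_def)

lemma rootv_borel:
  assumes "a \<in> idxs m n" "b \<in> idxs m n" "k > 0 \<or> k = 0 \<and> \<not> idx_less b a"
  shows "rootv a b k \<in> borel m n"
proof -
  have "loop (munit a b) k \<in> glhat m n" using rootv_glhat[OF assms(1,2), of k] by (simp add: rootv_def)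
  then show ?thesis using assms(3) by (auto simp: borel_def rootv_def loop_def munit_def)
qed

section \<open>Comparison of the irreducible module with the Fock space\<close>

context vector_space
begin

text \<open>
  The polynomials \<open>\<Prod>\<^bsub>i=1\<^esub>\<^sup>N (H - h + i)\<close> kill the eigenvectors with eigenvalues
  \<open>h - 1, \<dots>, h - N\<close> but not those with eigenvalue \<open>h\<close>.
\<close>

lemma lower_eigenvectors:
  assumes lin: "Vector_Spaces.linear scale scale H"
    and x: "x \<in> span {y. \<exists>j::nat. j \<ge> 1 \<and> H y = scale (h - of_nat j) y}"
    and Hx: "H x = scale h x" and ch: "\<And>k::nat. (of_nat (Suc k) :: 'a) \<noteq> 0"
  shows "x = 0"
proof -
  interpret H: Vector_Spaces.linear scale scale H by (rule lin)
  define R where "R = rec_nat (\<lambda>y. y) (\<lambda>N r y. H (r y) - scale (h - of_nat (Suc N)) (r y))"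
  have R0: "R 0 y = y" and RS: "R (Suc N) y = H (R N y) - scale (h - of_nat (Suc N)) (R N y)" for N y
    by (simp_all add: R_def)
  have R_add: "R N (y + z) = R N y + R N z" for N y z
    by (induction N) (simp_all add: R0 RS H.add scale_right_distrib)
  have R_scale: "R N (scale s y) = scale s (R N y)" for N s y
    by (induction N) (simp_all add: R0 RS H.scale scale_right_diff_distrib mult.commute)
  have R_mono: "R (N + k) y = 0" if "R N y = 0" for N k y
    using that by (induction k) (simp_all add: RS H.zero)
  have R_eig: "R N y = scale (\<Prod>i\<in>{1..N}. \<mu> - h + of_nat i) y" if "H y = scale \<mu> y" for N \<mu> y
  proof (induction N)
    case (Suc N)
    have "R (Suc N) y = scale (\<mu> - (h - of_nat (Suc N))) (scale (\<Prod>i\<in>{1..N}. \<mu> - h + of_nat i) y)"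
      unfolding RS Suc.IH H.scale that scale_left_diff_distrib by (simp add: mult.commute)
    then show ?case by (simp add: algebra_simps)
  qed (simp add: R0)
  have "\<exists>N. R N x = 0"
    using x
  proof (induction rule: span_induct_alt)
    case base
    show ?case by (auto simp: R0 intro: exI[of _ 0])
  next
    case (step s y z)
    then obtain j N where j: "j \<ge> 1" "H y = scale (h - of_nat j) y" and N: "R N z = 0" by auto
    have "R j y = 0" unfolding R_eig[OF j(2)] using j(1) by (auto simp: prod_zero_iff intro!: bexI[of _ j])
    then have "R (j + N) y = 0" "R (j + N) z = 0"
      using R_mono[of j y N] R_mono[OF N, of j] by (simp_all add: add.commute)
    then show ?case by (intro exI[of _ "j + N"]) (simp add: R_add R_scale)
  qed
  then obtain N where "R N x = 0" by blast
  moreover have "(\<Prod>i\<in>{1..N}. h - h + of_nat i :: 'a) \<noteq> 0"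
  proof -
    have "(of_nat i :: 'a) \<noteq> 0" if "i \<in> {1..N}" for i
      using that ch[of "i - 1"] by simp
    then show ?thesis by (simp add: prod_zero_iff)
  qed
  ultimately show ?thesis unfolding R_eig[OF Hx] by simp
qed

end

text \<open>As \<open>f\<close> need not be homogeneous, the grading is followed from one
  configuration of its support at a time.\<close>

lemma current_shift:
  assumes f: "f \<in> fin_on (cfgs m n)" and ab: "a \<in> idxs m n" "b \<in> idxs m n"
    and z: "\<And>i. mode_sign (a, i + k) * g (a, i + k) - mode_sign (b, i) * g (b, i) = z"
    and c: "current a b k f c \<noteq> 0"
  obtains c0 where "f c0 \<noteq> 0" "lsum g c = lsum g c0 + z"
proof -
  have d: "fdelta c' \<in> fin_on (cfgs m n)" if "f c' \<noteq> 0" for c'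
    using f that by (intro fdelta_fin_on) (auto simp: fin_on_def)
  have t: "tame_vec (fdelta c')" if "c' \<in> {c. f c \<noteq> 0}" for c'
    by (rule fin_on_cfgs_tame[OF d]) (use that in simp)
  have "current a b k f = current a b k (\<Sum>c' | f c' \<noteq> 0. fscale (f c') (fdelta c'))"
    using fin_on_expand[OF f] by (rule arg_cong)
  also have "\<dots> = (\<Sum>c' | f c' \<noteq> 0. current a b k (fscale (f c') (fdelta c')))"
    by (rule current_sum) (rule tame_fscale, rule t)
  also have "\<dots> = (\<Sum>c' | f c' \<noteq> 0. fscale (f c') (current a b k (fdelta c')))"
    by (rule sum.cong[OF refl]) (rule current_fscale, rule t)
  finally have "(\<Sum>c' | f c' \<noteq> 0. fscale (f c') (current a b k (fdelta c')) c) \<noteq> 0"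
    using c by (simp add: sum_app)
  then obtain c0 where c0: "f c0 \<noteq> 0" "fscale (f c0) (current a b k (fdelta c0)) c \<noteq> 0"
    by (metis (mono_tags, lifting) mem_Collect_eq sum.neutral)
  have "homog g (lsum g c0) (fdelta c0)" by (auto simp: homog_def fdelta_def split: if_splits)
  from homog_current[OF d[OF c0(1)] this ab z] c0(2) have "lsum g c = lsum g c0 + z"
    by (auto simp: homog_def fscale_def)
  with c0(1) show ?thesis by (rule that)
qed

text \<open>On charge \<open>l\<close> this differs from the eigenvalue of \<open>hgt\<close> by a
  constant, since \<open>d\<close> contributes i + 1/2 instead of i per unit of charge.\<close>

definition hgrade :: "nat \<Rightarrow> nat \<Rightarrow> mode \<Rightarrow> int" where
  "hgrade m n p = mode_sign p * (int (m + n + 1) * snd p - rk m (fst p))"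

lemma hgrade_shift:
  "mode_sign (a, i + k) * hgrade m n (a, i + k) - mode_sign (b, i) * hgrade m n (b, i) = hdrop m n a b k"
  by (simp add: hgrade_def hdrop_def algebra_simps)

section \<open>The affine superalgebra as the span of root vectors, C and d, and its action\<close>

lemma glhat_0: "0 \<in> glhat m n"
  by (auto simp: glhat_zero glhat_def gl_def)

lemma glhat_add:
  assumes "x \<in> glhat m n" "y \<in> glhat m n" shows "x + y \<in> glhat m n"
proof -
  obtain X c d Y c' d' where xy: "x = (X, c, d)" "y = (Y, c', d')" by (metis prod.exhaust)
  have "\<And>k. X k \<in> gl m n" "\<And>k. Y k \<in> gl m n" "finite {k. X k \<noteq> 0}" "finite {k. Y k \<noteq> 0}"
    using assms by (simp_all add: xy glhat_def)
  moreover have "{k. (X + Y) k \<noteq> 0} \<subseteq> {k. X k \<noteq> 0} \<union> {k. Y k \<noteq> 0}" by auto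
  moreover have "(X + Y) k \<in> gl m n" if "X k \<in> gl m n" "Y k \<in> gl m n" for k
  proof -
    have "X k a b \<noteq> 0 \<or> Y k a b \<noteq> 0" if "(X + Y) k a b \<noteq> 0" for a b
      using that by auto
    then show ?thesis using that unfolding gl_def by blast
  qed
  ultimately have "(\<forall>k. (X + Y) k \<in> gl m n) \<and> finite {k. (X + Y) k \<noteq> 0}"
    by (blast intro: finite_subset)
  then show ?thesis unfolding xy glhat_def add_Pair by blast
qed

lemma glhat_sum: "(\<And>i. i \<in> I \<Longrightarrow> y i \<in> glhat m n) \<Longrightarrow> sum y I \<in> glhat m n"
proof (induction I rule: infinite_finite_induct)
  case (insert i I)
  then show ?case unfolding sum.insert[OF insert(1,2)] by (intro glhat_add) auto
next
  case (infinite A)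
  show ?case unfolding sum.infinite[OF infinite(1)] by (rule glhat_0)
next
  case empty
  show ?case unfolding sum.empty by (rule glhat_0)
qed

lemma glhat_scale_mem:
  assumes "x \<in> glhat m n" shows "glhat_scale s x \<in> glhat m n"
proof -
  obtain X c d where x: "x = (X, c, d)" by (metis prod.exhaust)
  have "\<And>k. X k \<in> gl m n" "finite {k. X k \<noteq> 0}"
    using assms by (simp_all add: x glhat_def)
  moreover have "{k. (\<lambda>a b. s * X k a b) \<noteq> 0} \<subseteq> {k. X k \<noteq> 0}" by (auto simp: fun_eq_iff)
  ultimately show ?thesis
    by (auto simp: x glhat_scale_def glhat_def gl_def intro: finite_subset)
qed

lemma glhat_scale_0: "glhat_scale 0 x = 0"
  by (cases x) (simp add: glhat_scale_def glhat_zero zero_fun_def)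

lemma glhat_expand:
  assumes "(X, c, d) \<in> glhat m n"
  shows "(X, c, d) = (\<Sum>(k, a, b)\<in>{k. X k \<noteq> 0} \<times> idxs m n \<times> idxs m n. glhat_scale (X k a b) (rootv a b k))
     + (glhat_scale c C_elt + glhat_scale d d_elt)" (is "_ = ?S + _")
proof -
  let ?I = "{k. X k \<noteq> 0} \<times> idxs m n \<times> idxs m n"
  have fin: "finite ?I" and gl: "X k \<in> gl m n" for k using assms by (simp_all add: glhat_def)
  have eq: "fst ?S r x y = X r x y" for r x y
  proof -
    have "fst ?S r x y = (\<Sum>(k, a, b)\<in>?I. X k a b * (if r = k then munit a b else 0) x y)"
      by (simp add: fst_sum sum_app split_def glhat_scale_def rootv_def loop_def)
    also have "\<dots> = (\<Sum>q\<in>?I. if q = (r, x, y) then X r x y else 0)"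
      by (rule sum.cong) (auto simp: munit_def split: if_splits)
    also have "\<dots> = X r x y"
    proof (cases "(r, x, y) \<in> ?I")
      case False
      then have "X r x y = 0" using gl[of r] unfolding gl_def by auto
      then show ?thesis by (auto intro!: sum.neutral)
    qed (simp add: sum.delta'[OF fin] sum.delta[OF fin])
    finally show ?thesis .
  qed
  have "fst ?S = X" by (intro ext eq)
  moreover have "snd ?S = 0"
    unfolding snd_sum by (rule sum.neutral) (auto simp: glhat_scale_def rootv_def loop_def zero_prod_def)
  moreover have "glhat_scale c C_elt + glhat_scale d d_elt = (0, c, d)"
    by (simp add: glhat_scale_def C_elt_def d_elt_def zero_fun_def plus_fun_def)
  ultimately show ?thesis by (simp add: prod_eq_iff)
qed

locale L_module = glhat_module scale m n V act
  for scale :: "complex \<Rightarrow> 'v::ab_group_add \<Rightarrow> 'v" and m n V act +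
  fixes l :: int and v :: 'v
  assumes mn: "m \<ge> 1" "n \<ge> 1"
    and irr: "irreducible_module scale m n V act"
    and hw: "highest_weight_vector scale m n V act (Lambda_tilde m n l) v"
begin

lemma act_lin: "x \<in> glhat m n \<Longrightarrow> act x (u + u') = act x u + act x u'"
    "x \<in> glhat m n \<Longrightarrow> act x (scale s u) = scale s (act x u)"
    "x \<in> glhat m n \<Longrightarrow> act x 0 = 0"
  using act_linear[of x] unfolding Vector_Spaces.linear_iff_module_hom
  by (simp_all add: module_hom.add module_hom.scale module_hom.zero)

lemma v_nonzero: "v \<noteq> 0" and v_borel: "x \<in> borel m n \<Longrightarrow> act x v = scale (Lambda_tilde m n l x) v"
  using hw by (auto simp: highest_weight_vector_def)

lemma submodule_UNIV:
  assumes "graded_submodule scale m n V act W" "u \<in> W" "u \<noteq> 0"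
  shows "W = UNIV"
  using irr assms unfolding irreducible_module_def by blast

lemma submodule_zero:
  assumes "graded_submodule scale m n V act W" "W \<noteq> UNIV"
  shows "W = {0}"
  using irr assms unfolding irreducible_module_def by blast

lemma act_0: "act 0 u = 0"
  using act_scale[OF glhat_0, of 0 u] by (simp add: glhat_scale_0)

lemma act_sum:
  assumes "\<And>i. i \<in> I \<Longrightarrow> y i \<in> glhat m n"
  shows "act (sum y I) u = (\<Sum>i\<in>I. act (y i) u)"
  using assms
proof (induction I rule: infinite_finite_induct)
  case (insert i I)
  then have "act (sum y (insert i I)) u = act (y i) u + act (sum y I) u"
    unfolding sum.insert[OF insert(1,2)] by (intro act_add glhat_sum) auto
  then show ?case using insert by simp
qed (simp_all add: act_0)

text \<open>Reduces invariance of a subspace to the elements for which the bracket relations are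
  explicit.\<close>

lemma act_closed:
  assumes S: "subspace S" and u: "u \<in> S" and x: "x \<in> glhat m n"
    and r: "\<And>a b k. a \<in> idxs m n \<Longrightarrow> b \<in> idxs m n \<Longrightarrow> act (rootv a b k) u \<in> S"
    and C: "act C_elt u \<in> S" and d: "act d_elt u \<in> S"
  shows "act x u \<in> S"
proof -
  obtain X c e where X: "x = (X, c, e)" by (metis prod.exhaust)
  let ?I = "{k. X k \<noteq> 0} \<times> idxs m n \<times> idxs m n"
  let ?y = "\<lambda>(k, a, b). glhat_scale (X k a b) (rootv a b k)"
  have y: "?y i \<in> glhat m n" if "i \<in> ?I" for i
    using that by (auto intro!: glhat_scale_mem)
  have sc: "glhat_scale c C_elt \<in> glhat m n" "glhat_scale e d_elt \<in> glhat m n"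
    by (intro glhat_scale_mem C_glhat d_glhat)+
  have "act x u = act (sum ?y ?I) u + (act (glhat_scale c C_elt) u + act (glhat_scale e d_elt) u)"
    unfolding X
    by (subst glhat_expand[OF x[unfolded X]])
      (subst act_add[OF glhat_sum[OF y] glhat_add[OF sc]], assumption, simp only: act_add[OF sc])
  also have "act (sum ?y ?I) u = (\<Sum>i\<in>?I. act (?y i) u)"
    by (rule act_sum) (rule y)
  also have "\<dots> + (act (glhat_scale c C_elt) u + act (glhat_scale e d_elt) u) \<in> S"
  proof (intro subspace_add[OF S] subspace_sum[OF S])
    fix i assume "i \<in> ?I"
    then obtain k a b where i: "i = (k, a, b)" "a \<in> idxs m n" "b \<in> idxs m n" by auto
    show "act (?y i) u \<in> S"
      unfolding i(1) split_conv act_scale[OF rootv_glhat[OF i(2,3)]]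
      by (intro subspace_scale[OF S] r i)
  qed (unfold act_scale[OF C_glhat] act_scale[OF d_glhat], (intro subspace_scale[OF S] C d)+)
  finally show ?thesis .
qed

lemma V_diff: "u \<in> V p \<Longrightarrow> u' \<in> V p \<Longrightarrow> u - u' \<in> V p"
  using subspace_diff[OF grading_subspace] .

lemma V_unique:
  assumes "u0 \<in> V 0" "u1 \<in> V 1" "u0 + u1 = u0' + u1'" "u0' \<in> V 0" "u1' \<in> V 1"
  shows "u0 = u0' \<and> u1 = u1'"
proof -
  have "u0 - u0' \<in> V 0" "u1' - u1 \<in> V 1" using V_diff assms by auto
  moreover have eq: "u0 - u0' = u1' - u1" using assms(3) by (simp add: algebra_simps)
  ultimately have "u0 - u0' \<in> V 0 \<inter> V 1" by simp
  then have "u0 - u0' = 0" unfolding grading_disjoint by simp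
  then show ?thesis using eq by simp
qed

text \<open>The highest weight fixes \<open>C\<close> on \<open>v\<close> only. Its eigenspace for 1
  is a graded submodule, as \<open>C\<close> is central and even, so irreducibility makes it
  everything.\<close>

lemma act_C: "act C_elt u = u"
proof -
  let ?W = "{u. act C_elt u = u}"
  have comm: "act C_elt (act x u) = act x (act C_elt u)" if "x \<in> glhat_part m n p" for x p u
    using act_bracket[OF C_part that, of u] by (simp add: super_sign_def C_bracket act_0)
  have W: "subspace ?W"
    by (rule subspaceI) (simp_all add: act_lin[OF C_glhat])
  have "graded_submodule scale m n V act ?W"
    unfolding graded_submodule_def
  proof (intro conjI ballI)
    fix x w assume x: "x \<in> glhat m n" and w: "w \<in> ?W"
    then have Cw: "act C_elt w = w" by simp
    show "act x w \<in> ?W"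
    proof (rule act_closed[OF W w x])
      fix a b k assume "a \<in> idxs m n" "b \<in> idxs m n"
      from comm[OF rootv_part[OF this], of k w] show "act (rootv a b k) w \<in> ?W"
        unfolding Cw by (rule CollectI)
    next
      show "act C_elt w \<in> ?W" unfolding Cw by (rule w)
    next
      from comm[OF d_part, of w] show "act d_elt w \<in> ?W" unfolding Cw by (rule CollectI)
    qed
  next
    fix w assume w: "w \<in> ?W"
    obtain w0 w1 where w01: "w0 \<in> V 0" "w1 \<in> V 1" "w = w0 + w1" using grading_sum[of w] by blast
    have C01: "act C_elt w0 \<in> V 0" "act C_elt w1 \<in> V 1"
      using act_parity[OF C_part w01(1)] act_parity[OF C_part w01(2)] by simp_all
    have "act C_elt w0 + act C_elt w1 = w0 + w1"
      using w by (simp add: w01(3) act_lin[OF C_glhat])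
    then have "act C_elt w0 = w0 \<and> act C_elt w1 = w1"
      by (intro V_unique C01 w01)
    then show "\<exists>w0\<in>?W \<inter> V 0. \<exists>w1\<in>?W \<inter> V 1. w = w0 + w1"
      using w01 by blast
  qed (use W in simp)
  moreover have "v \<in> ?W" using v_borel[OF C_borel] Lambda_C by simp
  ultimately have "?W = UNIV" using submodule_UNIV v_nonzero by blast
  then show ?thesis by blast
qed

definition EV :: "idx \<Rightarrow> idx \<Rightarrow> int \<Rightarrow> 'v \<Rightarrow> 'v" where
  "EV a b k u = act (rootv a b k) u"

text \<open>Term by term the relation \<open>current_current\<close>, with \<open>C\<close> replaced
  by 1; this agreement lets a single induction treat both components of \<open>W\<close>.\<close>

lemma EV_EV:
  assumes "a \<in> idxs m n" "b \<in> idxs m n" "c \<in> idxs m n" "d \<in> idxs m n"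
  defines "\<sigma> \<equiv> exchange_sign a c * exchange_sign b c * exchange_sign a d * exchange_sign b d"
  shows "EV a b k (EV c d k' u) = scale \<sigma> (EV c d k' (EV a b k u))
     + (if b = c then EV a d (k + k') u else 0) - (if a = d then scale \<sigma> (EV c b (k + k') u) else 0)
     + (if b = c \<and> a = d \<and> k + k' = 0 then scale (of_int k * esgn a) u else 0)"
proof -
  let ?s = "super_sign (parity a + parity b) (parity c + parity d)"
  have s: "?s = \<sigma>" unfolding super_sign_exchange_sign \<sigma>_def ..
  let ?x = "if b = c then rootv a d (k + k') else 0" and ?y = "if a = d then rootv c b (k + k') else 0"
    and ?z = "if b = c \<and> a = d \<and> k + k' = 0 then of_int k * esgn a else 0"
  have xy: "?x \<in> glhat m n" "?y \<in> glhat m n" using assms by (auto intro: glhat_0)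
  have "act (?x + glhat_scale (- ?s) ?y + glhat_scale ?z C_elt) u =
     act ?x u + scale (- ?s) (act ?y u) + scale ?z u"
    by (simp only: act_add act_scale xy glhat_add glhat_scale_mem C_glhat act_C)
  then have "act (rootv a b k) (act (rootv c d k') u) - scale ?s (act (rootv c d k') (act (rootv a b k) u)) =
     act ?x u + scale (- ?s) (act ?y u) + scale ?z u"
    unfolding act_bracket[OF rootv_part[OF assms(1,2)] rootv_part[OF assms(3,4)], of k k' u, symmetric]
      bracket_root[OF assms(1-4)] .
  then show ?thesis
    unfolding EV_def s by (auto simp: act_0 algebra_simps)
qed

end

lemma cartan_expand:
  assumes "(X, c, d) \<in> cartan_hd m n"
  shows "(X, c, d) = (\<Sum>a\<in>idxs m n. glhat_scale (X 0 a a) (rootv a a 0)) + glhat_scale d d_elt" (is "_ = ?S + _")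
proof -
  have h: "(X, c, d) \<in> glhat m n" "\<And>k. k \<noteq> 0 \<Longrightarrow> X k = 0" "\<And>a b. a \<noteq> b \<Longrightarrow> X 0 a b = 0" "c = 0"
    using assms by (auto simp: cartan_hd_def cartan_def)
  have gl: "X 0 \<in> gl m n" using h(1) by (simp add: glhat_def)
  have eq: "fst ?S r x y = X r x y" for r x y
  proof -
    have "fst ?S r x y = (\<Sum>a\<in>idxs m n. X 0 a a * (if r = 0 then munit a a else 0) x y)"
      by (simp add: fst_sum sum_app glhat_scale_def rootv_def loop_def)
    also have "\<dots> = (\<Sum>a\<in>idxs m n. if a = x then X r x y else 0)"
    proof (rule sum.cong[OF refl])
      fix a
      show "X 0 a a * (if r = 0 then munit a a else 0) x y = (if a = x then X r x y else 0)"
        using h(2)[of r] h(3)[of x y] by (cases "r = 0"; cases "x = y"; cases "a = x") (auto simp: munit_def)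
    qed
    also have "\<dots> = (if x \<in> idxs m n then X r x y else 0)" by simp
    also have "\<dots> = X r x y"
      using gl h(2)[of r] by (cases "r = 0") (auto simp: gl_def)
    finally show ?thesis .
  qed
  have "fst ?S = X" by (intro ext eq)
  moreover have "snd ?S = 0"
    unfolding snd_sum by (rule sum.neutral) (auto simp: glhat_scale_def rootv_def loop_def zero_prod_def)
  moreover have "glhat_scale d d_elt = (0, 0, d)"
    by (simp add: glhat_scale_def d_elt_def zero_fun_def)
  ultimately show ?thesis by (simp add: prod_eq_iff h(4))
qed

lemma Dop_zero: "Dop l 0 = 0"
  by (simp add: Dop_def)

context L_module
begin

abbreviation "top_vec \<equiv> fdelta (top_cfg m n l)"
abbreviation "charged \<equiv> fin_on (cfgs_ch m n l)"

lemma charged_sub: "f \<in> charged \<Longrightarrow> f \<in> fin_on (cfgs m n)"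
  unfolding fin_on_cfgs_ch by blast

lemma charged_tame: "f \<in> charged \<Longrightarrow> tame_vec f"
  by (rule fin_on_cfgs_tame[OF charged_sub])

lemma EV_lin: "a \<in> idxs m n \<Longrightarrow> b \<in> idxs m n \<Longrightarrow> EV a b k (u + u') = EV a b k u + EV a b k u'"
    "a \<in> idxs m n \<Longrightarrow> b \<in> idxs m n \<Longrightarrow> EV a b k (scale s u) = scale s (EV a b k u)"
    "a \<in> idxs m n \<Longrightarrow> b \<in> idxs m n \<Longrightarrow> EV a b k 0 = 0"
  by (simp_all add: EV_def act_lin[OF rootv_glhat])

lemma bracket_eigen:
  assumes "x \<in> glhat_part m n 0" "a \<in> idxs m n" "b \<in> idxs m n"
    and "glhat_bracket m n x (rootv a b k) = glhat_scale s (rootv a b k)"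
  shows "act x (EV a b k u) = EV a b k (act x u) + scale s (EV a b k u)"
  using act_bracket[OF assms(1) rootv_part[OF assms(2,3)], of k u]
  unfolding assms(4) act_scale[OF rootv_glhat[OF assms(2,3)]]
  by (simp add: super_sign_def EV_def)

lemma d_EV:
  assumes "a \<in> idxs m n" "b \<in> idxs m n"
  shows "act d_elt (EV a b k u) = EV a b k (act d_elt u) + scale (of_int k) (EV a b k u)"
  by (rule bracket_eigen[OF d_part assms]) (simp add: rootv_def d_bracket_loop)

lemma hgt_EV:
  assumes "a \<in> idxs m n" "b \<in> idxs m n"
  shows "act (hgt m n) (EV a b k u) = EV a b k (act (hgt m n) u) + scale (of_int (hdrop m n a b k)) (EV a b k u)"
  by (rule bracket_eigen[OF hgt_part assms bracket_hgt[OF assms]])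

section \<open>The submodule generated by both highest weight vectors together\<close>

definition lowering :: "idx \<Rightarrow> idx \<Rightarrow> int \<Rightarrow> bool" where
  "lowering a b k \<longleftrightarrow> k < 0 \<or> k = 0 \<and> idx_less b a"

text \<open>Only lowering operators appear in the rules, so that triangularity
  (\<open>W_lower\<close>) is a direct induction; stability under all root vectors is proved in
  \<open>W_current\<close>.\<close>

inductive_set W :: "('v \<times> fock) set" where
  base: "(v, top_vec) \<in> W"
| add: "(u, f) \<in> W \<Longrightarrow> (u', f') \<in> W \<Longrightarrow> (u + u', f + f') \<in> W"
| scl: "(u, f) \<in> W \<Longrightarrow> (scale s u, fscale s f) \<in> W"
| step: "(u, f) \<in> W \<Longrightarrow> a \<in> idxs m n \<Longrightarrow> b \<in> idxs m n \<Longrightarrow> lowering a b k \<Longrightarrow> (EV a b k u, current a b k f) \<in> W"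

lemma W_0: "(0, 0) \<in> W"
  using W.scl[OF W.base, of 0] by simp

lemma W_diff: "(u, f) \<in> W \<Longrightarrow> (u', f') \<in> W \<Longrightarrow> (u - u', f - f') \<in> W"
  using W.add[of u f "scale (-1) u'" "fscale (-1) f'"] W.scl[of u' f' "-1"]
  by (simp add: fscale_minus)

lemma W_charged: "(u, f) \<in> W \<Longrightarrow> f \<in> charged"
proof (induction rule: W.induct)
  case base
  show ?case by (rule fdelta_fin_on[OF top_cfg_ch[OF mn]])
next
  case (add u f u' f')
  then show ?case by (intro fin_on_add)
next
  case (scl u f s)
  then show ?case by (intro fin_on_fscale)
next
  case (step u f a b k)
  then show ?case by (intro current_fin_on_ch)
qed

text \<open>On the generator, both components react in the same way to each root vector. In the
  inductive step the operator is moved past the last lowering operator; since the induction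
  hypothesis holds for all indices and degrees, it also covers the bracket terms.\<close>

lemma W_current:
  "(u, f) \<in> W \<Longrightarrow> a \<in> idxs m n \<Longrightarrow> b \<in> idxs m n \<Longrightarrow> (EV a b k u, current a b k f) \<in> W"
proof (induction arbitrary: a b k rule: W.induct)
  case base
  consider "lowering a b k" | "k > 0 \<or> k = 0 \<and> idx_less a b" | "k = 0" "a = b"
    using idx_less_cases[of a b] unfolding lowering_def by linarith
  then show ?case
  proof cases
    case 1
    then show ?thesis using base by (intro W.step W.base)
  next
    case 2
    then have nl: "\<not> idx_less b a \<or> k > 0" "k \<noteq> 0 \<or> a \<noteq> b" by (cases a; cases b; auto)+
    then have "EV a b k v = 0" unfolding EV_def
      using v_borel[OF rootv_borel[OF base, of k]] Lambda_root_off[of k a b] 2 by auto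
    moreover have "current a b k top_vec = 0" by (rule current_top_cfg[OF mn base 2])
    ultimately show ?thesis using W_0 by (simp only:)
  next
    case 3
    have "\<not> idx_less b b" by (cases b) auto
    then have "EV a b k v = scale (of_nat (top_cfg m n l (a, -1)) - of_nat (top_cfg m n l (a, 0))) v"
      unfolding EV_def using v_borel[OF rootv_borel[OF base, of k]] Lambda_root_diag[OF mn base(1), of l] 3 by simp
    moreover have "current a b k top_vec = fscale (of_nat (top_cfg m n l (a, -1)) - of_nat (top_cfg m n l (a, 0))) top_vec"
      using current_diag_top_cfg[OF mn, of a l] 3 by simp
    ultimately show ?thesis using W.scl[OF W.base] by (simp only:)
  qed
next
  case (add u f u' f')
  have "current a b k (f + f') = current a b k f + current a b k f'"
    by (rule current_add) (rule charged_tame, rule W_charged, rule add)+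
  then show ?case using W.add[OF add.IH(1)[OF add.prems] add.IH(2)[OF add.prems]]
    by (simp only: EV_lin[OF add.prems])
next
  case (scl u f s)
  have "current a b k (fscale s f) = fscale s (current a b k f)"
    by (rule current_fscale) (rule charged_tame, rule W_charged, rule scl)
  then show ?case using W.scl[OF scl.IH[OF scl.prems]] by (simp only: EV_lin[OF scl.prems])
next
  case (step u f c d k')
  let ?s = "exchange_sign a c * exchange_sign b c * exchange_sign a d * exchange_sign b d"
  let ?z = "of_int k * esgn a"
  have f: "tame_vec f" by (rule charged_tame, rule W_charged, rule step)
  note ab = step.prems and cd = step.hyps(2,3)
  have 1: "(scale ?s (EV c d k' (EV a b k u)), fscale ?s (current c d k' (current a b k f))) \<in> W"
    by (intro W.scl W.step step.IH ab step.hyps)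
  have 2: "(if b = c then EV a d (k + k') u else 0, if b = c then current a d (k + k') f else 0) \<in> W"
    using step.IH[OF ab(1) cd(2)] W_0 by (cases "b = c") (simp_all only: if_True if_False simp_thms)
  have 3: "(if a = d then scale ?s (EV c b (k + k') u) else 0, if a = d then fscale ?s (current c b (k + k') f) else 0) \<in> W"
    using W.scl[OF step.IH[OF cd(1) ab(2)]] W_0 by (cases "a = d") (simp_all only: if_True if_False simp_thms)
  have 4: "(if b = c \<and> a = d \<and> k + k' = 0 then scale ?z u else 0, if b = c \<and> a = d \<and> k + k' = 0 then fscale ?z f else 0) \<in> W"
    using W.scl[OF step.hyps(1)] W_0
    by (cases "b = c \<and> a = d \<and> k + k' = 0") (simp_all only: if_True if_False simp_thms)
  show ?case
    unfolding EV_EV[OF ab cd, where k = k and k' = k']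
      current_current[OF f, where a = a and b = b and c = c and d = d and k = k and l = k']
    by (rule W.add[OF W_diff[OF W.add[OF 1 2] 3] 4])
qed

lemma W_D: "(u, f) \<in> W \<Longrightarrow> (act d_elt u, Dop l f) \<in> W"
proof (induction rule: W.induct)
  case base
  have "act d_elt v = 0" using v_borel[OF d_borel] Lambda_d by simp
  then show ?case using Dop_top_cfg[OF mn, of l] W_0 by (simp only:)
next
  case (add u f u' f')
  show ?case unfolding act_lin[OF d_glhat] Dop_add by (rule W.add[OF add.IH])
next
  case (scl u f s)
  show ?case unfolding act_lin[OF d_glhat] Dop_fscale by (rule W.scl[OF scl.IH])
next
  case (step u f a b k)
  have f: "f \<in> fin_on (cfgs m n)" by (rule charged_sub, rule W_charged, rule step)
  show ?case
    unfolding d_EV[OF step(2,3)] Dop_current[OF f step(2,3)]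
    by (intro W.add W.step W.scl step)
qed

lemma W_lower:
  "(u, f) \<in> W \<Longrightarrow> \<exists>\<alpha>. u - scale \<alpha> v \<in> span {y. \<exists>j::nat. j \<ge> 1 \<and>
        act (hgt m n) y = scale (Lambda_tilde m n l (hgt m n) - of_nat j) y}
     \<and> (\<forall>c. (f - fscale \<alpha> top_vec) c \<noteq> 0 \<longrightarrow> lsum (hgrade m n) c < lsum (hgrade m n) (top_cfg m n l))"
proof (induction rule: W.induct)
  case base
  show ?case by (rule exI[of _ 1]) (simp add: span_zero)
next
  case (add u f u' f')
  let ?S = "span {y. \<exists>j::nat. j \<ge> 1 \<and> act (hgt m n) y = scale (Lambda_tilde m n l (hgt m n) - of_nat j) y}"
  obtain \<alpha> \<beta> where a: "u - scale \<alpha> v \<in> ?S"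
      "\<And>c. (f - fscale \<alpha> top_vec) c \<noteq> 0 \<Longrightarrow> lsum (hgrade m n) c < lsum (hgrade m n) (top_cfg m n l)"
    and b: "u' - scale \<beta> v \<in> ?S"
      "\<And>c. (f' - fscale \<beta> top_vec) c \<noteq> 0 \<Longrightarrow> lsum (hgrade m n) c < lsum (hgrade m n) (top_cfg m n l)"
    using add.IH by blast
  have "u + u' - scale (\<alpha> + \<beta>) v = (u - scale \<alpha> v) + (u' - scale \<beta> v)"
    by (simp add: algebra_simps)
  then have 1: "u + u' - scale (\<alpha> + \<beta>) v \<in> ?S" using span_add[OF a(1) b(1)] by (simp only:)
  have 2: "lsum (hgrade m n) c < lsum (hgrade m n) (top_cfg m n l)" if "(f + f' - fscale (\<alpha> + \<beta>) top_vec) c \<noteq> 0" for c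
  proof -
    have "(f - fscale \<alpha> top_vec) c \<noteq> 0 \<or> (f' - fscale \<beta> top_vec) c \<noteq> 0"
      using that by (auto simp: fscale_def algebra_simps)
    then show ?thesis using a(2) b(2) by blast
  qed
  show ?case using 1 2 by blast
next
  case (scl u f s)
  let ?S = "span {y. \<exists>j::nat. j \<ge> 1 \<and> act (hgt m n) y = scale (Lambda_tilde m n l (hgt m n) - of_nat j) y}"
  obtain \<alpha> where a: "u - scale \<alpha> v \<in> ?S"
      "\<And>c. (f - fscale \<alpha> top_vec) c \<noteq> 0 \<Longrightarrow> lsum (hgrade m n) c < lsum (hgrade m n) (top_cfg m n l)"
    using scl.IH by blast
  have 1: "scale s u - scale (s * \<alpha>) v \<in> ?S"
    using span_scale[OF a(1), of s] by (simp add: scale_right_diff_distrib)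
  have 2: "lsum (hgrade m n) c < lsum (hgrade m n) (top_cfg m n l)" if "(fscale s f - fscale (s * \<alpha>) top_vec) c \<noteq> 0" for c
    using that by (intro a(2)) (auto simp: fscale_def)
  show ?case using 1 2 by blast
next
  case (step u f a b k)
  let ?h = "Lambda_tilde m n l (hgt m n)"
  let ?G = "{y. \<exists>j::nat. j \<ge> 1 \<and> act (hgt m n) y = scale (?h - of_nat j) y}"
  let ?r = "hdrop m n a b k"
  have neg: "?r < 0" using hdrop_neg[OF step(2,3)] step(4) by (simp add: lowering_def)
  obtain \<alpha> where a: "u - scale \<alpha> v \<in> span ?G"
      "\<And>c. (f - fscale \<alpha> top_vec) c \<noteq> 0 \<Longrightarrow> lsum (hgrade m n) c < lsum (hgrade m n) (top_cfg m n l)"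
    using step.IH by blast
  have gen: "EV a b k y \<in> ?G" if "act (hgt m n) y = scale (?h - of_nat j) y" for y j
  proof -
    have "act (hgt m n) (EV a b k y) = scale (?h - of_nat (j + nat (- ?r))) (EV a b k y)"
      unfolding hgt_EV[OF step(2,3)] that EV_lin[OF step(2,3)] scale_left_distrib[symmetric]
      using neg by (simp add: of_nat_nat)
    moreover have "j + nat (- ?r) \<ge> 1" using neg by simp
    ultimately show ?thesis by blast
  qed
  have closed: "EV a b k y \<in> span ?G" if "y \<in> span ?G" for y
    using that
  proof (induction rule: span_induct_alt)
    case base
    then show ?case by (simp add: EV_lin[OF step(2,3)] span_zero)
  next
    case (step s y z)
    then have "EV a b k y \<in> ?G" using gen by blast
    then show ?case unfolding EV_lin[OF \<open>a \<in> idxs m n\<close> \<open>b \<in> idxs m n\<close>]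
      by (intro span_add span_scale span_base step.IH)
  qed
  have "act (hgt m n) v = scale (?h - of_nat 0) v"
    using v_borel[OF hgt_borel] by simp
  then have EVv: "EV a b k v \<in> span ?G" by (intro span_base gen)
  have "EV a b k (u - scale \<alpha> v) + scale \<alpha> (EV a b k v) \<in> span ?G"
    by (rule span_add[OF closed[OF a(1)] span_scale[OF EVv]])
  moreover have "EV a b k (u - scale \<alpha> v) + scale \<alpha> (EV a b k v) = EV a b k u"
    unfolding EV_lin(1,2)[OF step(2,3), symmetric] by simp
  \<comment> \<open>Nothing of the top survives a lowering operator, so the coefficient is
    0.\<close>
  ultimately have 1: "EV a b k u - scale 0 v \<in> span ?G" by simp
  have 2: "lsum (hgrade m n) c < lsum (hgrade m n) (top_cfg m n l)" if "(current a b k f - fscale 0 top_vec) c \<noteq> 0" for c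
  proof -
    have f: "f \<in> fin_on (cfgs m n)" by (rule charged_sub, rule W_charged, rule step)
    have "current a b k f c \<noteq> 0" using that by simp
    then obtain c0 where c0: "f c0 \<noteq> 0" "lsum (hgrade m n) c = lsum (hgrade m n) c0 + ?r"
      using current_shift[OF f step(2,3) hgrade_shift] by blast
    have "lsum (hgrade m n) c0 \<le> lsum (hgrade m n) (top_cfg m n l)"
    proof (cases "c0 = top_cfg m n l")
      case False
      then have "(f - fscale \<alpha> top_vec) c0 \<noteq> 0" using c0(1) by (simp add: fscale_def fdelta_def)
      then show ?thesis using a(2)[of c0] by simp
    qed simp
    then show ?thesis using c0(2) neg by simp
  qed
  show ?case using 1 2 by blast
qed

lemma v_not_lower:
  assumes "v \<in> span {y. \<exists>j::nat. j \<ge> 1 \<and> act (hgt m n) y = scale (Lambda_tilde m n l (hgt m n) - of_nat j) y}"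
  shows False
proof -
  have "v = 0"
    by (rule lower_eigenvectors[OF act_linear[OF hgt_glhat] assms v_borel[OF hgt_borel]])
      (simp del: of_nat_Suc)
  then show False using v_nonzero by contradiction
qed

text \<open>The Fock component determines \<alpha>: it is 0 for (v, 0) and 1 for (0,
  \<open>top_vec\<close>). In both cases \<open>v\<close> would be a combination of strictly lower
  eigenvectors.\<close>

lemma W_top:
  assumes "(u, f) \<in> W"
  shows "u \<noteq> v \<or> f \<noteq> 0" "u \<noteq> 0 \<or> f \<noteq> top_vec"
proof -
  obtain \<alpha> where a: "u - scale \<alpha> v \<in> span {y. \<exists>j::nat. j \<ge> 1 \<and>
        act (hgt m n) y = scale (Lambda_tilde m n l (hgt m n) - of_nat j) y}"
     "\<And>c. (f - fscale \<alpha> top_vec) c \<noteq> 0 \<Longrightarrow> lsum (hgrade m n) c < lsum (hgrade m n) (top_cfg m n l)"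
    using W_lower[OF assms] by blast
  have top: "(f - fscale \<alpha> top_vec) (top_cfg m n l) = 0" using a(2)[of "top_cfg m n l"] by blast
  show "u \<noteq> v \<or> f \<noteq> 0"
  proof (rule ccontr)
    assume "\<not> (u \<noteq> v \<or> f \<noteq> 0)"
    then have uf: "u = v" "f = 0" by auto
    have "\<alpha> = 0" using top by (simp add: uf fscale_def fdelta_def)
    then show False using a(1) v_not_lower by (simp add: uf)
  qed
  show "u \<noteq> 0 \<or> f \<noteq> top_vec"
  proof (rule ccontr)
    assume "\<not> (u \<noteq> 0 \<or> f \<noteq> top_vec)"
    then have uf: "u = 0" "f = top_vec" by auto
    have "\<alpha> = 1" using top by (simp add: uf fscale_def fdelta_def)
    then have "v \<in> span {y. \<exists>j::nat. j \<ge> 1 \<and>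
        act (hgt m n) y = scale (Lambda_tilde m n l (hgt m n) - of_nat j) y}"
      using span_neg[OF a(1)] by (simp add: uf)
    then show False by (rule v_not_lower)
  qed
qed

end

lemma homog_disjoint:
  assumes "homog g x f" "homog g y f'" "x \<noteq> y" "f + f' = 0"
  shows "f = 0" "f' = 0"
proof -
  have "f c = 0 \<and> f' c = 0" for c
  proof -
    have "f c + f' c = 0" using fun_cong[OF assms(4), of c] by simp
    then show ?thesis using assms(1-3) unfolding homog_def
      by (metis add.left_neutral add.right_neutral)
  qed
  then show "f = 0" "f' = 0" by (simp_all add: fun_eq_iff)
qed

lemma lsum_by_index:
  assumes "c \<in> cfgs m n"
  shows "lsum (\<lambda>p. mode_sign p * x (fst p)) c = (\<Sum>a\<in>idxs m n. x a * lsum (acount a) c)"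
proof -
  have "(\<Sum>a\<in>idxs m n. x a * lsum (acount a) c) =
      (\<Sum>p | c p \<noteq> 0. \<Sum>a\<in>idxs m n. if a = fst p then of_nat (c p) * (mode_sign p * x (fst p)) else 0)"
    unfolding lsum_def sum_distrib_left acount_def by (subst sum.swap) (auto intro!: sum.cong)
  also have "\<dots> = (\<Sum>p | c p \<noteq> 0. of_nat (c p) * (mode_sign p * x (fst p)))"
    by (rule sum.cong) (use cfgs_idx[OF assms] in auto)
  finally show ?thesis unfolding lsum_def ..
qed

lemma cwt_eq:
  assumes "c \<in> cfgs m n"
  shows "cwt l c h = (\<Sum>a\<in>idxs m n. awt a h * lsum (acount a) c)
    + wt_delta h * (lsum mode_energy c + of_int \<bar>l\<bar> / 2)"
proof -
  have abs_l: "complex_of_real \<bar>real_of_int l\<bar> = of_int \<bar>l\<bar>"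
    by (metis of_int_abs of_real_of_int_eq)
  have "cwt l c h = lsum (\<lambda>p. mode_sign p * awt (fst p) h) c + wt_delta h * (lsum mode_energy c + of_int \<bar>l\<bar> / 2)"
    unfolding cwt_def mwt_def lsum_def
    using abs_l by (simp add: q_wt_def wt_scale_def algebra_simps sum.distrib sum_distrib_left)
  then show ?thesis unfolding lsum_by_index[OF assms, of "\<lambda>a. awt a h"] .
qed

section \<open>Parity, and the bijectivity of the two projections\<close>

context L_module
begin

text \<open>Elements of \<open>W\<close> must split by parity in both components simultaneously to
  give graded submodules. The parity of \<open>v\<close> is arbitrary, hence the offset between the
  two gradings.\<close>

lemma W_graded:
  assumes hp: "v \<in> V p"
  shows "(u, f) \<in> W \<Longrightarrow> \<exists>u0 f0 u1 f1. (u0, f0) \<in> W \<and> (u1, f1) \<in> W \<and> u = u0 + u1 \<and> f = f0 + f1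
    \<and> u0 \<in> V 0 \<and> u1 \<in> V 1 \<and> homog mode_par (p + lsum mode_par (top_cfg m n l)) f0
    \<and> homog mode_par (1 + p + lsum mode_par (top_cfg m n l)) f1"
proof (induction rule: W.induct)
  let ?s = "p + lsum mode_par (top_cfg m n l)"
  have V0: "0 \<in> V q" for q using subspace_0[OF grading_subspace] .
  case base
  have hh: "homog mode_par (lsum mode_par (top_cfg m n l)) top_vec" by (auto simp: homog_def fdelta_def split: if_splits)
  show ?case
  proof (cases p)
    case zero
    show ?thesis
      by (rule exI[of _ v], rule exI[of _ top_vec], rule exI[of _ 0], rule exI[of _ 0])
        (use hp hh W_0 W.base V0 homog_0 zero in \<open>simp_all only: add_0_left add_0_right simp_thms\<close>)
  next
    case one
    have two: "1 + 1 + x = x" for x :: bit by (cases x) simp_all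
    show ?thesis
      by (rule exI[of _ 0], rule exI[of _ 0], rule exI[of _ v], rule exI[of _ top_vec])
        (use hp hh W_0 W.base V0 homog_0 one in \<open>simp_all only: add_0_left add_0_right simp_thms two\<close>)
  qed
next
  case (add u f u' f')
  from add.IH obtain u0 f0 u1 f1 u0' f0' u1' f1' where
    1: "(u0, f0) \<in> W" "(u1, f1) \<in> W" "u = u0 + u1" "f = f0 + f1" "u0 \<in> V 0" "u1 \<in> V 1"
      "homog mode_par (p + lsum mode_par (top_cfg m n l)) f0" "homog mode_par (1 + p + lsum mode_par (top_cfg m n l)) f1" and
    2: "(u0', f0') \<in> W" "(u1', f1') \<in> W" "u' = u0' + u1'" "f' = f0' + f1'" "u0' \<in> V 0" "u1' \<in> V 1"
      "homog mode_par (p + lsum mode_par (top_cfg m n l)) f0'" "homog mode_par (1 + p + lsum mode_par (top_cfg m n l)) f1'"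
    by blast
  show ?case
    by (rule exI[of _ "u0 + u0'"], rule exI[of _ "f0 + f0'"], rule exI[of _ "u1 + u1'"], rule exI[of _ "f1 + f1'"])
      (intro conjI W.add 1 2 homog_add subspace_add[OF grading_subspace], simp_all only: 1 2 ac_simps)
next
  case (scl u f s)
  from scl.IH obtain u0 f0 u1 f1 where
    1: "(u0, f0) \<in> W" "(u1, f1) \<in> W" "u = u0 + u1" "f = f0 + f1" "u0 \<in> V 0" "u1 \<in> V 1"
      "homog mode_par (p + lsum mode_par (top_cfg m n l)) f0" "homog mode_par (1 + p + lsum mode_par (top_cfg m n l)) f1"
    by blast
  show ?case
    by (rule exI[of _ "scale s u0"], rule exI[of _ "fscale s f0"], rule exI[of _ "scale s u1"], rule exI[of _ "fscale s f1"])
      (intro conjI W.scl 1 homog_fscale subspace_scale[OF grading_subspace], simp_all only: 1 scale_right_distrib fscale_add)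
next
  case (step u f a b k)
  from step.IH obtain u0 f0 u1 f1 where
    1: "(u0, f0) \<in> W" "(u1, f1) \<in> W" "u = u0 + u1" "f = f0 + f1" "u0 \<in> V 0" "u1 \<in> V 1"
      "homog mode_par (p + lsum mode_par (top_cfg m n l)) f0" "homog mode_par (1 + p + lsum mode_par (top_cfg m n l)) f1"
    by blast
  note ab = step.hyps(2,3)
  have f: "f0 \<in> fin_on (cfgs m n)" "f1 \<in> fin_on (cfgs m n)"
    using charged_sub[OF W_charged[OF 1(1)]] charged_sub[OF W_charged[OF 1(2)]] .
  have W01: "(EV a b k u0, current a b k f0) \<in> W" "(EV a b k u1, current a b k f1) \<in> W"
    using W.step[OF 1(1) ab step.hyps(4)] W.step[OF 1(2) ab step.hyps(4)] .
  have eq: "EV a b k u = EV a b k u0 + EV a b k u1" "current a b k f = current a b k f0 + current a b k f1"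
    unfolding 1(3,4) EV_lin[OF ab] by (rule refl, rule current_add[OF fin_on_cfgs_tame[OF f(1)] fin_on_cfgs_tame[OF f(2)]])
  have VV: "EV a b k u0 \<in> V (parity a + parity b + 0)" "EV a b k u1 \<in> V (parity a + parity b + 1)"
    unfolding EV_def using act_parity[OF rootv_part[OF ab]] 1(5,6) by blast+
  have HH: "homog mode_par (p + lsum mode_par (top_cfg m n l) + (parity a + parity b)) (current a b k f0)"
    "homog mode_par (1 + p + lsum mode_par (top_cfg m n l) + (parity a + parity b)) (current a b k f1)"
    using homog_mode_par_current[OF f(1) 1(7) ab] homog_mode_par_current[OF f(2) 1(8) ab] .
  show ?case
  proof (cases "parity a + parity b")
    case zero
    show ?thesis
      by (rule exI[of _ "EV a b k u0"], rule exI[of _ "current a b k f0"], rule exI[of _ "EV a b k u1"], rule exI[of _ "current a b k f1"])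
        (use W01 eq VV HH zero in \<open>simp_all only: add_0_left add_0_right simp_thms\<close>)
  next
    case one
    have "p + lsum mode_par (top_cfg m n l) + 1 = 1 + p + lsum mode_par (top_cfg m n l)"
      "1 + p + lsum mode_par (top_cfg m n l) + 1 = p + lsum mode_par (top_cfg m n l)"
      by (cases p; cases "lsum mode_par (top_cfg m n l)"; simp)+
    with HH have HH': "homog mode_par (1 + p + lsum mode_par (top_cfg m n l)) (current a b k f0)"
      "homog mode_par (p + lsum mode_par (top_cfg m n l)) (current a b k f1)"
      by (simp_all only: one)
    have "1 + 0 = (1 :: bit)" "1 + 1 = (0 :: bit)" by simp_all
    with VV have VV': "EV a b k u0 \<in> V 1" "EV a b k u1 \<in> V 0"
      by (simp_all only: one)
    show ?thesis
      by (rule exI[of _ "EV a b k u1"], rule exI[of _ "current a b k f1"], rule exI[of _ "EV a b k u0"], rule exI[of _ "current a b k f0"])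
        (intro conjI W01 VV' HH', simp_all only: eq add.commute)
  qed
qed

lemma V_hw: obtains p where "v \<in> V p"
  using hw unfolding highest_weight_vector_def by blast

lemma W_subspace_V: "subspace {u. \<exists>f. (u, f) \<in> W}"
  by (rule subspaceI) (use W_0 W.add W.scl in blast)+

text \<open>\<open>P\<close> selects the Fock component: always true for the projection, equal to 0
  for the kernel.\<close>

lemma W_closed_V:
  assumes S: "subspace S" and "(u, f) \<in> W" "x \<in> glhat m n" "\<And>u' f'. (u', f') \<in> W \<Longrightarrow> P f' \<Longrightarrow> u' \<in> S"
    and P: "P f" "\<And>a b k. a \<in> idxs m n \<Longrightarrow> b \<in> idxs m n \<Longrightarrow> P (current a b k f)" "P (Dop l f)"
  shows "act x u \<in> S"
proof (rule act_closed[OF S assms(4)[OF assms(2) P(1)] assms(3)])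
  show "act (rootv a b k) u \<in> S" if "a \<in> idxs m n" "b \<in> idxs m n" for a b k
    using assms(4)[OF W_current[OF assms(2) that] P(2)[OF that]] by (simp add: EV_def)
  show "act C_elt u \<in> S" unfolding act_C by (rule assms(4)[OF assms(2) P(1)])
  show "act d_elt u \<in> S" by (rule assms(4)[OF W_D[OF assms(2)] P(3)])
qed

lemma W_proj_V: "\<exists>f. (u, f) \<in> W"
proof -
  let ?S = "{u. \<exists>f. (u, f) \<in> W}"
  obtain p where p: "v \<in> V p" by (rule V_hw)
  have "graded_submodule scale m n V act ?S"
    unfolding graded_submodule_def
  proof (intro conjI ballI W_subspace_V)
    fix x u assume x: "x \<in> glhat m n" and "u \<in> ?S"
    then obtain f where "(u, f) \<in> W" by blast
    then show "act x u \<in> ?S"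
      by (rule W_closed_V[OF W_subspace_V _ x, where P = "\<lambda>_. True"]) auto
  next
    fix u assume "u \<in> ?S"
    then obtain f where "(u, f) \<in> W" by blast
    from W_graded[OF p this] show "\<exists>u0\<in>?S \<inter> V 0. \<exists>u1\<in>?S \<inter> V 1. u = u0 + u1" by blast
  qed
  moreover have "v \<in> ?S" using W.base by blast
  ultimately have "?S = UNIV" using submodule_UNIV v_nonzero by blast
  then show ?thesis by blast
qed

lemma W_kernel_V: "(u, 0) \<in> W \<Longrightarrow> u = 0"
proof -
  let ?S = "{u. (u, 0) \<in> W}"
  obtain p where p: "v \<in> V p" by (rule V_hw)
  have S: "subspace ?S"
  proof (rule subspaceI)
    show "0 \<in> ?S" by (rule CollectI) (rule W_0)
    show "x + y \<in> ?S" if "x \<in> ?S" "y \<in> ?S" for x y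
      using W.add[of x 0 y 0] that by (simp only: mem_Collect_eq add_0_left)
    show "scale c x \<in> ?S" if "x \<in> ?S" for c x
      using W.scl[of x 0 c] that by (simp only: mem_Collect_eq fscale_simps)
  qed
  have "graded_submodule scale m n V act ?S"
    unfolding graded_submodule_def
  proof (intro conjI ballI S)
    fix x u assume x: "x \<in> glhat m n" and "u \<in> ?S"
    from this(2) have u: "(u, 0) \<in> W" by (rule CollectD)
    show "act x u \<in> ?S"
    proof (rule W_closed_V[OF S u x, where P = "\<lambda>f. f = 0"])
      show "u' \<in> ?S" if "(u', f') \<in> W" "f' = 0" for u' f' using that by (simp only: mem_Collect_eq)
    qed (simp_all only: current_0 Dop_zero)
  next
    fix u assume "u \<in> ?S"
    then have "(u, 0) \<in> W" by (rule CollectD)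
    from W_graded[OF p this] obtain u0 f0 u1 f1 where
      1: "(u0, f0) \<in> W" "(u1, f1) \<in> W" "u = u0 + u1" "0 = f0 + f1" "u0 \<in> V 0" "u1 \<in> V 1"
      and h: "homog mode_par (p + lsum mode_par (top_cfg m n l)) f0" "homog mode_par (1 + p + lsum mode_par (top_cfg m n l)) f1"
      by blast
    have "p + lsum mode_par (top_cfg m n l) \<noteq> 1 + p + lsum mode_par (top_cfg m n l)"
      by (cases "p"; cases "lsum mode_par (top_cfg m n l)") simp_all
    \<comment> \<open>The Fock components have different parities and add up to 0, so each of them
      vanishes.\<close>
    from homog_disjoint[OF h this 1(4)[symmetric]] have "u0 \<in> ?S" "u1 \<in> ?S"
      using 1(1,2) by (simp_all only: mem_Collect_eq)
    then show "\<exists>u0\<in>?S \<inter> V 0. \<exists>u1\<in>?S \<inter> V 1. u = u0 + u1" using 1 by blast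
  qed
  moreover have "?S \<noteq> UNIV" using W_top(1)[of v 0] by blast
  ultimately have "?S = {0}" by (rule submodule_zero)
  then show "(u, 0) \<in> W \<Longrightarrow> u = 0" by blast
qed

lemma W_subspace_F: "fock.subspace {f. \<exists>u. (u, f) \<in> W}"
  by (rule fock.subspaceI) (use W_0 W.add W.scl in blast)+

lemma W_proj_F: assumes "f \<in> charged" shows "\<exists>u. (u, f) \<in> W"
proof -
  let ?S = "{f. \<exists>u. (u, f) \<in> W}"
  have "?S = charged"
  proof (rule fock_irreducible[OF mn W_subspace_F])
    show "?S \<subseteq> charged" using W_charged by blast
    have "top_vec \<in> ?S" using W.base by blast
    then show "?S \<noteq> {0}" using fdelta_nonzero by blast
    show "current a b k f \<in> ?S" if "f \<in> ?S" "a \<in> idxs m n" "b \<in> idxs m n" for f a b k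
      using that W_current by blast
  qed
  then show ?thesis using assms by blast
qed

lemma W_kernel_F: "(0, f) \<in> W \<Longrightarrow> f = 0"
proof -
  let ?S = "{f. (0, f) \<in> W}"
  have S: "fock.subspace ?S"
  proof (rule fock.subspaceI)
    show "0 \<in> ?S" by (rule CollectI) (rule W_0)
    show "x + y \<in> ?S" if "x \<in> ?S" "y \<in> ?S" for x y
      using W.add[of 0 x 0 y] that by (simp only: mem_Collect_eq add_0_left)
    show "fscale c x \<in> ?S" if "x \<in> ?S" for c x
      using W.scl[of 0 x c] that by (simp only: mem_Collect_eq scale_zero_right)
  qed
  have "?S = {0}"
  proof (rule ccontr)
    assume "?S \<noteq> {0}"
    then have "?S = charged"
    proof (rule fock_irreducible[OF mn S, rotated])
      show "?S \<subseteq> charged" using W_charged by blast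
      show "current a b k f \<in> ?S" if "f \<in> ?S" "a \<in> idxs m n" "b \<in> idxs m n" for f a b k
        using W_current[of 0 f a b k] that by (simp only: mem_Collect_eq EV_lin)
    qed
    then have "top_vec \<in> ?S" using fdelta_fin_on[OF top_cfg_ch[OF mn, of l]] by (simp only:)
    then show False using W_top(2)[of 0 top_vec] by blast
  qed
  then show "(0, f) \<in> W \<Longrightarrow> f = 0" by blast
qed

lemma W_sum: "(\<And>i. i \<in> I \<Longrightarrow> (g i, h i) \<in> W) \<Longrightarrow> (sum g I, sum h I) \<in> W"
proof (induction I rule: infinite_finite_induct)
  case (insert i I)
  then show ?case unfolding sum.insert[OF insert(1,2)] by (intro W.add) auto
next
  case (infinite A)
  show ?case unfolding sum.infinite[OF infinite(1)] by (rule W_0)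
next
  case empty
  show ?case unfolding sum.empty by (rule W_0)
qed

lemma W_cartan:
  assumes W: "(u, fdelta c) \<in> W" and h: "h \<in> cartan_hd m n"
  shows "(act h u, fscale (cwt l c h) (fdelta c)) \<in> W"
proof -
  obtain X e d where X: "h = (X, e, d)" by (metis prod.exhaust)
  have e: "e = 0" using h by (simp add: X cartan_hd_def)
  have c: "c \<in> cfgs m n"
  proof -
    have "fdelta c \<in> fin_on (cfgs m n)" by (rule charged_sub, rule W_charged, rule W)
    then show ?thesis by (auto simp: fin_on_def fdelta_def split: if_splits)
  qed
  let ?n = "\<lambda>a. lsum (acount a) c"
  have y: "glhat_scale (X 0 a a) (rootv a a 0) \<in> glhat m n" if "a \<in> idxs m n" for a
    using that by (intro glhat_scale_mem rootv_glhat)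
  have "act h u = (\<Sum>a\<in>idxs m n. act (glhat_scale (X 0 a a) (rootv a a 0)) u) + act (glhat_scale d d_elt) u"
    unfolding X
    by (subst cartan_expand[OF h[unfolded X]])
      (subst act_add[OF glhat_sum[OF y] glhat_scale_mem[OF d_glhat]], assumption, simp only: act_sum[OF y])
  also have "\<dots> = (\<Sum>a\<in>idxs m n. scale (X 0 a a) (EV a a 0 u)) + scale d (act d_elt u)"
    by (simp add: act_scale d_glhat EV_def)
  finally have 1: "act h u = \<dots>" .
  have cw: "cwt l c h = (\<Sum>a\<in>idxs m n. X 0 a a * ?n a) + d * (lsum mode_energy c + of_int \<bar>l\<bar> / 2)"
    unfolding cwt_eq[OF c] by (simp add: X awt_def wt_delta_def)
  have En: "current a a 0 (fdelta c) = fscale (?n a) (fdelta c)" for a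
    unfolding current_diag[OF fdelta_fin_on[OF c]] fdiag_fdelta acount_def[abs_def] ..
  have Dn: "Dop l (fdelta c) = fscale (lsum mode_energy c + of_int \<bar>l\<bar> / 2) (fdelta c)"
    unfolding Dop_def fdiag_fdelta fscale_left ..
  have fs: "(\<Sum>a\<in>I. fscale (z a) f) = fscale (\<Sum>a\<in>I. z a) f" for I :: "idx set" and z f
    by (rule ext) (simp add: sum_app fscale_def sum_distrib_right)
  have 2: "fscale (cwt l c h) (fdelta c) =
     (\<Sum>a\<in>idxs m n. fscale (X 0 a a) (current a a 0 (fdelta c))) + fscale d (Dop l (fdelta c))"
    unfolding En Dn fscale_simps fs cw by (rule fscale_left)
  show ?thesis unfolding 1 2
    by (intro W.add W_sum W.scl W_current[OF W] W_D[OF W])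
qed

text \<open>\<open>W\<close> is the graph of a linear isomorphism and \<open>b c\<close> is the
  partner of \<open>fdelta c\<close>; every relation is transported through the trivial kernels on
  the two sides.\<close>

theorem weight_basis:
  obtains b where "inj_on b (cfgs_ch m n l)" "independent (b ` cfgs_ch m n l)" "span (b ` cfgs_ch m n l) = UNIV"
    "\<And>c h. c \<in> cfgs_ch m n l \<Longrightarrow> h \<in> cartan_hd m n \<Longrightarrow> act h (b c) = scale (cwt l c h) (b c)"
proof -
  have "\<forall>c\<in>cfgs_ch m n l. \<exists>u. (u, fdelta c) \<in> W"
    using W_proj_F fdelta_fin_on by blast
  then obtain b where b: "\<And>c. c \<in> cfgs_ch m n l \<Longrightarrow> (b c, fdelta c) \<in> W" by metis
  have comb: "(\<Sum>c\<in>T. scale (x c) (b c), \<Sum>c\<in>T. fscale (x c) (fdelta c)) \<in> W" if "T \<subseteq> cfgs_ch m n l" for T x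
    using that b by (intro W_sum W.scl) blast
  have inj: "inj_on b (cfgs_ch m n l)"
  proof (rule inj_onI)
    fix c c' assume c: "c \<in> cfgs_ch m n l" "c' \<in> cfgs_ch m n l" "b c = b c'"
    have "(0, fdelta c - fdelta c') \<in> W" using W_diff[OF b[OF c(1)] b[OF c(2)]] c(3) by simp
    then have "fdelta c - fdelta c' = 0" by (rule W_kernel_F)
    then have "(fdelta c - fdelta c') c = 0" by simp
    then show "c = c'" by (auto simp: fdelta_def split: if_splits)
  qed
  have ind: "independent (b ` cfgs_ch m n l)"
    unfolding independent_explicit_finite_subsets
  proof (intro allI impI ballI)
    fix S x u assume S: "S \<subseteq> b ` cfgs_ch m n l" "finite S" and 0: "(\<Sum>u\<in>S. scale (x u) u) = 0" and u: "u \<in> S"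
    obtain T where T: "T \<subseteq> cfgs_ch m n l" "S = b ` T" using S(1) by (auto simp: subset_image_iff)
    have injT: "inj_on b T" by (rule inj_on_subset[OF inj T(1)])
    have finT: "finite T" using S(2) finite_imageD[OF _ injT] by (simp add: T(2))
    have "(\<Sum>c\<in>T. scale (x (b c)) (b c)) = 0"
      using 0 unfolding T(2) by (simp add: sum.reindex[OF injT])
    then have "(0, \<Sum>c\<in>T. fscale (x (b c)) (fdelta c)) \<in> W" using comb[OF T(1), of "\<lambda>c. x (b c)"] by (simp only:)
    then have z: "(\<Sum>c\<in>T. fscale (x (b c)) (fdelta c)) = 0" by (rule W_kernel_F)
    obtain c where c: "c \<in> T" "u = b c" using u T(2) by blast
    have "(\<Sum>c'\<in>T. fscale (x (b c')) (fdelta c')) c = (\<Sum>c'\<in>T. if c' = c then x (b c) else 0)"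
      unfolding sum_app by (rule sum.cong) (auto simp: fscale_def fdelta_def)
    then show "x u = 0" using c finT unfolding z by simp
  qed
  have spn: "u \<in> span (b ` cfgs_ch m n l)" for u
  proof -
    obtain f where f: "(u, f) \<in> W" using W_proj_V by blast
    have charged: "f \<in> charged" by (rule W_charged[OF f])
    let ?T = "{c. f c \<noteq> 0}"
    have T: "?T \<subseteq> cfgs_ch m n l" using charged by (simp add: fin_on_def)
    have "(u - (\<Sum>c\<in>?T. scale (f c) (b c)), f - (\<Sum>c\<in>?T. fscale (f c) (fdelta c))) \<in> W"
      by (rule W_diff[OF f comb[OF T]])
    moreover have "f - (\<Sum>c\<in>?T. fscale (f c) (fdelta c)) = 0"
      using fin_on_expand[OF charged] by (simp only: right_minus_eq)
    ultimately have "(u - (\<Sum>c\<in>?T. scale (f c) (b c)), 0) \<in> W" by (simp only:)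
    from W_kernel_V[OF this] have u: "u = (\<Sum>c\<in>?T. scale (f c) (b c))" by simp
    show ?thesis
      unfolding u by (rule span_sum, rule span_scale, rule span_base, rule imageI) (use T in blast)
  qed
  have wt: "act h (b c) = scale (cwt l c h) (b c)" if "c \<in> cfgs_ch m n l" "h \<in> cartan_hd m n" for c h
  proof -
    have "(act h (b c) - scale (cwt l c h) (b c), fscale (cwt l c h) (fdelta c) - fscale (cwt l c h) (fdelta c)) \<in> W"
      by (rule W_diff[OF W_cartan[OF b[OF that(1)] that(2)] W.scl[OF b[OF that(1)]]])
    then have "(act h (b c) - scale (cwt l c h) (b c), 0) \<in> W" by (simp only: diff_self)
    from W_kernel_V[OF this] show ?thesis by simp
  qed
  have "span (b ` cfgs_ch m n l) = UNIV" using spn by blast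
  then show ?thesis using that[OF inj ind _ wt] by blast
qed

end

section \<open>Generating functions of weighted sets\<close>

text \<open>The exponent of \<open>q\<close>, with the sign coming from q = e^-delta.\<close>

definition deg :: "weight \<Rightarrow> real" where
  "deg \<eta> = - Re (\<eta> d_elt)"

lemma deg_add: "deg (\<eta> + \<theta>) = deg \<eta> + deg \<theta>"
  and deg_0 [simp]: "deg 0 = 0"
  by (simp_all add: deg_def)

lemma deg_sum: "deg (sum f I) = (\<Sum>i\<in>I. deg (f i))"
  using sum_comp_morphism[of deg f I] deg_add by (simp add: o_def)

lemma deg_q_wt: "deg (q_wt s) = s"
  by (simp add: deg_def q_wt_def wt_scale_def wt_delta_def d_elt_def)

definition gf :: "'a set \<Rightarrow> ('a \<Rightarrow> weight) \<Rightarrow> fsum" where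
  "gf S w = (\<lambda>\<eta>. card {s \<in> S. w s = \<eta>})"

text \<open>Finiteness below each degree makes every coefficient a genuine count; nonnegativity
  carries this over to products, as neither factor can then exceed the total degree.\<close>

definition tame_set :: "'a set \<Rightarrow> ('a \<Rightarrow> weight) \<Rightarrow> bool" where
  "tame_set S w \<longleftrightarrow> (\<forall>s\<in>S. 0 \<le> deg (w s)) \<and> (\<forall>r. finite {s \<in> S. deg (w s) \<le> r})"

lemma tame_set_subset:
  assumes "tame_set S w" "T \<subseteq> S" shows "tame_set T w"
proof -
  have "{s \<in> T. deg (w s) \<le> r} \<subseteq> {s \<in> S. deg (w s) \<le> r}" for r using assms(2) by blast
  moreover have "finite {s \<in> S. deg (w s) \<le> r}" for r using assms(1) unfolding tame_set_def by blast
  ultimately have "finite {s \<in> T. deg (w s) \<le> r}" for r by (rule finite_subset)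
  then show ?thesis using assms unfolding tame_set_def by blast
qed

lemma tame_set_fibre: "tame_set S w \<Longrightarrow> finite {s \<in> S. w s = \<eta>}"
  unfolding tame_set_def by (rule finite_subset[of _ "{s \<in> S. deg (w s) \<le> deg \<eta>}"]) auto

lemma tame_set_times:
  assumes "tame_set S w" "tame_set T u"
  shows "tame_set (S \<times> T) (\<lambda>(s, t). w s + u t)"
  unfolding tame_set_def
proof (intro conjI allI)
  show "\<forall>x\<in>S \<times> T. 0 \<le> deg (case x of (s, t) \<Rightarrow> w s + u t)"
    using assms by (auto simp: tame_set_def deg_add)
  fix r
  show "finite {x \<in> S \<times> T. deg (case x of (s, t) \<Rightarrow> w s + u t) \<le> r}"
  proof (rule finite_subset)
    show "{x \<in> S \<times> T. deg (case x of (s, t) \<Rightarrow> w s + u t) \<le> r}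
        \<subseteq> {s \<in> S. deg (w s) \<le> r} \<times> {t \<in> T. deg (u t) \<le> r}"
      using assms by (force simp: tame_set_def deg_add)
    show "finite ({s \<in> S. deg (w s) \<le> r} \<times> {t \<in> T. deg (u t) \<le> r})"
      using assms by (auto simp: tame_set_def)
  qed
qed

lemma fmult_gf:
  assumes "tame_set S w" "tame_set T u"
  shows "fmult (gf S w) (gf T u) = gf (S \<times> T) (\<lambda>(s, t). w s + u t)"
proof
  fix \<eta>
  let ?P = "{x \<in> S \<times> T. (case x of (s, t) \<Rightarrow> w s + u t) = \<eta>}"
  let ?k = "\<lambda>x. w (fst x)"
  have fin: "finite ?P" by (rule tame_set_fibre[OF tame_set_times[OF assms]])
  have fib: "{x \<in> ?P. ?k x = \<alpha>} = {s \<in> S. w s = \<alpha>} \<times> {t \<in> T. u t = \<eta> - \<alpha>}" for \<alpha>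
    by (auto simp: algebra_simps)
  have prod: "card {x \<in> ?P. ?k x = \<alpha>} = gf S w \<alpha> * gf T u (\<eta> - \<alpha>)" for \<alpha>
    unfolding fib gf_def by (rule card_cartesian_product)
  have "{\<alpha>. gf S w \<alpha> * gf T u (\<eta> - \<alpha>) \<noteq> 0} \<subseteq> ?k ` ?P"
  proof
    fix \<alpha> assume "\<alpha> \<in> {\<alpha>. gf S w \<alpha> * gf T u (\<eta> - \<alpha>) \<noteq> 0}"
    then have "card {x \<in> ?P. ?k x = \<alpha>} \<noteq> 0" unfolding prod by simp
    then have "{x \<in> ?P. ?k x = \<alpha>} \<noteq> {}" by (metis card.empty)
    then show "\<alpha> \<in> ?k ` ?P" by blast
  qed
  then have "fmult (gf S w) (gf T u) \<eta> = (\<Sum>\<alpha>\<in>?k ` ?P. gf S w \<alpha> * gf T u (\<eta> - \<alpha>))"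
    unfolding fmult_def by (intro Sum_any.expand_superset) (use fin in auto)
  also have "\<dots> = (\<Sum>\<alpha>\<in>?k ` ?P. \<Sum>x\<in>{x \<in> ?P. ?k x = \<alpha>}. 1)"
    by (rule sum.cong) (simp_all only: prod[symmetric] card_eq_sum)
  also have "\<dots> = card ?P" unfolding card_eq_sum by (rule sum.image_gen[OF fin, symmetric])
  finally show "fmult (gf S w) (gf T u) \<eta> = gf (S \<times> T) (\<lambda>(s, t). w s + u t) \<eta>"
    unfolding gf_def .
qed

lemma fmult_fexp: "fmult (fexp w) G \<eta> = G (\<eta> - w)"
proof -
  have "fmult (fexp w) G \<eta> = (\<Sum>\<alpha>\<in>{w}. fexp w \<alpha> * G (\<eta> - \<alpha>))"
    unfolding fmult_def by (rule Sum_any.expand_superset) (auto simp: fexp_def)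
  then show ?thesis by (simp add: fexp_def)
qed

lemma gf_bij:
  assumes "bij_betw h S T" "\<And>s. s \<in> S \<Longrightarrow> u (h s) = w s"
  shows "gf S w = gf T u"
proof
  fix \<eta>
  have "bij_betw h {s \<in> S. w s = \<eta>} {t \<in> T. u t = \<eta>}"
    by (rule bij_betw_subset[OF assms(1)]) (use assms bij_betw_imp_surj_on[OF assms(1)] in force)+
  then show "gf S w \<eta> = gf T u \<eta>" unfolding gf_def by (rule bij_betw_same_card)
qed

lemma gf_fibres:
  assumes "tame_set S w"
  shows "gf S w \<eta> = Sum_any (\<lambda>i. gf {s \<in> S. k s = i} w \<eta>)"
proof -
  let ?P = "{s \<in> S. w s = \<eta>}"
  have fin: "finite ?P" by (rule tame_set_fibre[OF assms])
  have fib: "gf {s \<in> S. k s = i} w \<eta> = card {s \<in> ?P. k s = i}" for i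
    unfolding gf_def by (rule arg_cong[where f = card]) auto
  have "{i. gf {s \<in> S. k s = i} w \<eta> \<noteq> 0} \<subseteq> k ` ?P"
  proof
    fix i assume "i \<in> {i. gf {s \<in> S. k s = i} w \<eta> \<noteq> 0}"
    then have "card {s \<in> ?P. k s = i} \<noteq> 0" unfolding fib by (rule CollectD)
    then have "{s \<in> ?P. k s = i} \<noteq> {}" by (metis card.empty)
    then show "i \<in> k ` ?P" by blast
  qed
  then have "Sum_any (\<lambda>i. gf {s \<in> S. k s = i} w \<eta>) = (\<Sum>i\<in>k ` ?P. gf {s \<in> S. k s = i} w \<eta>)"
    by (intro Sum_any.expand_superset) (use fin in auto)
  also have "\<dots> = (\<Sum>i\<in>k ` ?P. \<Sum>s\<in>{s \<in> ?P. k s = i}. 1)"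
    unfolding fib card_eq_sum ..
  also have "\<dots> = card ?P" unfolding card_eq_sum by (rule sum.image_gen[OF fin, symmetric])
  finally show ?thesis unfolding gf_def by (rule sym)
qed

section \<open>Multisets and finite sets of variables\<close>

definition msum :: "(nat \<Rightarrow> weight) \<Rightarrow> nat multiset \<Rightarrow> weight" where
  "msum x A = (\<Sum>t\<in>#A. x t)"

lemma deg_msum: "deg (msum x A) = (\<Sum>t\<in>#A. deg (x t))"
proof (induction A)
  case empty
  show ?case unfolding msum_def image_mset_empty sum_mset.empty by (rule deg_0)
next
  case (add t A)
  then show ?case
    unfolding msum_def image_mset_add_mset sum_mset.add_mset deg_add by (simp only:)
qed

lemma msum_mset: "msum x (mset xs) = sum_list (map x xs)"
  unfolding msum_def by (metis mset_map sum_mset_sum_list)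

lemma deg_qvars:
  assumes "\<And>j. deg (u j) = 0"
  shows "deg (qvars u r t) = real (t div r) + 1/2"
  by (simp add: qvars_def deg_add deg_q_wt assms)

lemma div_le_bound:
  assumes "1 \<le> (r::nat)" "real (t div r) \<le> R"
  shows "t < r * (nat \<lceil>R\<rceil> + 1)"
proof -
  have "t div r \<le> nat \<lceil>R\<rceil>" using assms(2) by linarith
  then have "t div r < nat \<lceil>R\<rceil> + 1" by simp
  then show ?thesis using assms(1) by (simp add: div_less_iff_less_mult mult.commute)
qed

text \<open>Every variable has degree at least 1/2, so degree \<open>R\<close> bounds the size by
  2R, and only \<open>r\<close> variables share a given degree.\<close>

lemma tame_multisets:
  assumes r: "1 \<le> r" and u: "\<And>j. deg (u j) = 0"
  shows "tame_set UNIV (msum (qvars u r))"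
  unfolding tame_set_def
proof (intro conjI ballI allI)
  note d = deg_qvars[where u = u and r = r, OF u]
  fix A show "0 \<le> deg (msum (qvars u r) A)"
    unfolding deg_msum d by (induction A) auto
next
  note d = deg_qvars[where u = u and r = r, OF u]
  fix R :: real
  let ?M = "r * (nat \<lceil>R\<rceil> + 1)" and ?K = "nat \<lceil>2 * R\<rceil>"
  have nonneg: "0 \<le> (\<Sum>t\<in>#A. real (t div r) + 1/2)" for A by (induction A) auto
  have "A \<in> mset ` {xs. set xs \<subseteq> {..<?M} \<and> length xs \<le> ?K}" if "deg (msum (qvars u r) A) \<le> R" for A
  proof -
    have le: "(\<Sum>t\<in>#A. real (t div r) + 1/2) \<le> R" using that unfolding deg_msum d .
    have "real (size A) / 2 \<le> (\<Sum>t\<in>#A. real (t div r) + 1/2)" by (induction A) auto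
    then have size: "size A \<le> ?K" using le by linarith
    have "t < ?M" if "t \<in># A" for t
    proof (rule div_le_bound[OF r])
      obtain B where "A = add_mset t B" using \<open>t \<in># A\<close> by (metis insert_DiffM)
      then have "real (t div r) + 1/2 + (\<Sum>t\<in>#B. real (t div r) + 1/2) \<le> R" using le by simp
      then show "real (t div r) \<le> R" using nonneg[of B] by linarith
    qed
    moreover obtain xs where "mset xs = A" by (metis ex_mset)
    ultimately show ?thesis using size by (intro image_eqI[of _ _ xs]) auto
  qed
  then have "{A \<in> UNIV. deg (msum (qvars u r) A) \<le> R} \<subseteq> mset ` {xs. set xs \<subseteq> {..<?M} \<and> length xs \<le> ?K}"
    by blast
  then show "finite {A \<in> UNIV. deg (msum (qvars u r) A) \<le> R}"
    by (rule finite_subset) (intro finite_imageI finite_lists_length_le finite_lessThan)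
qed

lemma tame_subsets:
  assumes r: "1 \<le> r" and u: "\<And>j. deg (u j) = 0"
  shows "tame_set {B. finite B} (sum (qvars u r))"
  unfolding tame_set_def
proof (intro conjI ballI allI)
  note d = deg_qvars[where u = u and r = r, OF u]
  fix B show "0 \<le> deg (sum (qvars u r) B)"
    unfolding deg_sum d by (intro sum_nonneg) simp
next
  note d = deg_qvars[where u = u and r = r, OF u]
  fix R :: real
  let ?M = "r * (nat \<lceil>R\<rceil> + 1)"
  have "B \<subseteq> {..<?M}" if B: "finite B" "deg (sum (qvars u r) B) \<le> R" for B
  proof
    fix t assume t: "t \<in> B"
    have "real (t div r) + 1/2 \<le> (\<Sum>t\<in>B. real (t div r) + 1/2)"
      by (rule member_le_sum[OF t]) (use B in auto)
    also have "\<dots> \<le> R" using B(2) unfolding deg_sum d .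
    finally show "t \<in> {..<?M}" using div_le_bound[OF r, of t R] by simp
  qed
  then have "{B \<in> {B. finite B}. deg (sum (qvars u r) B) \<le> R} \<subseteq> Pow {..<?M}" by blast
  then show "finite {B \<in> {B. finite B}. deg (sum (qvars u r) B) \<le> R}"
    by (rule finite_subset) simp
qed

section \<open>Hook Schur functions of one-row partitions\<close>

text \<open>Here \<open>e\<close> enumerates the cells of a row or of a column, so one statement
  serves both shapes; tableaux are extensional, hence \<open>undefined\<close> outside the
  diagram.\<close>

lemma bij_tableau_list:
  assumes "inj_on e {..<k}"
  shows "bij_betw (\<lambda>T. map (\<lambda>j. T (e j)) [0..<k]) {T \<in> e ` {..<k} \<rightarrow>\<^sub>E UNIV. P (map (\<lambda>j. T (e j)) [0..<k])}
    {xs. length xs = k \<and> P xs}"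
proof (rule bij_betw_byWitness[where f' = "\<lambda>xs d. if d \<in> e ` {..<k} then xs ! inv_into {..<k} e d else undefined"])
  let ?f = "\<lambda>T. map (\<lambda>j. T (e j)) [0..<k]"
    and ?g = "\<lambda>xs d. if d \<in> e ` {..<k} then xs ! inv_into {..<k} e d else undefined"
  have fg: "?f (?g xs) = xs" if "length xs = k" for xs :: "'b list"
    using that assms by (intro nth_equalityI) auto
  show "\<forall>T\<in>{T \<in> e ` {..<k} \<rightarrow>\<^sub>E UNIV. P (?f T)}. ?g (?f T) = T"
  proof
    fix T :: "'a \<Rightarrow> 'b" assume T: "T \<in> {T \<in> e ` {..<k} \<rightarrow>\<^sub>E UNIV. P (?f T)}"
    show "?g (?f T) = T"
    proof
      fix d
      show "?g (?f T) d = T d"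
      proof (cases "d \<in> e ` {..<k}")
        case True
        then have "inv_into {..<k} e d \<in> {..<k}" "e (inv_into {..<k} e d) = d"
          using inv_into_into[of d e "{..<k}"] f_inv_into_f[of d e "{..<k}"] by auto
        then show ?thesis using True by simp
      next
        case False
        then have "T d = undefined" using T PiE_arb by fastforce
        then show ?thesis using False by (simp only: if_False)
      qed
    qed
  qed
  show "\<forall>xs\<in>{xs. length xs = k \<and> P xs}. ?f (?g xs) = xs" using fg by blast
  show "?f ` {T \<in> e ` {..<k} \<rightarrow>\<^sub>E UNIV. P (?f T)} \<subseteq> {xs. length xs = k \<and> P xs}" by auto
  show "?g ` {xs. length xs = k \<and> P xs} \<subseteq> {T \<in> e ` {..<k} \<rightarrow>\<^sub>E UNIV. P (?f T)}"
  proof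
    fix T assume "T \<in> ?g ` {xs. length xs = k \<and> P xs}"
    then obtain xs where xs: "T = ?g xs" "length xs = k" "P xs" by blast
    have "P (?f T)" unfolding xs(1) fg[OF xs(2)] by (rule xs(3))
    moreover have "T \<in> e ` {..<k} \<rightarrow>\<^sub>E UNIV" unfolding xs(1) by auto
    ultimately show "T \<in> {T \<in> e ` {..<k} \<rightarrow>\<^sub>E UNIV. P (?f T)}" by blast
  qed
qed

lemma bij_mset_sorted: "bij_betw mset {xs :: nat list. length xs = k \<and> sorted xs} {A. size A = k}"
  by (rule bij_betw_byWitness[where f' = sorted_list_of_multiset])
    (auto simp: sorted_sort_id simp flip: size_mset)

lemma bij_set_sorted:
  "bij_betw set {xs :: nat list. length xs = k \<and> sorted_wrt (<) xs} {B. finite B \<and> card B = k}"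
  by (rule bij_betw_byWitness[where f' = sorted_list_of_set])
    (auto simp: strict_sorted_iff distinct_card sorted_list_of_set.idem_if_sorted_distinct)

lemma skew_diagram_row: "skew_diagram (one_row k) (\<lambda>_. 0) = (\<lambda>j. (0, j)) ` {..<k}"
  by (auto simp: skew_diagram_def one_row_def split: if_splits)

lemma conj_one_row: "conj_partition (one_row k) = (\<lambda>j. if j < k then 1 else 0)"
proof
  fix j
  have "{i. j < one_row k i} = (if j < k then {0} else {})"
    by (auto simp: one_row_def)
  then show "conj_partition (one_row k) j = (if j < k then 1 else 0)"
    by (simp add: conj_partition_def)
qed

lemma skew_diagram_column:
  assumes "i \<le> k"
  shows "skew_diagram (conj_partition (one_row k)) (conj_partition (one_row i)) = (\<lambda>j. (i + j, 0)) ` {..<k - i}"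
proof -
  have "(r, c) \<in> skew_diagram (conj_partition (one_row k)) (conj_partition (one_row i)) \<longleftrightarrow>
      (r, c) \<in> (\<lambda>j. (i + j, 0)) ` {..<k - i}" for r c
  proof -
    have "(r, c) \<in> (\<lambda>j. (i + j, 0)) ` {..<k - i} \<longleftrightarrow> i \<le> r \<and> r < k \<and> c = 0"
      using assms by (auto simp: image_iff intro!: bexI[of _ "r - i"])
    then show ?thesis by (auto simp: skew_diagram_def conj_one_row)
  qed
  then show ?thesis by auto
qed

lemma sorted_wrt_map_upt:
  "sorted_wrt R (map f [0..<k]) \<longleftrightarrow> (\<forall>j j'. j < j' \<and> j' < k \<longrightarrow> R (f j) (f j'))"
  by (auto simp: sorted_wrt_iff_nth_less)

lemma ssyt_row:
  "ssyt (one_row k) (\<lambda>_. 0) =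
    {T \<in> (\<lambda>j. (0, j)) ` {..<k} \<rightarrow>\<^sub>E UNIV. sorted (map (\<lambda>j. T (0, j)) [0..<k])}"
  unfolding ssyt_def skew_diagram_row sorted_wrt_map_upt by auto

lemma ssyt_column:
  assumes "i \<le> k"
  shows "ssyt (conj_partition (one_row k)) (conj_partition (one_row i)) =
    {T \<in> (\<lambda>j. (i + j, 0)) ` {..<k - i} \<rightarrow>\<^sub>E UNIV. sorted_wrt (<) (map (\<lambda>j. T (i + j, 0)) [0..<k - i])}"
  unfolding ssyt_def skew_diagram_column[OF assms] sorted_wrt_map_upt by fastforce

lemma sum_tableau:
  fixes x :: "'b \<Rightarrow> weight"
  assumes "inj_on e {..<k}"
  shows "(\<Sum>b\<in>e ` {..<k}. x (T b)) = sum_list (map x (map (\<lambda>j. T (e j)) [0..<k]))"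
proof -
  have "(\<Sum>b\<in>e ` {..<k}. x (T b)) = (\<Sum>j<k. x (T (e j)))"
    by (subst sum.reindex[OF assms]) (simp only: o_def)
  also have "\<dots> = sum_list (map (\<lambda>j. x (T (e j))) [0..<k])"
    unfolding interv_sum_list_conv_sum_set_nat set_upt by (simp only: atLeast0LessThan)
  finally show ?thesis by (simp only: map_map o_def)
qed

text \<open>The complete symmetric function: a weakly increasing row is a multiset.\<close>

lemma schur_row: "schur (one_row k) x = gf {A. size A = k} (msum x)"
proof -
  have inj: "inj_on (\<lambda>j. (0 :: nat, j :: nat)) {..<k}" by (simp add: inj_on_def)
  have "schur (one_row k) x = gf (ssyt (one_row k) (\<lambda>_. 0)) (\<lambda>T. \<Sum>b\<in>skew_diagram (one_row k) (\<lambda>_. 0). x (T b))"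
    unfolding schur_def skew_schur_def gf_def ..
  also have "\<dots> = gf {xs. length xs = k \<and> sorted xs} (\<lambda>xs. sum_list (map x xs))"
    unfolding ssyt_row skew_diagram_row
    by (rule gf_bij[OF bij_tableau_list[OF inj]]) (rule sum_tableau[OF inj, symmetric])
  also have "\<dots> = gf {A. size A = k} (msum x)"
    by (rule gf_bij[OF bij_mset_sorted]) (rule msum_mset)
  finally show ?thesis .
qed

text \<open>The elementary symmetric function: what is left of the column is strictly increasing,
  that is, a set.\<close>

lemma skew_schur_column:
  assumes "i \<le> k"
  shows "skew_schur (conj_partition (one_row k)) (conj_partition (one_row i)) y = gf {B. finite B \<and> card B = k - i} (sum y)"
proof -
  have inj: "inj_on (\<lambda>j. (i + j, 0 :: nat)) {..<k - i}" by (simp add: inj_on_def)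
  have "skew_schur (conj_partition (one_row k)) (conj_partition (one_row i)) y =
      gf (ssyt (conj_partition (one_row k)) (conj_partition (one_row i)))
        (\<lambda>T. \<Sum>b\<in>skew_diagram (conj_partition (one_row k)) (conj_partition (one_row i)). y (T b))"
    unfolding skew_schur_def gf_def ..
  also have "\<dots> = gf {xs. length xs = k - i \<and> sorted_wrt (<) xs} (\<lambda>xs. sum_list (map y xs))"
    unfolding ssyt_column[OF assms] skew_diagram_column[OF assms]
    by (rule gf_bij[OF bij_tableau_list[OF inj]]) (rule sum_tableau[OF inj, symmetric])
  also have "\<dots> = gf {B. finite B \<and> card B = k - i} (sum y)"
    by (rule gf_bij[OF bij_set_sorted])
      (simp only: mem_Collect_eq strict_sorted_iff sum_list_distinct_conv_sum_set)
  finally show ?thesis .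
qed

lemma partitions_below_row:
  "{\<mu>. is_partition \<mu> \<and> (\<forall>i. \<mu> i \<le> one_row k i)} = one_row ` {..k}"
proof (intro equalityI subsetI)
  fix \<mu> assume "\<mu> \<in> {\<mu>. is_partition \<mu> \<and> (\<forall>i. \<mu> i \<le> one_row k i)}"
  then have le: "\<mu> i \<le> one_row k i" for i by simp
  have "\<mu> = one_row (\<mu> 0)"
  proof
    fix i show "\<mu> i = one_row (\<mu> 0) i" using le[of i] by (auto simp: one_row_def split: if_splits)
  qed
  moreover have "\<mu> 0 \<le> k" using le[of 0] by (simp add: one_row_def)
  ultimately show "\<mu> \<in> one_row ` {..k}" by blast
next
  fix \<mu> assume "\<mu> \<in> one_row ` {..k}"
  then obtain j where j: "\<mu> = one_row j" "j \<le> k" by blast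
  have "finite {i. one_row j i \<noteq> 0}" by (rule finite_subset[of _ "{0}"]) (auto simp: one_row_def)
  moreover have "antimono (one_row j)" by (auto simp: antimono_def one_row_def)
  ultimately show "\<mu> \<in> {\<mu>. is_partition \<mu> \<and> (\<forall>i. \<mu> i \<le> one_row k i)}"
    using j(2) by (auto simp: j(1) is_partition_def one_row_def)
qed

lemma inj_one_row: "inj_on one_row S"
  unfolding inj_on_def one_row_def by (metis (full_types))

definition hook_pairs :: "nat \<Rightarrow> (nat multiset \<times> nat set) set" where
  "hook_pairs k = {(A, B). finite B \<and> size A + card B = k}"

definition pair_wt :: "(nat \<Rightarrow> weight) \<Rightarrow> (nat \<Rightarrow> weight) \<Rightarrow> nat multiset \<times> nat set \<Rightarrow> weight" where
  "pair_wt x y = (\<lambda>(A, B). msum x A + sum y B)"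

lemma tame_pairs:
  assumes "tame_set UNIV (msum x)" "tame_set {B. finite B} (sum y)"
  shows "tame_set (UNIV \<times> {B. finite B}) (pair_wt x y)"
  unfolding pair_wt_def by (rule tame_set_times[OF assms])

text \<open>The defining sum becomes that of h_i(x) e_(k-i)(y), whose terms are the fibres of the
  size of the multiset.\<close>

lemma hook_schur_row:
  assumes "tame_set UNIV (msum x)" "tame_set {B. finite B} (sum y)"
  shows "hook_schur (one_row k) x y = gf (hook_pairs k) (pair_wt x y)"
proof
  fix \<eta>
  have summand: "fmult (schur (one_row i) x) (skew_schur (conj_partition (one_row k)) (conj_partition (one_row i)) y) \<eta>
      = gf {q \<in> hook_pairs k. size (fst q) = i} (pair_wt x y) \<eta>" if "i \<le> k" for i
  proof -
    have "fmult (schur (one_row i) x) (skew_schur (conj_partition (one_row k)) (conj_partition (one_row i)) y)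
        = gf ({A. size A = i} \<times> {B. finite B \<and> card B = k - i}) (pair_wt x y)"
      unfolding schur_row skew_schur_column[OF that] pair_wt_def
      by (rule fmult_gf) (rule tame_set_subset[OF assms(1)], simp, rule tame_set_subset[OF assms(2)], auto)
    also have "{A. size A = i} \<times> {B. finite B \<and> card B = k - i} = {q \<in> hook_pairs k. size (fst q) = i}"
      using that by (auto simp: hook_pairs_def)
    finally show ?thesis by simp
  qed
  have tame: "tame_set (hook_pairs k) (pair_wt x y)"
    by (rule tame_set_subset[OF tame_pairs[OF assms]]) (auto simp: hook_pairs_def)
  have "hook_schur (one_row k) x y \<eta> =
      (\<Sum>i\<le>k. gf {q \<in> hook_pairs k. size (fst q) = i} (pair_wt x y) \<eta>)"
    unfolding hook_schur_def partitions_below_row sum.reindex[OF inj_one_row] o_def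
    by (rule sum.cong[OF refl]) (rule summand, simp)
  also have "\<dots> = Sum_any (\<lambda>i. gf {q \<in> hook_pairs k. size (fst q) = i} (pair_wt x y) \<eta>)"
  proof (rule Sum_any.expand_superset[symmetric])
    show "{i. gf {q \<in> hook_pairs k. size (fst q) = i} (pair_wt x y) \<eta> \<noteq> 0} \<subseteq> {..k}"
    proof
      fix i assume "i \<in> {i. gf {q \<in> hook_pairs k. size (fst q) = i} (pair_wt x y) \<eta> \<noteq> 0}"
      then have "card {s \<in> {q \<in> hook_pairs k. size (fst q) = i}. pair_wt x y s = \<eta>} \<noteq> 0"
        unfolding gf_def by (rule CollectD)
      then have "{s \<in> {q \<in> hook_pairs k. size (fst q) = i}. pair_wt x y s = \<eta>} \<noteq> {}"
        by (metis card.empty)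
      then show "i \<in> {..k}" by (auto simp: hook_pairs_def)
    qed
  qed simp
  also have "\<dots> = gf (hook_pairs k) (pair_wt x y) \<eta>"
    by (rule gf_fibres[OF tame, symmetric])
  finally show "hook_schur (one_row k) x y \<eta> = gf (hook_pairs k) (pair_wt x y) \<eta>" .
qed

section \<open>Configurations as pairs of multisets and sets\<close>

text \<open>Inverse to the enumeration in \<open>qvars\<close>: the position of the variable with
  index \<open>j\<close> and exponent s + 1/2.\<close>

definition pos :: "nat \<Rightarrow> nat \<Rightarrow> nat \<Rightarrow> nat" where
  "pos r j s = s * r + (j - 1)"

lemma pos_mod_div:
  assumes "1 \<le> j" "j \<le> r"
  shows "pos r j s mod r + 1 = j" "pos r j s div r = s"
  using assms by (cases j; simp add: pos_def)+

lemma pos_inv: "pos r (t mod r + 1) (t div r) = t"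
  by (simp add: pos_def)

text \<open>The variable number \<open>t\<close> has exponent t div r + 1/2, and |i + 1/2| takes
  this value at exactly two mode numbers, one on each side of 0; \<open>s\<close> chooses the
  side.\<close>

definition mode_at :: "(nat \<Rightarrow> idx) \<Rightarrow> nat \<Rightarrow> bool \<Rightarrow> nat \<Rightarrow> mode" where
  "mode_at e r s t = (e (t mod r + 1), if s then - int (t div r) - 1 else int (t div r))"

type_synonym quad = "(nat multiset \<times> nat set) \<times> (nat multiset \<times> nat set)"

text \<open>Multisets record bosons, sets record fermions; the primed pair describes the modes
  \<open>i \<ge> 0\<close>, whose particles have charge -1 and correspond to the inverse
  variables.\<close>

definition cfg_of :: "nat \<Rightarrow> nat \<Rightarrow> quad \<Rightarrow> cfg" where
  "cfg_of m n = (\<lambda>((A, B), (A', B')) (a, i). case a of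
      Od j \<Rightarrow> if 1 \<le> j \<and> j \<le> n then (if i < 0 then count A (pos n j (nat (- i - 1))) else count A' (pos n j (nat i))) else 0
    | Ev j \<Rightarrow> if 1 \<le> j \<and> j \<le> m then (if (if i < 0 then pos m j (nat (- i - 1)) \<in> B else pos m j (nat i) \<in> B') then 1 else 0) else 0)"

definition quad_set :: "int \<Rightarrow> quad set" where
  "quad_set l = {((A, B), (A', B')). finite B \<and> finite B' \<and>
     int (size A + card B) - int (size A' + card B') = l}"

lemma mode_at_pos:
  assumes "1 \<le> j" "j \<le> r"
  shows "i < 0 \<Longrightarrow> mode_at e r True (pos r j (nat (- i - 1))) = (e j, i)"
    and "0 \<le> i \<Longrightarrow> mode_at e r False (pos r j (nat i)) = (e j, i)"
  unfolding mode_at_def pos_mod_div[OF assms] by simp_all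

lemma inj_mode_at: "inj e \<Longrightarrow> inj (mode_at e r s)"
proof (rule injI)
  fix t t' assume e: "inj e" and eq: "mode_at e r s t = mode_at e r s t'"
  then have "t mod r = t' mod r" by (auto simp: mode_at_def dest: injD)
  moreover have "t div r = t' div r" using eq by (auto simp: mode_at_def split: if_splits)
  ultimately show "t = t'" by (metis div_mult_mod_eq)
qed

lemma inj_Ev: "inj Ev" and inj_Od: "inj Od"
  by (auto simp: inj_def)

context
  fixes m n :: nat
  assumes mn: "1 \<le> m" "1 \<le> n"
begin

lemma cfg_of_mode_at:
  "cfg_of m n ((A, B), (A', B')) (mode_at Od n True t) = count A t"
  "cfg_of m n ((A, B), (A', B')) (mode_at Ev m True t) = (if t \<in> B then 1 else 0)"
  "cfg_of m n ((A, B), (A', B')) (mode_at Od n False t) = count A' t"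
  "cfg_of m n ((A, B), (A', B')) (mode_at Ev m False t) = (if t \<in> B' then 1 else 0)"
proof -
  have "Suc (t mod n) \<le> n" "Suc (t mod m) \<le> m"
    using mn by (simp_all add: Suc_le_eq)
  moreover have "pos n (Suc (t mod n)) (t div n) = t" "pos m (Suc (t mod m)) (t div m) = t"
    using pos_inv[of n t] pos_inv[of m t] by simp_all
  ultimately show "cfg_of m n ((A, B), (A', B')) (mode_at Od n True t) = count A t"
    "cfg_of m n ((A, B), (A', B')) (mode_at Ev m True t) = (if t \<in> B then 1 else 0)"
    "cfg_of m n ((A, B), (A', B')) (mode_at Od n False t) = count A' t"
    "cfg_of m n ((A, B), (A', B')) (mode_at Ev m False t) = (if t \<in> B' then 1 else 0)"
    by (simp_all add: cfg_of_def mode_at_def)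
qed

lemma cfg_of_support:
  "{p. cfg_of m n ((A, B), (A', B')) p \<noteq> 0} \<subseteq>
    (mode_at Od n True ` set_mset A \<union> mode_at Ev m True ` B) \<union>
    (mode_at Od n False ` set_mset A' \<union> mode_at Ev m False ` B')"
proof
  fix p assume p: "p \<in> {p. cfg_of m n ((A, B), (A', B')) p \<noteq> 0}"
  obtain a i where ai: "p = (a, i)" by (cases p)
  let ?s = "if i < 0 then nat (- i - 1) else nat i"
  show "p \<in> (mode_at Od n True ` set_mset A \<union> mode_at Ev m True ` B) \<union>
    (mode_at Od n False ` set_mset A' \<union> mode_at Ev m False ` B')"
  proof (cases a)
    case (Ev j)
    then have j: "1 \<le> j" "j \<le> m" and mem: "if i < 0 then pos m j ?s \<in> B else pos m j ?s \<in> B'"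
      using p by (auto simp: cfg_of_def ai split: if_splits)
    show ?thesis
    proof (cases "i < 0")
      case True
      then have "p = mode_at Ev m True (pos m j ?s)" using mode_at_pos(1)[OF j True, of Ev] by (simp add: ai Ev)
      then show ?thesis using mem True by simp
    next
      case False
      then have "p = mode_at Ev m False (pos m j ?s)" using mode_at_pos(2)[OF j, of i Ev] by (simp add: ai Ev)
      then show ?thesis using mem False by simp
    qed
  next
    case (Od j)
    then have j: "1 \<le> j" "j \<le> n" and mem: "if i < 0 then pos n j ?s \<in># A else pos n j ?s \<in># A'"
      using p by (auto simp: cfg_of_def ai split: if_splits)
    show ?thesis
    proof (cases "i < 0")
      case True
      then have "p = mode_at Od n True (pos n j ?s)" using mode_at_pos(1)[OF j True, of Od] by (simp add: ai Od)
      then show ?thesis using mem True by simp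
    next
      case False
      then have "p = mode_at Od n False (pos n j ?s)" using mode_at_pos(2)[OF j, of i Od] by (simp add: ai Od)
      then show ?thesis using mem False by simp
    qed
  qed
qed

lemma cfg_of_cfgs:
  assumes "finite B" "finite B'"
  shows "cfg_of m n ((A, B), (A', B')) \<in> cfgs m n"
proof -
  have "finite {p. cfg_of m n ((A, B), (A', B')) p \<noteq> 0}"
    by (rule finite_subset[OF cfg_of_support]) (use assms in simp)
  moreover have "fst p \<in> idxs m n \<and> (fermi p \<longrightarrow> cfg_of m n ((A, B), (A', B')) p \<le> 1)"
    if "cfg_of m n ((A, B), (A', B')) p \<noteq> 0" for p
    using that by (cases p; cases "fst p") (auto simp: cfg_of_def idxs_def split: if_splits)
  ultimately show ?thesis unfolding cfgs_def by blast
qed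

lemma sum_mset_count:
  fixes f :: "'b \<Rightarrow> 'a::comm_ring_1"
  assumes "finite F"
  shows "set_mset A \<subseteq> F \<Longrightarrow> (\<Sum>t\<in>F. of_nat (count A t) * f t) = (\<Sum>t\<in>#A. f t)"
proof (induction A)
  case (add x A)
  have "(\<Sum>t\<in>F. of_nat (count (add_mset x A) t) * f t)
      = (\<Sum>t\<in>F. (if t = x then f x else 0) + of_nat (count A t) * f t)"
    by (rule sum.cong) (auto simp: algebra_simps)
  then show ?case using add assms by (simp add: sum.distrib)
qed simp

lemma lsum_cfg_of:
  assumes "finite B" "finite B'"
  shows "lsum g (cfg_of m n ((A, B), (A', B'))) =
    (\<Sum>t\<in>#A. g (mode_at Od n True t)) + (\<Sum>t\<in>B. g (mode_at Ev m True t))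
    + ((\<Sum>t\<in>#A'. g (mode_at Od n False t)) + (\<Sum>t\<in>B'. g (mode_at Ev m False t)))"
proof -
  let ?c = "cfg_of m n ((A, B), (A', B'))"
  let ?h = "\<lambda>p. of_nat (?c p) * g p"
  have dj: "mode_at e r True t \<noteq> mode_at e' r' False t'" "mode_at Od n s t \<noteq> mode_at Ev m s' t'" for e e' r r' s s' t t'
    by (auto simp: mode_at_def)
  have "lsum g ?c = (\<Sum>p\<in>(mode_at Od n True ` set_mset A \<union> mode_at Ev m True ` B) \<union>
    (mode_at Od n False ` set_mset A' \<union> mode_at Ev m False ` B'). ?h p)"
    by (rule lsum_superset[OF _ cfg_of_support]) (use assms in simp)
  also have "\<dots> = (\<Sum>p\<in>mode_at Od n True ` set_mset A \<union> mode_at Ev m True ` B. ?h p) +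
    (\<Sum>p\<in>mode_at Od n False ` set_mset A' \<union> mode_at Ev m False ` B'. ?h p)"
    by (rule sum.union_disjoint) (use assms in simp, use assms in simp, use dj(1) in blast)
  also have "(\<Sum>p\<in>mode_at Od n True ` set_mset A \<union> mode_at Ev m True ` B. ?h p) =
     (\<Sum>p\<in>mode_at Od n True ` set_mset A. ?h p) + (\<Sum>p\<in>mode_at Ev m True ` B. ?h p)"
    by (rule sum.union_disjoint) (use assms in simp, use assms in simp, use dj(2) in blast)
  also have "(\<Sum>p\<in>mode_at Od n False ` set_mset A' \<union> mode_at Ev m False ` B'. ?h p) =
     (\<Sum>p\<in>mode_at Od n False ` set_mset A'. ?h p) + (\<Sum>p\<in>mode_at Ev m False ` B'. ?h p)"
    by (rule sum.union_disjoint) (use assms in simp, use assms in simp, use dj(2) in blast)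
  also have "(\<Sum>p\<in>mode_at Od n True ` set_mset A. ?h p) = (\<Sum>t\<in>#A. g (mode_at Od n True t))"
    using sum_mset_count[of "set_mset A" A "\<lambda>t. g (mode_at Od n True t)"]
    by (simp add: sum.reindex inj_on_subset[OF inj_mode_at[OF inj_Od]] cfg_of_mode_at)
  also have "(\<Sum>p\<in>mode_at Od n False ` set_mset A'. ?h p) = (\<Sum>t\<in>#A'. g (mode_at Od n False t))"
    using sum_mset_count[of "set_mset A'" A' "\<lambda>t. g (mode_at Od n False t)"]
    by (simp add: sum.reindex inj_on_subset[OF inj_mode_at[OF inj_Od]] cfg_of_mode_at)
  also have "(\<Sum>p\<in>mode_at Ev m True ` B. ?h p) = (\<Sum>t\<in>B. g (mode_at Ev m True t))"
    by (simp add: sum.reindex inj_on_subset[OF inj_mode_at[OF inj_Ev]] cfg_of_mode_at)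
  also have "(\<Sum>p\<in>mode_at Ev m False ` B'. ?h p) = (\<Sum>t\<in>B'. g (mode_at Ev m False t))"
    by (simp add: sum.reindex inj_on_subset[OF inj_mode_at[OF inj_Ev]] cfg_of_mode_at)
  finally show ?thesis .
qed

lemma cfg_of_bij: "bij_betw (cfg_of m n) (quad_set l) (cfgs_ch m n l)"
proof (rule bij_betwI')
  have charge: "lsum mode_sign (cfg_of m n ((A, B), (A', B'))) = int (size A + card B) - int (size A' + card B')"
    if "finite B" "finite B'" for A B A' B'
    unfolding lsum_cfg_of[OF that] by (simp add: mode_sign_def mode_at_def)
  fix x assume x: "x \<in> quad_set l"
  obtain A B A' B' where xe: "x = ((A, B), (A', B'))" by (metis prod.exhaust)
  show "cfg_of m n x \<in> cfgs_ch m n l"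
    using x cfg_of_cfgs charge by (auto simp: xe quad_set_def cfgs_ch_def)
  fix y assume y: "y \<in> quad_set l"
  obtain D F D' F' where ye: "y = ((D, F), (D', F'))" by (metis prod.exhaust)
  show "cfg_of m n x = cfg_of m n y \<longleftrightarrow> x = y"
  proof
    assume eq: "cfg_of m n x = cfg_of m n y"
    have "A = D"
      by (rule multiset_eqI) (use fun_cong[OF eq, of "mode_at Od n True _"] in \<open>simp add: xe ye cfg_of_mode_at\<close>)
    moreover have "A' = D'"
      by (rule multiset_eqI) (use fun_cong[OF eq, of "mode_at Od n False _"] in \<open>simp add: xe ye cfg_of_mode_at\<close>)
    moreover have "t \<in> B \<longleftrightarrow> t \<in> F" for t
      using fun_cong[OF eq, of "mode_at Ev m True t"] by (simp add: xe ye cfg_of_mode_at split: if_splits)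
    moreover have "t \<in> B' \<longleftrightarrow> t \<in> F'" for t
      using fun_cong[OF eq, of "mode_at Ev m False t"] by (simp add: xe ye cfg_of_mode_at split: if_splits)
    ultimately show "x = y" unfolding xe ye by blast
  qed simp
next
  fix c assume "c \<in> cfgs_ch m n l"
  then have c: "c \<in> cfgs m n" "lsum mode_sign c = l" by (auto simp: cfgs_ch_def)
  have fin: "finite {t. c (mode_at e r s t) \<noteq> 0}" if "inj e" for e r s
    using finite_vimageI[OF cfgs_finite[OF c(1)] inj_mode_at[OF that, of r s]] by (simp add: vimage_def)
  have fin': "finite {t. 0 < c (mode_at e r s t)}" if "inj e" for e r s
    using fin[OF that, of r s] by simp
  define A where "A = Abs_multiset (\<lambda>t. c (mode_at Od n True t))"
  define A' where "A' = Abs_multiset (\<lambda>t. c (mode_at Od n False t))"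
  define B where "B = {t. c (mode_at Ev m True t) \<noteq> 0}"
  define B' where "B' = {t. c (mode_at Ev m False t) \<noteq> 0}"
  have cA: "count A t = c (mode_at Od n True t)" "count A' t = c (mode_at Od n False t)" for t
    unfolding A_def A'_def using fin'[OF inj_Od] by (simp_all add: count_Abs_multiset)
  have fB: "finite B" "finite B'" unfolding B_def B'_def by (intro fin inj_Ev)+
  have eq: "cfg_of m n ((A, B), (A', B')) = c"
  proof
    fix p :: mode
    obtain a i where p: "p = (a, i)" by (cases p)
    have out: "c p = 0" if "a \<notin> idxs m n" using cfgs_idx[OF c(1), of p] that by (auto simp: p)
    have le: "c p = 0 \<or> c p = 1" if "parity a = 0"
      using cfgs_fermi[OF c(1), of p] that by (auto simp: p)
    show "cfg_of m n ((A, B), (A', B')) p = c p"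
    proof (cases a)
      case (Ev j)
      show ?thesis
      proof (cases "1 \<le> j \<and> j \<le> m")
        case True
        then show ?thesis using mode_at_pos[of j m i Ev] le Ev
          by (cases "i < 0") (auto simp: cfg_of_def p B_def B'_def)
      next
        case False
        then have "a \<notin> idxs m n" using Ev by (auto simp: idxs_def)
        then show ?thesis using out False Ev by (auto simp: cfg_of_def p)
      qed
    next
      case (Od j)
      show ?thesis
      proof (cases "1 \<le> j \<and> j \<le> n")
        case True
        then show ?thesis using mode_at_pos[of j n i Od] Od
          by (cases "i < 0") (auto simp: cfg_of_def p cA)
      next
        case False
        then have "a \<notin> idxs m n" using Od by (auto simp: idxs_def)
        then show ?thesis using out False Od by (auto simp: cfg_of_def p)
      qed
    qed
  qed
  have "lsum mode_sign (cfg_of m n ((A, B), (A', B'))) = int (size A + card B) - int (size A' + card B')"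
    unfolding lsum_cfg_of[OF fB] by (simp add: mode_sign_def mode_at_def)
  then have "((A, B), (A', B')) \<in> quad_set l" using fB c(2) by (simp add: quad_set_def eq)
  then show "\<exists>x\<in>quad_set l. c = cfg_of m n x" using eq by metis
qed

end

section \<open>The character\<close>

lemma msum_app: "msum x A h = (\<Sum>t\<in>#A. x t h)"
proof (induction A)
  case (add t A)
  then show ?case
    unfolding msum_def image_mset_add_mset sum_mset.add_mset plus_fun_apply by (simp only:)
qed (simp add: msum_def)

text \<open>The half-integers in \<open>mode_energy\<close> are the exponents of \<open>q\<close>,
  and the negative charge of the modes \<open>i \<ge> 0\<close> inverts the variables.\<close>

lemma mwt_mode_at:
  "mwt (mode_at Od n True t) = qvars wt_del n t"
  "mwt (mode_at Ev m True t) = qvars wt_eps m t"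
  "mwt (mode_at Od n False t) = qvars (\<lambda>j. - wt_del j) n t"
  "mwt (mode_at Ev m False t) = qvars (\<lambda>i. - wt_eps i) m t"
  by (rule ext, simp add: mwt_def mode_at_def qvars_def mode_sign_def mode_energy_def awt_eps awt_del q_wt_def wt_scale_def algebra_simps)+

definition quad_wt :: "nat \<Rightarrow> nat \<Rightarrow> quad \<Rightarrow> weight" where
  "quad_wt m n = (\<lambda>(q, q'). pair_wt (qvars wt_del n) (qvars wt_eps m) q
     + pair_wt (qvars (\<lambda>j. - wt_del j) n) (qvars (\<lambda>i. - wt_eps i) m) q')"

lemma deg_eps: "deg (wt_eps i) = 0" "deg (wt_del i) = 0" "deg (- wt_eps i) = 0" "deg (- wt_del i) = 0"
  by (simp_all add: deg_def wt_eps_def wt_del_def d_elt_def)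

context
  fixes m n :: nat
  assumes mn: "1 \<le> m" "1 \<le> n"
begin

lemma cwt_cfg_of:
  assumes "q \<in> quad_set l"
  shows "cwt l (cfg_of m n q) = quad_wt m n q + q_wt (- (\<bar>real_of_int l\<bar> / 2))"
proof
  fix h
  obtain A B A' B' where q: "q = ((A, B), (A', B'))" by (metis prod.exhaust)
  have fin: "finite B" "finite B'" using assms by (auto simp: q quad_set_def)
  show "cwt l (cfg_of m n q) h = (quad_wt m n q + q_wt (- (\<bar>real_of_int l\<bar> / 2))) h"
    unfolding cwt_def q lsum_cfg_of[OF mn fin] quad_wt_def pair_wt_def split_conv plus_fun_apply
      msum_app sum_app mwt_mode_at ..
qed

lemma tame_qvars:
  "tame_set (UNIV \<times> {B. finite B}) (pair_wt (qvars wt_del n) (qvars wt_eps m))"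
  "tame_set (UNIV \<times> {B. finite B}) (pair_wt (qvars (\<lambda>j. - wt_del j) n) (qvars (\<lambda>i. - wt_eps i) m))"
  by (intro tame_pairs tame_multisets tame_subsets mn deg_eps)+

lemma tame_quads: "tame_set (quad_set l) (quad_wt m n)"
proof (rule tame_set_subset)
  show "tame_set ((UNIV \<times> {B. finite B}) \<times> (UNIV \<times> {B. finite B})) (quad_wt m n)"
    unfolding quad_wt_def by (rule tame_set_times[OF tame_qvars])
qed (auto simp: quad_set_def)

text \<open>A configuration determines the pair of its particle numbers on the two sides, so the
  double sum runs over the fibres of \<open>?k\<close>, and the charge condition is constant on each
  of them.\<close>

lemma hook_sum:
  "Sum_any (\<lambda>(\<mu>, \<nu>). if int \<mu> - int \<nu> = l
      then fmult (hook_schur (one_row \<mu>) (qvars wt_del n) (qvars wt_eps m))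
        (hook_schur (one_row \<nu>) (qvars (\<lambda>j. - wt_del j) n) (qvars (\<lambda>i. - wt_eps i) m)) \<eta>
      else 0) = gf (quad_set l) (quad_wt m n) \<eta>"
proof -
  let ?k = "\<lambda>((A, B), (A', B')). (size A + card B, size A' + card B') :: nat \<times> nat"
  have "(if int \<mu> - int \<nu> = l
      then fmult (hook_schur (one_row \<mu>) (qvars wt_del n) (qvars wt_eps m))
        (hook_schur (one_row \<nu>) (qvars (\<lambda>j. - wt_del j) n) (qvars (\<lambda>i. - wt_eps i) m)) \<eta>
      else 0) = gf {q \<in> quad_set l. ?k q = (\<mu>, \<nu>)} (quad_wt m n) \<eta>" for \<mu> \<nu>
  proof (cases "int \<mu> - int \<nu> = l")
    case True
    have tame: "tame_set (hook_pairs \<mu>) (pair_wt (qvars wt_del n) (qvars wt_eps m))"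
      "tame_set (hook_pairs \<nu>) (pair_wt (qvars (\<lambda>j. - wt_del j) n) (qvars (\<lambda>i. - wt_eps i) m))"
      by (rule tame_set_subset[OF tame_qvars(1)], auto simp: hook_pairs_def)
        (rule tame_set_subset[OF tame_qvars(2)], auto simp: hook_pairs_def)
    have hs: "hook_schur (one_row \<mu>) (qvars wt_del n) (qvars wt_eps m) =
        gf (hook_pairs \<mu>) (pair_wt (qvars wt_del n) (qvars wt_eps m))"
      "hook_schur (one_row \<nu>) (qvars (\<lambda>j. - wt_del j) n) (qvars (\<lambda>i. - wt_eps i) m) =
        gf (hook_pairs \<nu>) (pair_wt (qvars (\<lambda>j. - wt_del j) n) (qvars (\<lambda>i. - wt_eps i) m))"
      by (intro hook_schur_row tame_multisets tame_subsets mn deg_eps)+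
    have "{q \<in> quad_set l. ?k q = (\<mu>, \<nu>)} = hook_pairs \<mu> \<times> hook_pairs \<nu>"
      using True by (auto simp: quad_set_def hook_pairs_def)
    then show ?thesis using True unfolding hs fmult_gf[OF tame] quad_wt_def by simp
  next
    case False
    then have e: "{q \<in> quad_set l. ?k q = (\<mu>, \<nu>)} = {}" by (auto simp: quad_set_def)
    show ?thesis unfolding e using False by (simp add: gf_def)
  qed
  then have "(\<lambda>(\<mu>, \<nu>). if int \<mu> - int \<nu> = l
      then fmult (hook_schur (one_row \<mu>) (qvars wt_del n) (qvars wt_eps m))
        (hook_schur (one_row \<nu>) (qvars (\<lambda>j. - wt_del j) n) (qvars (\<lambda>i. - wt_eps i) m)) \<eta>
      else 0) = (\<lambda>i. gf {q \<in> quad_set l. ?k q = i} (quad_wt m n) \<eta>)"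
    by (auto simp only: fun_eq_iff split_paired_All split_conv)
  then show ?thesis unfolding gf_fibres[OF tame_quads, of l \<eta> ?k] by (simp only:)
qed

lemma gf_quads_cfgs:
  "gf (quad_set l) (quad_wt m n) (\<eta> - q_wt (- (\<bar>real_of_int l\<bar> / 2))) = gf (cfgs_ch m n l) (cwt l) \<eta>"
proof -
  let ?\<theta> = "q_wt (- (\<bar>real_of_int l\<bar> / 2))"
  have "gf (quad_set l) (quad_wt m n) (\<eta> - ?\<theta>) = gf (quad_set l) (\<lambda>q. quad_wt m n q + ?\<theta>) \<eta>"
    unfolding gf_def by (rule arg_cong[where f = card]) (auto simp: eq_diff_eq)
  also have "gf (quad_set l) (\<lambda>q. quad_wt m n q + ?\<theta>) = gf (cfgs_ch m n l) (cwt l)"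
    by (rule gf_bij[OF cfg_of_bij[OF mn]]) (rule cwt_cfg_of)
  finally show ?thesis .
qed

lemma finite_weight: "finite {c \<in> cfgs_ch m n l. cwt l c = \<eta>}"
proof -
  let ?\<theta> = "q_wt (- (\<bar>real_of_int l\<bar> / 2))"
  have "{c \<in> cfgs_ch m n l. cwt l c = \<eta>} \<subseteq> cfg_of m n ` {q \<in> quad_set l. quad_wt m n q = \<eta> - ?\<theta>}"
  proof
    fix c assume c: "c \<in> {c \<in> cfgs_ch m n l. cwt l c = \<eta>}"
    then obtain q where q: "q \<in> quad_set l" "c = cfg_of m n q"
      using bij_betw_imp_surj_on[OF cfg_of_bij[OF mn, of l]] by blast
    then have "quad_wt m n q + ?\<theta> = \<eta>" using c cwt_cfg_of[OF q(1)] by auto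
    then have "quad_wt m n q = \<eta> - ?\<theta>" by (rule eq_diff_eq[THEN iffD2])
    then show "c \<in> cfg_of m n ` {q \<in> quad_set l. quad_wt m n q = \<eta> - ?\<theta>}" using q by blast
  qed
  then show ?thesis by (rule finite_subset) (intro finite_imageI tame_set_fibre[OF tame_quads])
qed

end

section \<open>Weights as functionals, and the weight spaces of the module\<close>

lemma rootv_cartan: "a \<in> idxs m n \<Longrightarrow> rootv a a 0 \<in> cartan_hd m n"
proof -
  assume "a \<in> idxs m n"
  then have "rootv a a 0 \<in> glhat m n" by (intro rootv_glhat)
  then show ?thesis by (auto simp: cartan_hd_def cartan_def rootv_def loop_def munit_def)
qed

lemma d_cartan: "d_elt \<in> cartan_hd m n"
  using d_glhat[of m n] by (auto simp: cartan_hd_def cartan_def d_elt_def)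

lemma dual_expand:
  assumes "\<eta> \<in> dual_hd m n"
  shows "\<eta> = (\<Sum>i=1..m. wt_scale (\<eta> (rootv (Ev i) (Ev i) 0)) (wt_eps i))
    + (\<Sum>j=1..n. wt_scale (\<eta> (rootv (Od j) (Od j) 0)) (wt_del j)) + wt_scale (\<eta> d_elt) wt_delta"
proof -
  obtain a b c where \<eta>: "\<eta> = (\<Sum>i=1..m. wt_scale (a i) (wt_eps i)) + (\<Sum>j=1..n. wt_scale (b j) (wt_del j))
     + wt_scale c wt_delta"
    using assms by (auto simp: dual_hd_def)
  have ev: "wt_eps i (rootv x x 0) = (if x = Ev i then 1 else 0)"
    "wt_del i (rootv x x 0) = (if x = Od i then 1 else 0)" "wt_delta (rootv x x 0) = 0"
    "wt_eps i d_elt = 0" "wt_del i d_elt = 0" "wt_delta d_elt = 1" for i x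
    by (auto simp: wt_eps_def wt_del_def wt_delta_def rootv_def loop_def munit_def d_elt_def)
  have 1: "\<eta> (rootv (Ev i) (Ev i) 0) = a i" if "i \<in> {1..m}" for i
  proof -
    have "(\<Sum>j=1..m. a j * (if Ev i = Ev j then 1 else 0)) = (\<Sum>j=1..m. if j = i then a i else 0)"
      by (rule sum.cong) auto
    then show ?thesis using that
      unfolding \<eta> plus_fun_apply sum_app wt_scale_def ev by simp
  qed
  have 2: "\<eta> (rootv (Od i) (Od i) 0) = b i" if "i \<in> {1..n}" for i
  proof -
    have "(\<Sum>j=1..n. b j * (if Od i = Od j then 1 else 0)) = (\<Sum>j=1..n. if j = i then b i else 0)"
      by (rule sum.cong) auto
    then show ?thesis using that
      unfolding \<eta> plus_fun_apply sum_app wt_scale_def ev by simp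
  qed
  have 3: "\<eta> d_elt = c"
    unfolding \<eta> plus_fun_apply sum_app wt_scale_def ev by simp
  have "(\<Sum>i=1..m. wt_scale (\<eta> (rootv (Ev i) (Ev i) 0)) (wt_eps i)) = (\<Sum>i=1..m. wt_scale (a i) (wt_eps i))"
    by (rule sum.cong[OF refl]) (simp only: 1)
  moreover have "(\<Sum>j=1..n. wt_scale (\<eta> (rootv (Od j) (Od j) 0)) (wt_del j)) = (\<Sum>j=1..n. wt_scale (b j) (wt_del j))"
    by (rule sum.cong[OF refl]) (simp only: 2)
  ultimately show ?thesis unfolding 3 using \<eta> by (simp only:)
qed

text \<open>Weights are functions on all triples, so agreement on the Cartan subalgebra gives
  equality only because members of \<open>dual_hd\<close> are combinations of the coordinates read
  off there.\<close>

lemma dual_ext: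
  assumes "\<eta> \<in> dual_hd m n" "\<theta> \<in> dual_hd m n" "\<And>h. h \<in> cartan_hd m n \<Longrightarrow> \<eta> h = \<theta> h"
  shows "\<eta> = \<theta>"
proof -
  have 1: "\<eta> (rootv (Ev i) (Ev i) 0) = \<theta> (rootv (Ev i) (Ev i) 0)" if "i \<in> {1..m}" for i
    by (rule assms(3)[OF rootv_cartan]) (use that in \<open>auto simp: idxs_def\<close>)
  have 2: "\<eta> (rootv (Od i) (Od i) 0) = \<theta> (rootv (Od i) (Od i) 0)" if "i \<in> {1..n}" for i
    by (rule assms(3)[OF rootv_cartan]) (use that in \<open>auto simp: idxs_def\<close>)
  have 3: "\<eta> d_elt = \<theta> d_elt" by (rule assms(3)[OF d_cartan])
  have "(\<Sum>i=1..m. wt_scale (\<eta> (rootv (Ev i) (Ev i) 0)) (wt_eps i)) =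
      (\<Sum>i=1..m. wt_scale (\<theta> (rootv (Ev i) (Ev i) 0)) (wt_eps i))"
    by (rule sum.cong[OF refl]) (simp only: 1)
  moreover have "(\<Sum>j=1..n. wt_scale (\<eta> (rootv (Od j) (Od j) 0)) (wt_del j)) =
      (\<Sum>j=1..n. wt_scale (\<theta> (rootv (Od j) (Od j) 0)) (wt_del j))"
    by (rule sum.cong[OF refl]) (simp only: 2)
  ultimately show ?thesis
    by (subst dual_expand[OF assms(1)], subst dual_expand[OF assms(2)]) (simp only: 3)
qed

lemma cwt_dual:
  assumes "c \<in> cfgs m n" shows "cwt l c \<in> dual_hd m n"
proof -
  have split: "(\<Sum>x\<in>idxs m n. f x) = (\<Sum>i=1..m. f (Ev i)) + (\<Sum>j=1..n. f (Od j))" for f :: "idx \<Rightarrow> complex"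
  proof -
    have "(\<Sum>x\<in>idxs m n. f x) = (\<Sum>x\<in>Ev ` {1..m}. f x) + (\<Sum>x\<in>Od ` {1..n}. f x)"
      unfolding idxs_def by (rule sum.union_disjoint) auto
    then show ?thesis by (simp add: sum.reindex inj_on_subset[OF inj_Ev] inj_on_subset[OF inj_Od])
  qed
  have "cwt l c = (\<Sum>i=1..m. wt_scale (lsum (acount (Ev i)) c) (wt_eps i))
     + (\<Sum>j=1..n. wt_scale (lsum (acount (Od j)) c) (wt_del j))
     + wt_scale (lsum mode_energy c + of_int \<bar>l\<bar> / 2) wt_delta"
  proof
    fix h
    show "cwt l c h = ((\<Sum>i=1..m. wt_scale (lsum (acount (Ev i)) c) (wt_eps i))
     + (\<Sum>j=1..n. wt_scale (lsum (acount (Od j)) c) (wt_del j))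
     + wt_scale (lsum mode_energy c + of_int \<bar>l\<bar> / 2) wt_delta) h"
      unfolding cwt_eq[OF assms] split plus_fun_apply sum_app wt_scale_def awt_eps awt_del
      by (simp only: mult.commute)
  qed
  then show ?thesis unfolding dual_hd_def by (intro CollectI exI)
qed

context L_module
begin

text \<open>The basis consists of weight vectors; comparing coefficients in act h u = \<eta>(h) u
  removes all basis vectors of a different weight.\<close>

lemma weight_space_span:
  assumes b: "inj_on b (cfgs_ch m n l)" "independent (b ` cfgs_ch m n l)" "span (b ` cfgs_ch m n l) = UNIV"
    and wt: "\<And>c h. c \<in> cfgs_ch m n l \<Longrightarrow> h \<in> cartan_hd m n \<Longrightarrow> act h (b c) = scale (cwt l c h) (b c)"
    and \<eta>: "\<eta> \<in> dual_hd m n"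
  shows "weight_space scale m n act \<eta> = span (b ` {c \<in> cfgs_ch m n l. cwt l c = \<eta>})"
proof (intro equalityI subsetI)
  have hgl: "h \<in> glhat m n" if "h \<in> cartan_hd m n" for h
    using that by (cases h) (simp add: cartan_hd_def cartan_def)
  fix u assume "u \<in> span (b ` {c \<in> cfgs_ch m n l. cwt l c = \<eta>})"
  then show "u \<in> weight_space scale m n act \<eta>"
  proof (induction rule: span_induct_alt)
    case base
    show ?case by (simp add: weight_space_def act_lin hgl)
  next
    case (step s y z)
    then obtain c where c: "c \<in> cfgs_ch m n l" "cwt l c = \<eta>" "y = b c" by blast
    show ?case unfolding weight_space_def
    proof (intro CollectI ballI)
      fix h assume h: "h \<in> cartan_hd m n"
      have "act h z = scale (\<eta> h) z" using step.IH h by (simp add: weight_space_def)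
      then show "act h (scale s y + z) = scale (\<eta> h) (scale s y + z)"
        using wt[OF c(1) h] c(2,3) by (simp add: act_lin[OF hgl[OF h]] scale_right_distrib mult.commute)
    qed
  qed
next
  have hgl: "h \<in> glhat m n" if "h \<in> cartan_hd m n" for h
    using that by (cases h) (simp add: cartan_hd_def cartan_def)
  fix u assume u: "u \<in> weight_space scale m n act \<eta>"
  have "u \<in> span (b ` cfgs_ch m n l)" using b(3) by simp
  then obtain t r where t: "finite t" "t \<subseteq> b ` cfgs_ch m n l" "u = (\<Sum>a\<in>t. scale (r a) a)"
    unfolding span_explicit by blast
  have "scale (r a) a \<in> span (b ` {c \<in> cfgs_ch m n l. cwt l c = \<eta>})" if a: "a \<in> t" for a
  proof (cases "r a = 0")
    case True
    then show ?thesis by (simp add: span_zero)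
  next
    case False
    obtain c where c: "c \<in> cfgs_ch m n l" "a = b c" using a t(2) by blast
    define ch where "ch = inv_into (cfgs_ch m n l) b"
    have ch: "ch x \<in> cfgs_ch m n l" "b (ch x) = x" if "x \<in> t" for x
      using that t(2) inv_into_into[of x b "cfgs_ch m n l"] f_inv_into_f[of x b "cfgs_ch m n l"]
      by (auto simp: ch_def)
    have chc: "ch a = c" unfolding ch_def c(2) by (rule inv_into_f_f[OF b(1) c(1)])
    have "cwt l c h = \<eta> h" if h: "h \<in> cartan_hd m n" for h
    proof -
      have hom: "module_hom scale scale (act h)"
        using act_linear[OF hgl[OF h]] unfolding Vector_Spaces.linear_iff_module_hom .
      have "act h u = (\<Sum>x\<in>t. scale (r x) (act h x))"
        unfolding t(3) module_hom.sum[OF hom] module_hom.scale[OF hom] ..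
      also have "\<dots> = (\<Sum>x\<in>t. scale (r x * cwt l (ch x) h) x)"
        by (rule sum.cong[OF refl]) (use wt[OF ch(1) h] ch(2) in simp)
      finally have "(\<Sum>x\<in>t. scale (r x * cwt l (ch x) h) x) = scale (\<eta> h) u"
        using u h by (simp add: weight_space_def)
      also have "\<dots> = (\<Sum>x\<in>t. scale (r x * \<eta> h) x)"
        unfolding t(3) scale_sum_right by (simp add: mult.commute)
      finally have "(\<Sum>x\<in>t. scale (r x * (cwt l (ch x) h - \<eta> h)) x) = 0"
        by (simp add: right_diff_distrib scale_left_diff_distrib sum_subtractf)
      then have "r a * (cwt l (ch a) h - \<eta> h) = 0"
        using b(2)[unfolded independent_explicit_finite_subsets, rule_format, OF t(2,1) _ a,
          of "\<lambda>x. r x * (cwt l (ch x) h - \<eta> h)"] by simp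
      then show ?thesis using False by (simp add: chc)
    qed
    then have "cwt l c = \<eta>"
      using dual_ext[OF cwt_dual \<eta>, of c l] c(1) by (simp add: cfgs_ch_def)
    then show ?thesis using c by (intro span_scale span_base) blast
  qed
  then show "u \<in> span (b ` {c \<in> cfgs_ch m n l. cwt l c = \<eta>})"
    unfolding t(3) by (rule span_sum)
qed

theorem character_formula:
  "finite_multiplicities scale m n act \<and> character scale m n act = gf (cfgs_ch m n l) (cwt l)"
proof -
  obtain b where b: "inj_on b (cfgs_ch m n l)" "independent (b ` cfgs_ch m n l)" "span (b ` cfgs_ch m n l) = UNIV"
    "\<And>c h. c \<in> cfgs_ch m n l \<Longrightarrow> h \<in> cartan_hd m n \<Longrightarrow> act h (b c) = scale (cwt l c h) (b c)"
    using weight_basis by blast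
  let ?T = "\<lambda>\<eta>. {c \<in> cfgs_ch m n l. cwt l c = \<eta>}"
  note ws = weight_space_span[OF b]
  have fin: "finite (b ` ?T \<eta>)" for \<eta> by (rule finite_imageI[OF finite_weight[OF mn]])
  have "finite_multiplicities scale m n act"
    unfolding finite_multiplicities_def using ws fin by blast
  moreover have "character scale m n act \<eta> = gf (cfgs_ch m n l) (cwt l) \<eta>" for \<eta>
  proof (cases "\<eta> \<in> dual_hd m n")
    case True
    have sub: "?T \<eta> \<subseteq> cfgs_ch m n l" by blast
    have "independent (b ` ?T \<eta>)" by (rule independent_mono[OF b(2)]) blast
    then have "dim (span (b ` ?T \<eta>)) = card (b ` ?T \<eta>)" by (rule dim_span_eq_card_independent)
    also have "\<dots> = card (?T \<eta>)" by (rule card_image[OF inj_on_subset[OF b(1) sub]])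
    finally show ?thesis using True by (simp add: character_def ws gf_def)
  next
    case False
    then have e: "?T \<eta> = {}" using cwt_dual by (auto simp: cfgs_ch_def)
    show ?thesis unfolding gf_def e using False by (simp add: character_def)
  qed
  ultimately show ?thesis by blast
qed

end

theorem theorem5p2:
  fixes m n :: nat and l :: int
    and scale :: "complex \<Rightarrow> 'v::ab_group_add \<Rightarrow> 'v"
    and V :: "bit \<Rightarrow> 'v set"
    and act :: "glhat \<Rightarrow> 'v \<Rightarrow> 'v"
  assumes "m \<ge> 1" and "n \<ge> 1"
    and "is_L scale m n V act (Lambda_tilde m n l)"
  shows "finite_multiplicities scale m n act \<and>
    character scale m n act =
      fmult (fexp (q_wt (- (\<bar>real_of_int l\<bar> / 2))))
        (\<lambda>\<eta>. Sum_any (\<lambda>(\<mu>, \<nu>).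
           if int \<mu> - int \<nu> = l
           then fmult
             (hook_schur (one_row \<mu>) (qvars wt_del n) (qvars wt_eps m))
             (hook_schur (one_row \<nu>) (qvars (\<lambda>j. - wt_del j) n) (qvars (\<lambda>i. - wt_eps i) m))
             \<eta>
           else 0))"
proof -
  obtain v where irr: "irreducible_module scale m n V act"
    and hw: "highest_weight_vector scale m n V act (Lambda_tilde m n l) v"
    using assms(3) unfolding is_L_def by blast
  interpret glhat_module scale m n V act using irr unfolding irreducible_module_def by blast
  interpret L_module scale m n V act l v
    by unfold_locales (rule assms(1,2) irr hw)+
  \<comment> \<open>Multiplying by one exponential shifts the weight, here by the normalisation of
    \<open>d\<close> contained in \<open>cwt\<close>.\<close>
  have "gf (cfgs_ch m n l) (cwt l) = fmult (fexp (q_wt (- (\<bar>real_of_int l\<bar> / 2)))) (gf (quad_set l) (quad_wt m n))"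
    by (rule ext) (simp only: fmult_fexp gf_quads_cfgs[OF assms(1,2)])
  then show ?thesis
    using character_formula unfolding hook_sum[OF assms(1,2)] by (simp only:)
qed

end
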